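(* (a) Let $I$ be a tropical ideal in $\overline{\mathbb R}[x_1^{\pm1},\dots,x_n^{\pm1}]$. Then the variety $V(I)\subseteq\mathbb R^n$ is empty if and only if $I$ is the unit ideal $\langle0\rangle$ (where $0\in\mathbb R$ is the multiplicative identity of $\overline{\mathbb R}$). (b) More generally, let $\Sigma$ be a simplicial fan in $N_{\mathbb R}$ and let $I\subseteq\mathrm{Cox}(\mathrm{trop}(X_\Sigma))$ be a locally tropical ideal. Then the variety $V_\Sigma(I)\subseteq\mathrm{trop}(X_\Sigma)$ is empty if and only if $\mathrm{trop}(B_\Sigma)^d\subseteq I$ for some $d>0$.
   Context: $\overline{\mathbb R}=(\mathbb R\cup\{\infty\},\oplus=\min,\odot=+)$ is the tropical semiring. Polynomials over $\overline{\mathbb R}$ are formal (not functions). An ideal of a semiring is a nonempty subset closed under addition and under multiplication by elements of the semiring. Tropical toric varieties. $N\cong\mathbb Z^n$ is a lattice, $M=\mathrm{Hom}(N,\mathbb Z)$, $N_{\mathbb R}=N\otimes\mathbb R$; a fan means a (finite) rational polyhedral fan, as in toric geometry. For $\sigma\in\Sigma$ put $N(\sigma)=N_{\mathbb R}/\mathrm{span}(\sigma)$, and $\mathrm{trop}(X_\Sigma)=\coprod_{\sigma\in\Sigma}N(\sigma)$. Cox semiring. Let $s$ be the number of rays of $\Sigma$, $t=n-\dim\mathrm{span}(\Sigma)$, $m=s+t$, and $S=\mathrm{Cox}(\mathrm{trop}(X_\Sigma))=\overline{\mathbb R}[x_1,\dots,x_m]$. Write $N=N'\oplus N''$ where the rays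 of $\Sigma$ span $N'_{\mathbb R}$; $Q$ is an $m\times n$ matrix whose $i$th row for $i\le s$ is the first lattice point on the $i$th ray, and whose last $t$ rows form a basis of $N''$. $S$ is graded by $\mathrm{coker}(\mathbb Z^n\cong M\to\mathbb Z^m,\ \mathbf u\mapsto Q\mathbf u)$, with $\deg(x_i)$ the class of $\mathbf e_i$. Rays are identified with $\{1,\dots,s\}$ and cones with subsets of $\{1,\dots,s\}$. For $\sigma\in\Sigma$, $\mathbf x^{\hat\sigma}=\prod_{i\notin\sigma}x_i$ (product over $i\in\{1,\dots,m\}\setminus\sigma$). $\mathrm{trop}(B_\Sigma)=\langle\mathbf x^{\hat\sigma}:\sigma\in\Sigma\rangle\subseteq S$. The degree-$\mathbf 0$ part of the localization satisfies $(S_{\mathbf x^{\hat\sigma}})_{\mathbf 0}\cong\overline{\mathbb R}[\sigma^\vee\cap M]$, with $\mathbf x^{Q\mathbf u}$ corresponding to $\mathbf u$. Tropical and locally tropical ideals. An ideal $J\subseteq\overline{\mathbb R}[\sigma^\vee\cap M]$ (in particular, for $\sigma=\{\mathbf 0\}$, an ideal of $\overline{\mathbb R}[x_1^{\pm1},\dots,x_n^{\pm1}]$) is a tropical ideal if for every finite set $E$ of monomials the set of polynomials in $J$ with support in $E$ is the set of vectors of a valuated matroid on $E$; equivalently, this set $\mathcal V$ satisfies: for $f,g\in\mathcal V$ and a monomial $e\in E$ at which $f,g$ have equal coefficients $\ne\infty$, there is $h\in\mathcal V$ whose coefficient at $e$ is $\infty$, whose coefficient at each $e'\in E$ is at least the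 minimum of those of $f$ and $g$, with equality whenever those of $f$ and $g$ at $e'$ differ. A homogeneous ideal $I\subseteq S$ is locally tropical if $(IS_{\mathbf x^{\hat\sigma}})_{\mathbf 0}\subseteq\overline{\mathbb R}[\sigma^\vee\cap M]$ is a tropical ideal for every $\sigma\in\Sigma$. Varieties. For an ideal $I\subseteq\overline{\mathbb R}[x_1^{\pm1},\dots,x_n^{\pm1}]$, $V(I)=\{\mathbf w\in\mathbb R^n:$ the minimum in $f(\mathbf w)$ is achieved at least twice for all $f\in I\setminus\{\infty\}\}$. For a homogeneous ideal $I\subseteq S$ and $\sigma\in\Sigma$, let $I_{(\sigma)}=(IS_{\mathbf x^{\hat\sigma}}/\langle x_i\sim\infty:i\in\sigma\rangle)_{\mathbf 0}\subseteq\overline{\mathbb R}[\sigma^\perp\cap M]$ (the set of polynomials obtained from elements of $(IS_{\mathbf x^{\hat\sigma}})_{\mathbf 0}$ by deleting all terms divisible by some $x_i$, $i\in\sigma$). $V_\sigma(I)$ is the set of $\mathbf w\in N(\sigma)$ such that for every $f\in I_{(\sigma)}$, $f\neq\infty$, the minimum in $f(\mathbf w)$ is achieved at least twice, and $V_\Sigma(I)=\coprod_{\sigma}V_\sigma(I)\subseteq\mathrm{trop}(X_\Sigma)$. *)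

theory Defs
  imports "HOL-Analysis.Analysis" "HOL-Library.Poly_Mapping"
begin

section \<open>The tropical semiring\<close>

datatype trop = Fin real | Infty

text \<open>
  Addition is the minimum and multiplication is the usual addition. Beware of the numerals:
  \<open>0 :: trop\<close> is \<open>\<infinity>\<close> and \<open>1 :: trop\<close> is the real number \<open>0\<close>.
  In the order, \<open>\<infinity>\<close> is the greatest element.
\<close>

instantiation trop :: linorder
begin

fun less_eq_trop :: "trop \<Rightarrow> trop \<Rightarrow> bool" where
  "Fin a \<le> Fin b \<longleftrightarrow> a \<le> b"
| "_ \<le> Infty \<longleftrightarrow> True"
| "Infty \<le> Fin _ \<longleftrightarrow> False"

definition less_trop :: "trop \<Rightarrow> trop \<Rightarrow> bool" where
  "a < b \<longleftrightarrow> a \<le> b \<and> \<not> b \<le> (a :: trop)"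

instance
proof
  fix x y z :: trop
  show "x < y \<longleftrightarrow> x \<le> y \<and> \<not> y \<le> x" by (rule less_trop_def)
  show "x \<le> x" by (cases x) auto
  show "x \<le> y \<Longrightarrow> y \<le> z \<Longrightarrow> x \<le> z" by (cases x; cases y; cases z) auto
  show "x \<le> y \<Longrightarrow> y \<le> x \<Longrightarrow> x = y" by (cases x; cases y) auto
  show "x \<le> y \<or> y \<le> x" by (cases x; cases y) auto
qed

end

instantiation trop :: comm_semiring_1
begin

definition zero_trop :: trop where "0 = Infty"

definition one_trop :: trop where "1 = Fin 0"

definition plus_trop :: "trop \<Rightarrow> trop \<Rightarrow> trop" where "a + b = min a (b :: trop)"

fun times_trop :: "trop \<Rightarrow> trop \<Rightarrow> trop" where
  "Fin a * Fin b = Fin (a + b)"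
| "_ * Infty = Infty"
| "Infty * Fin _ = Infty"

instance
proof
  fix a b c :: trop
  show "a * b * c = a * (b * c)" by (cases a; cases b; cases c) auto
  show "a * b = b * a" by (cases a; cases b) auto
  show "1 * a = a" by (cases a) (auto simp: one_trop_def)
  show "a + b + c = a + (b + c)" by (simp add: plus_trop_def min.assoc)
  show "a + b = b + a" by (simp add: plus_trop_def min.commute)
  show "0 + a = a" by (cases a) (auto simp: plus_trop_def zero_trop_def min_def)
  show "0 * a = 0" by (cases a) (auto simp: zero_trop_def)
  show "a * 0 = 0" by (cases a) (auto simp: zero_trop_def)
  show "(a + b) * c = a * c + b * c"
    by (cases a; cases b; cases c) (auto simp: plus_trop_def min_def)
  show "(0::trop) \<noteq> 1" by (simp add: zero_trop_def one_trop_def)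
qed

end


section \<open>Tropical (Laurent) polynomials and ideals\<close>

text \<open>
  A formal Laurent polynomial in variables indexed by \<open>'n\<close> is a finitely supported map from
  exponent vectors to coefficients; \<open>keys f\<close> is its support, and the zero polynomial
  is the polynomial \<open>\<infinity>\<close>.
\<close>

type_synonym 'n laurent = "int ^ 'n \<Rightarrow>\<^sub>0 trop"

definition supported_on :: "(int ^ 'n) set \<Rightarrow> 'n laurent set" where
  "supported_on A = {f. Poly_Mapping.keys f \<subseteq> A}"

definition var :: "'n \<Rightarrow> ('n :: finite) laurent" where
  "var i = Poly_Mapping.single (axis i 1) 1"

text \<open>\<open>R\<close> is the carrier of a subsemiring of the ambient semiring.\<close>

definition semiring_ideal :: "'a :: comm_semiring_1 set \<Rightarrow> 'a set \<Rightarrow> bool" where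
  "semiring_ideal R J \<longleftrightarrow> J \<noteq> {} \<and> J \<subseteq> R \<and>
     (\<forall>f\<in>J. \<forall>g\<in>J. f + g \<in> J) \<and> (\<forall>r\<in>R. \<forall>f\<in>J. r * f \<in> J)"

text \<open>The ideal of \<open>R\<close> generated by \<open>X\<close> is \<open>semiring_ideal R hull X\<close>.\<close>

definition ideal_power :: "'a :: comm_semiring_1 set \<Rightarrow> 'a set \<Rightarrow> nat \<Rightarrow> 'a set" where
  "ideal_power R J d =
     semiring_ideal R hull {(\<Prod>k<d. b k) | b :: nat \<Rightarrow> 'a. \<forall>k<d. b k \<in> J}"

text \<open>
  Tropical ideals in the semigroup semiring of a set \<open>A\<close> of monomials (closed under
  multiplication): for every finite \<open>E \<subseteq> A\<close>, the polynomials in \<open>J\<close> with support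
  in \<open>E\<close> satisfy the vector elimination axiom of valuated matroids. The coefficient
  condition \<open>\<noteq> 0\<close> says that the common coefficient is not \<open>\<infinity>\<close>.
\<close>

definition tropical_ideal :: "(int ^ 'n) set \<Rightarrow> ('n :: finite) laurent set \<Rightarrow> bool" where
  "tropical_ideal A J \<longleftrightarrow>
     semiring_ideal (supported_on A) J \<and>
     (\<forall>E. finite E \<and> E \<subseteq> A \<longrightarrow>
       (\<forall>f \<in> J \<inter> supported_on E. \<forall>g \<in> J \<inter> supported_on E. \<forall>e\<in>E.
          Poly_Mapping.lookup f e = Poly_Mapping.lookup g e \<and> Poly_Mapping.lookup f e \<noteq> 0 \<longrightarrow>
          (\<exists>h \<in> J \<inter> supported_on E.
             Poly_Mapping.lookup h e = 0 \<and>
             (\<forall>e'\<in>E. min (Poly_Mapping.lookup f e') (Poly_Mapping.lookup g e') \<le> Poly_Mapping.lookup h e' \<and>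
                (Poly_Mapping.lookup f e' \<noteq> Poly_Mapping.lookup g e' \<longrightarrow>
                   Poly_Mapping.lookup h e' = min (Poly_Mapping.lookup f e') (Poly_Mapping.lookup g e'))))))"


section \<open>Varieties in the torus\<close>

definition real_vec :: "int ^ 'n \<Rightarrow> real ^ 'n" where
  "real_vec u = (\<chi> i. real_of_int (u $ i))"

definition term_value :: "('n :: finite) laurent \<Rightarrow> real ^ 'n \<Rightarrow> int ^ 'n \<Rightarrow> trop" where
  "term_value f w u = Poly_Mapping.lookup f u * Fin (real_vec u \<bullet> w)"

text \<open>The sum is taken in \<open>trop\<close>, hence is a minimum.\<close>

definition trop_eval :: "('n :: finite) laurent \<Rightarrow> real ^ 'n \<Rightarrow> trop" where
  "trop_eval f w = (\<Sum>u\<in>Poly_Mapping.keys f. term_value f w u)"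

definition min_achieved_twice :: "('n :: finite) laurent \<Rightarrow> real ^ 'n \<Rightarrow> bool" where
  "min_achieved_twice f w \<longleftrightarrow>
     2 \<le> card {u \<in> Poly_Mapping.keys f. term_value f w u = trop_eval f w}"

definition torus_variety :: "('n :: finite) laurent set \<Rightarrow> (real ^ 'n) set" where
  "torus_variety J = {w. \<forall>f \<in> J - {0}. min_achieved_twice f w}"


section \<open>Fans\<close>

text \<open>The lattice \<open>N\<close> is \<open>int ^ 'n\<close>, embedded in \<open>real ^ 'n\<close> by \<open>real_vec\<close>, and its
  dual \<open>M\<close> is identified with \<open>int ^ 'n\<close> via the inner product.\<close>

definition rational_cone :: "(real ^ 'n) set \<Rightarrow> bool" where
  "rational_cone \<sigma> \<longleftrightarrow>
     (\<exists>V :: (int ^ 'n) set. finite V \<and> \<sigma> = convex_cone hull (real_vec ` V))"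

definition strongly_convex :: "(real ^ 'n) set \<Rightarrow> bool" where
  "strongly_convex \<sigma> \<longleftrightarrow> \<sigma> \<inter> uminus ` \<sigma> = {0}"

text \<open>\<open>(face_of)\<close> admits the empty face, which is not a face of a cone in toric geometry.\<close>

definition fan :: "(real ^ 'n) set set \<Rightarrow> bool" where
  "fan \<Sigma> \<longleftrightarrow> finite \<Sigma> \<and>
     (\<forall>\<sigma>\<in>\<Sigma>. rational_cone \<sigma> \<and> strongly_convex \<sigma>) \<and>
     (\<forall>\<sigma>\<in>\<Sigma>. \<forall>\<tau>. \<tau> face_of \<sigma> \<and> \<tau> \<noteq> {} \<longrightarrow> \<tau> \<in> \<Sigma>) \<and>
     (\<forall>\<sigma>\<in>\<Sigma>. \<forall>\<tau>\<in>\<Sigma>. (\<sigma> \<inter> \<tau>) face_of \<sigma> \<and> (\<sigma> \<inter> \<tau>) face_of \<tau>)"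

definition simplicial_cone :: "(real ^ 'n) set \<Rightarrow> bool" where
  "simplicial_cone \<sigma> \<longleftrightarrow> (\<exists>B. independent B \<and> \<sigma> = convex_cone hull B)"

definition simplicial_fan :: "(real ^ 'n) set set \<Rightarrow> bool" where
  "simplicial_fan \<Sigma> \<longleftrightarrow> fan \<Sigma> \<and> (\<forall>\<sigma>\<in>\<Sigma>. simplicial_cone \<sigma>)"

definition rays :: "(real ^ 'n) set set \<Rightarrow> (real ^ 'n) set set" where
  "rays \<Sigma> = {\<rho> \<in> \<Sigma>. dim \<rho> = 1}"

definition first_lattice_point :: "(real ^ 'n) set \<Rightarrow> int ^ 'n \<Rightarrow> bool" where
  "first_lattice_point \<rho> v \<longleftrightarrow> v \<noteq> 0 \<and> real_vec v \<in> \<rho> \<and>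
     (\<forall>w. w \<noteq> 0 \<and> real_vec w \<in> \<rho> \<longrightarrow> norm (real_vec v) \<le> norm (real_vec w))"

definition dual_monomials :: "(real ^ 'n) set \<Rightarrow> (int ^ 'n) set" where
  "dual_monomials \<sigma> = {u. \<forall>w\<in>\<sigma>. 0 \<le> real_vec u \<bullet> w}"


section \<open>The Cox semiring\<close>

definition lattice_direct_sum :: "(int ^ 'n) set \<Rightarrow> (int ^ 'n) set \<Rightarrow> bool" where
  "lattice_direct_sum L L' \<longleftrightarrow> (\<forall>v. \<exists>!p. fst p \<in> L \<and> snd p \<in> L' \<and> v = fst p + snd p)"

text \<open>The family \<open>(b i)\<close>, \<open>i \<in> T\<close>, is a basis of the abelian group \<open>L\<close>.\<close>

definition lattice_basis :: "'m set \<Rightarrow> ('m :: finite \<Rightarrow> int ^ 'n) \<Rightarrow> (int ^ 'n) set \<Rightarrow> bool" where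
  "lattice_basis T b L \<longleftrightarrow>
     (\<forall>c. (\<Sum>i\<in>T. c i *s b i) \<in> L) \<and>
     (\<forall>v\<in>L. \<exists>!c. (\<forall>i. i \<notin> T \<longrightarrow> c i = 0) \<and> v = (\<Sum>i\<in>T. c i *s b i))"

text \<open>
  The variables of the Cox semiring are indexed by the finite type \<open>'m\<close>; the indices in
  \<open>R\<close> (there are \<open>s\<close> of them) are those of the rays, and the remaining \<open>t\<close> ones are
  those of the basis of \<open>N''\<close>. The lattice \<open>N'\<close> consists of the lattice points in the
  span of the rays. That \<open>'m\<close> has \<open>s + t\<close> elements is a consequence.
\<close>

definition cox_matrix :: "(real ^ 'n) set set \<Rightarrow> 'm set \<Rightarrow> int ^ 'n ^ 'm \<Rightarrow> bool" where
  "cox_matrix \<Sigma> R Q \<longleftrightarrow>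
     (\<exists>\<rho>. bij_betw \<rho> R (rays \<Sigma>) \<and> (\<forall>i\<in>R. first_lattice_point (\<rho> i) (Q $ i))) \<and>
     (\<exists>N''. lattice_direct_sum {v. real_vec v \<in> span (\<Union>(rays \<Sigma>))} N'' \<and>
            lattice_basis (- R) (\<lambda>i. Q $ i) N'')"

text \<open>
  The Cox semiring \<open>S\<close> and all its localizations live inside the Laurent polynomial semiring
  in the same variables, \<open>S\<close> being the polynomials with nonnegative exponents.
\<close>

definition cox :: "('m :: finite) laurent set" where
  "cox = supported_on {a. \<forall>i. 0 \<le> a $ i}"

definition degree_class :: "int ^ 'n ^ 'm \<Rightarrow> int ^ 'm \<Rightarrow> (int ^ 'm) set" where
  "degree_class Q a = {a + Q *v u | u. True}"

definition homogeneous :: "int ^ 'n ^ 'm \<Rightarrow> ('m :: finite) laurent \<Rightarrow> bool" where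
  "homogeneous Q f \<longleftrightarrow> (\<exists>D. \<forall>a \<in> Poly_Mapping.keys f. degree_class Q a = D)"

definition homogeneous_ideal :: "int ^ 'n ^ 'm \<Rightarrow> ('m :: finite) laurent set \<Rightarrow> bool" where
  "homogeneous_ideal Q I \<longleftrightarrow>
     semiring_ideal cox I \<and> I = semiring_ideal cox hull {f \<in> I. homogeneous Q f}"

definition cone_indices :: "'m set \<Rightarrow> int ^ 'n ^ 'm \<Rightarrow> (real ^ 'n) set \<Rightarrow> 'm set" where
  "cone_indices R Q \<sigma> = {i \<in> R. real_vec (Q $ i) \<in> \<sigma>}"

definition xhat :: "'m set \<Rightarrow> int ^ 'n ^ 'm \<Rightarrow> (real ^ 'n) set \<Rightarrow> ('m :: finite) laurent" where
  "xhat R Q \<sigma> = (\<Prod>i \<in> - cone_indices R Q \<sigma>. var i)"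

definition irrelevant_ideal ::
  "(real ^ 'n) set set \<Rightarrow> 'm set \<Rightarrow> int ^ 'n ^ 'm \<Rightarrow> ('m :: finite) laurent set" where
  "irrelevant_ideal \<Sigma> R Q = semiring_ideal cox hull (xhat R Q ` \<Sigma>)"

text \<open>The fractions \<open>g / (xhat R Q \<sigma>) ^ k\<close> with \<open>g \<in> cox\<close>.\<close>

definition cox_localization ::
  "'m set \<Rightarrow> int ^ 'n ^ 'm \<Rightarrow> (real ^ 'n) set \<Rightarrow> ('m :: finite) laurent set" where
  "cox_localization R Q \<sigma> = {f. \<exists>k :: nat. xhat R Q \<sigma> ^ k * f \<in> cox}"

text \<open>
  The degree-zero part of a set of Laurent polynomials, transported to Laurent polynomials on
  \<open>M\<close> along \<open>x^(Q u) \<mapsto> u\<close>.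
\<close>

definition degree_zero_part ::
  "int ^ 'n ^ 'm \<Rightarrow> ('m :: finite) laurent set \<Rightarrow> ('n :: finite) laurent set" where
  "degree_zero_part Q F =
     {g. \<exists>f\<in>F. (\<forall>a \<in> Poly_Mapping.keys f. degree_class Q a = degree_class Q 0) \<and>
               (\<forall>u. Poly_Mapping.lookup g u = Poly_Mapping.lookup f (Q *v u))}"

definition chart_ideal ::
  "'m set \<Rightarrow> int ^ 'n ^ 'm \<Rightarrow> ('m :: finite) laurent set \<Rightarrow> (real ^ 'n) set
    \<Rightarrow> ('n :: finite) laurent set" where
  "chart_ideal R Q I \<sigma> =
     degree_zero_part Q (semiring_ideal (cox_localization R Q \<sigma>) hull I)"

definition locally_tropical ::
  "(real ^ 'n) set set \<Rightarrow> 'm set \<Rightarrow> int ^ 'n ^ 'm \<Rightarrow> ('m :: finite) laurent set \<Rightarrow> bool" where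
  "locally_tropical \<Sigma> R Q I \<longleftrightarrow>
     homogeneous_ideal Q I \<and>
     (\<forall>\<sigma>\<in>\<Sigma>. tropical_ideal (dual_monomials \<sigma>) (chart_ideal R Q I \<sigma>))"


section \<open>Varieties in tropical toric varieties\<close>

text \<open>
  In the localization at \<open>xhat R Q \<sigma>\<close> the variables \<open>x_i\<close>, \<open>i \<in> \<sigma>\<close>, have nonnegative exponents, so the
  monomial \<open>x^(Q u)\<close> is divisible by \<open>x_i\<close> iff \<open>0 < (Q u)_i\<close>.
\<close>

definition orbit_ideal ::
  "'m set \<Rightarrow> int ^ 'n ^ 'm \<Rightarrow> ('m :: finite) laurent set \<Rightarrow> (real ^ 'n) set
    \<Rightarrow> ('n :: finite) laurent set" where
  "orbit_ideal R Q I \<sigma> =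
     {h. \<exists>g \<in> chart_ideal R Q I \<sigma>. \<forall>u.
        Poly_Mapping.lookup h u =
          (if \<exists>i \<in> cone_indices R Q \<sigma>. 0 < (Q *v u) $ i then 0 else Poly_Mapping.lookup g u)}"

text \<open>\<open>N(\<sigma>)\<close>, whose points are the cosets of \<open>span \<sigma>\<close>.\<close>

definition orbit :: "(real ^ 'n) set \<Rightarrow> (real ^ 'n) set set" where
  "orbit \<sigma> = UNIV // {(v, w). v - w \<in> span \<sigma>}"

text \<open>
  Exponents of polynomials in \<open>orbit_ideal R Q I \<sigma>\<close> are orthogonal to \<open>\<sigma>\<close>, so evaluation does not
  depend on the representative \<open>w\<close> of the coset \<open>W\<close>.
\<close>

definition orbit_variety ::
  "'m set \<Rightarrow> int ^ 'n ^ 'm \<Rightarrow> ('m :: finite) laurent set \<Rightarrow> (real ^ ('n :: finite)) set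
    \<Rightarrow> (real ^ 'n) set set" where
  "orbit_variety R Q I \<sigma> =
     {W \<in> orbit \<sigma>. \<forall>f \<in> orbit_ideal R Q I \<sigma> - {0}. \<forall>w\<in>W. min_achieved_twice f w}"

definition trop_toric :: "(real ^ 'n) set set \<Rightarrow> ((real ^ 'n) set \<times> (real ^ 'n) set) set" where
  "trop_toric \<Sigma> = (SIGMA \<sigma>:\<Sigma>. orbit \<sigma>)"

definition toric_variety_of ::
  "(real ^ 'n) set set \<Rightarrow> 'm set \<Rightarrow> int ^ 'n ^ 'm \<Rightarrow> ('m :: finite) laurent set
    \<Rightarrow> ((real ^ ('n :: finite)) set \<times> (real ^ 'n) set) set" where
  "toric_variety_of \<Sigma> R Q I = (SIGMA \<sigma>:\<Sigma>. orbit_variety R Q I \<sigma>)"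

lemma toric_variety_of_subset: "toric_variety_of \<Sigma> R Q I \<subseteq> trop_toric \<Sigma>"
  by (auto simp: toric_variety_of_def trop_toric_def orbit_variety_def)

end

theory Submission
  imports Defs
begin

text \<open>
  A tropical ideal without monomials consists, in each finite set of monomials, of the vectors of a valuated matroid
  without loops, so some real weighting \<open>y\<close> of the monomials makes every vector attain its minimum twice. As in the tropical
  dual Nullstellensatz of Grigoriev and Podolskii, one passes from the arbitrary \<open>y\<close> to a weighting \<open>u \<mapsto> u \<bullet> w\<close> by
  looking at a minimum of \<open>y\<close> plus a convex function built from finitely many polynomials; Farkas' lemma supplies \<open>w\<close>.
  So all the polynomials of bounded degree in the ideal have a common root. That finitely many degrees suffice is a
  Groebner basis argument: the number of leading monomials in each degree does not depend on the weight, and Dickson's lemma applies.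

  For the toric statement, the weak Nullstellensatz on the lattice orthogonal to a cone \<open>\<sigma>\<close> gives an element \<open>1 + \<dots>\<close> of the
  chart ideal whose other terms vanish on the orbit. By induction on \<open>\<sigma>\<close> the ideal contains a power of \<open>xhat\<close> for each facet, hence
  all the monomials of the chart that vanish to high order along some ray, and eliminating the other terms one by one leaves \<open>1\<close>.
\<close>

section \<open>Valuated matroids and their covectors\<close>

text \<open>There is no subtraction: the only division step is vector elimination, which gives just
  a lower bound wherever the two vectors agree. Each argument therefore arranges that the terms
  which must survive have different coefficients in the two vectors, and it terminates because some
  finite set of monomials shrinks. The second obstacle is noncompactness. What is available is
  finite data, the leading monomials and the ties between terms, and two roots with the same data
  are compared along the line through them. The same obstacle appears when approximate roots are
  made exact; there a Farkas certificate turns the absence of an exact root into a uniform positive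
  gap. In the toric part simpliciality enters through the facets: leaving out any one ray of a cone
  gives again a cone of the fan, so that the monomials not yet known to lie in the ideal have
  bounded order along every ray.\<close>

abbreviation cf :: "('a \<Rightarrow>\<^sub>0 trop) \<Rightarrow> 'a \<Rightarrow> trop" where "cf \<equiv> Poly_Mapping.lookup"
abbreviation supp :: "('a \<Rightarrow>\<^sub>0 trop) \<Rightarrow> 'a set" where "supp \<equiv> Poly_Mapping.keys"

section \<open>Order and arithmetic of the tropical numbers\<close>

lemma trop_le_zero [simp]: "x \<le> (0::trop)"
  by (cases x) (auto simp: zero_trop_def)

lemma trop_zero_le_iff [simp]: "(0::trop) \<le> x \<longleftrightarrow> x = 0"
  by (cases x) (auto simp: zero_trop_def)

lemma Fin_neq_zero [simp]: "Fin c \<noteq> 0" "0 \<noteq> Fin c"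
  by (auto simp: zero_trop_def)

lemma trop_neq_zero_iff: "x \<noteq> 0 \<longleftrightarrow> (\<exists>c. x = Fin c)"
  by (cases x) (auto simp: zero_trop_def)

lemma Fin_less_iff [simp]: "Fin a < Fin b \<longleftrightarrow> a < b"
  by (auto simp: less_trop_def)

lemma Fin_less_zero [simp]: "Fin a < 0"
  by (auto simp: less_trop_def zero_trop_def)

lemma trop_neq_zero_iff_less: "x \<noteq> (0::trop) \<longleftrightarrow> x < 0"
  using trop_le_zero[of x] by (auto simp: less_le)

lemma trop_mult_le_cancel [simp]: "Fin c * a \<le> Fin c * b \<longleftrightarrow> a \<le> b" "a * Fin c \<le> b * Fin c \<longleftrightarrow> a \<le> b"
  by (cases a; cases b; simp)+

lemma trop_mult_less_cancel [simp]: "Fin c * a < Fin c * b \<longleftrightarrow> a < b" "a * Fin c < b * Fin c \<longleftrightarrow> a < b"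
  by (auto simp: less_trop_def)

lemma trop_mult_eq_cancel [simp]: "Fin c * a = Fin c * b \<longleftrightarrow> a = b" "a * Fin c = b * Fin c \<longleftrightarrow> a = b"
  by (cases a; cases b; simp)+

lemma trop_mult_eq_zero [simp]: "Fin c * a = 0 \<longleftrightarrow> a = 0" "a * Fin c = 0 \<longleftrightarrow> a = 0"
  by (cases a; simp add: zero_trop_def)+

lemma one_trop_neq_zero [simp]: "(1::trop) \<noteq> 0" by (simp add: one_trop_def)

lemma lookup_single_mult [simp]:
  fixes f :: "'n::finite laurent"
  shows "cf (Poly_Mapping.single a c * f) u = c * cf f (u - a)"
proof -
  have "cf (Poly_Mapping.single a c * f) u = (\<Sum>l. cf (Poly_Mapping.single a c) l * (\<Sum>q. cf f q when u = l + q))"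
    by (simp add: lookup_mult prod_fun_def)
  also have "\<dots> = (\<Sum>l. (c * (\<Sum>q. cf f q when u = a + q)) when l = a)"
    by (rule Sum_any.cong) (auto simp: lookup_single when_def)
  also have "\<dots> = c * (\<Sum>q. cf f q when u = a + q)" by simp
  also have "(\<Sum>q. cf f q when u = a + q) = (\<Sum>q. cf f q when q = u - a)"
    by (rule Sum_any.cong) (auto simp: when_def algebra_simps)
  finally show ?thesis by simp
qed

definition scale :: "real \<Rightarrow> 'n laurent \<Rightarrow> ('n::finite) laurent" where
  "scale c f = Poly_Mapping.single 0 (Fin c) * f"

lemma lookup_scale [simp]: "cf (scale c f) u = Fin c * cf f u"
  by (simp add: scale_def)

lemma keys_scale [simp]: "supp (scale c f) = supp f"
  by (auto simp: in_keys_iff)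

definition matroidal :: "('n::finite) laurent set \<Rightarrow> bool" where
  "matroidal V \<longleftrightarrow> (\<forall>f\<in>V. \<forall>c. scale c f \<in> V) \<and>
     (\<forall>f\<in>V. \<forall>g\<in>V. \<forall>e. cf f e = cf g e \<and> cf f e \<noteq> 0 \<longrightarrow>
        (\<exists>h\<in>V. cf h e = 0 \<and> (\<forall>u. min (cf f u) (cf g u) \<le> cf h u \<and>
            (cf f u \<noteq> cf g u \<longrightarrow> cf h u = min (cf f u) (cf g u)))))"

lemma matroidal_scale: "matroidal V \<Longrightarrow> f \<in> V \<Longrightarrow> scale c f \<in> V"
  by (auto simp: matroidal_def)

lemma matroidal_elim:
  assumes "matroidal V" "f \<in> V" "g \<in> V" "cf f e = cf g e" "cf f e \<noteq> 0"
  obtains h where "h \<in> V" "cf h e = 0" "\<And>u. min (cf f u) (cf g u) \<le> cf h u"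
    "\<And>u. cf f u \<noteq> cf g u \<Longrightarrow> cf h u = min (cf f u) (cf g u)"
    "supp h \<subseteq> (supp f \<union> supp g) - {e}"
proof -
  obtain h where h: "h \<in> V" "cf h e = 0" "\<And>u. min (cf f u) (cf g u) \<le> cf h u"
    "\<And>u. cf f u \<noteq> cf g u \<Longrightarrow> cf h u = min (cf f u) (cf g u)"
    using assms unfolding matroidal_def by metis
  have "supp h \<subseteq> (supp f \<union> supp g) - {e}"
    using h(2,3) by (auto simp: in_keys_iff) (metis trop_zero_le_iff min.idem)
  with h that show thesis by blast
qed

lemma matroidal_elim_scaled:
  assumes "matroidal V" "f \<in> V" "g \<in> V" "e \<in> supp f" "e \<in> supp g"
  obtains c h where "h \<in> V" "cf f e = Fin c * cf g e" "\<And>u. min (cf f u) (Fin c * cf g u) \<le> cf h u"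
    "\<And>u. cf f u \<noteq> Fin c * cf g u \<Longrightarrow> cf h u = min (cf f u) (Fin c * cf g u)"
    "supp h \<subseteq> (supp f \<union> supp g) - {e}"
proof -
  obtain a b where ab: "cf f e = Fin a" "cf g e = Fin b"
    using assms(4,5) by (auto simp: in_keys_iff trop_neq_zero_iff)
  have "scale (a - b) g \<in> V" using assms matroidal_scale by blast
  from matroidal_elim[OF assms(1,2) this, of e] ab
  obtain h where "h \<in> V" "cf h e = 0" "\<And>u. min (cf f u) (cf (scale (a-b) g) u) \<le> cf h u"
    "\<And>u. cf f u \<noteq> cf (scale (a-b) g) u \<Longrightarrow> cf h u = min (cf f u) (cf (scale (a-b) g) u)"
    "supp h \<subseteq> (supp f \<union> supp (scale (a-b) g)) - {e}" by auto
  with ab that[of h "a - b"] show thesis by simp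
qed

lemma matroidal_deletion: "matroidal V \<Longrightarrow> matroidal {f \<in> V. x \<notin> supp f}"
  unfolding matroidal_def
proof (intro conjI ballI allI impI, goal_cases)
  case (1 f c) then show ?case by auto
next
  case (2 f g e)
  then obtain h where h: "h\<in>V" "cf h e = 0" "(\<forall>u. min (cf f u) (cf g u) \<le> cf h u \<and>
            (cf f u \<noteq> cf g u \<longrightarrow> cf h u = min (cf f u) (cf g u)))" by blast
  have "x \<notin> supp h" using h(3)[rule_format, of x] 2 by (auto simp: in_keys_iff)
  with h show ?case by blast
qed

lemma matroidal_restrict: "matroidal V \<Longrightarrow> matroidal (V \<inter> supported_on E)"
  unfolding matroidal_def
proof (intro conjI ballI allI impI, goal_cases)
  case (1 f c) then show ?case by (auto simp: supported_on_def)
next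
  case (2 f g e)
  then obtain h where h: "h\<in>V" "cf h e = 0" "(\<forall>u. min (cf f u) (cf g u) \<le> cf h u \<and>
            (cf f u \<noteq> cf g u \<longrightarrow> cf h u = min (cf f u) (cf g u)))" by blast
  have "supp h \<subseteq> supp f \<union> supp g"
    using h(3) by (auto simp: in_keys_iff) (metis trop_zero_le_iff min.idem)
  with h 2 show ?case unfolding supported_on_def by blast
qed

text \<open>The union of the two supports serves as ground set, and \<open>0 \<in> A\<close> puts
  the real constants into the semiring, whence closure under \<open>scale\<close>.\<close>

lemma tropical_ideal_matroidal:
  assumes "tropical_ideal A J" "0 \<in> A"
  shows "matroidal J"
  unfolding matroidal_def
proof (intro conjI ballI allI impI, goal_cases)
  case (1 f c)
  have "Poly_Mapping.single 0 (Fin c) \<in> supported_on A"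
    using assms(2) by (auto simp: supported_on_def)
  then show ?case using assms(1) 1 unfolding scale_def tropical_ideal_def semiring_ideal_def by blast
next
  case (2 f g e)
  let ?E = "supp f \<union> supp g"
  have "f \<in> supported_on A" "g \<in> supported_on A"
    using assms(1) 2 unfolding tropical_ideal_def semiring_ideal_def by blast+
  then have E: "finite ?E \<and> ?E \<subseteq> A" by (auto simp: supported_on_def)
  have "e \<in> ?E" using 2 by (auto simp: in_keys_iff)
  then obtain h where h: "h \<in> J \<inter> supported_on ?E" "cf h e = 0" "\<forall>u\<in>?E. min (cf f u) (cf g u) \<le> cf h u \<and>
            (cf f u \<noteq> cf g u \<longrightarrow> cf h u = min (cf f u) (cf g u))"
  proof -
    have "f \<in> J \<inter> supported_on ?E" "g \<in> J \<inter> supported_on ?E" using 2 by (auto simp: supported_on_def)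
    moreover have "\<forall>f \<in> J \<inter> supported_on ?E. \<forall>g \<in> J \<inter> supported_on ?E. \<forall>e\<in>?E.
          cf f e = cf g e \<and> cf f e \<noteq> 0 \<longrightarrow>
          (\<exists>h \<in> J \<inter> supported_on ?E. cf h e = 0 \<and>
             (\<forall>e'\<in>?E. min (cf f e') (cf g e') \<le> cf h e' \<and>
                (cf f e' \<noteq> cf g e' \<longrightarrow> cf h e' = min (cf f e') (cf g e'))))"
      by (rule assms(1)[unfolded tropical_ideal_def, THEN conjunct2, THEN spec, THEN mp, OF E])
    ultimately have "\<exists>h \<in> J \<inter> supported_on ?E. cf h e = 0 \<and>
             (\<forall>e'\<in>?E. min (cf f e') (cf g e') \<le> cf h e' \<and>
                (cf f e' \<noteq> cf g e' \<longrightarrow> cf h e' = min (cf f e') (cf g e')))"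
      using 2(3) \<open>e \<in> ?E\<close> by (elim ballE[of _ _ f] ballE[of _ _ g] ballE[of _ _ e]) auto
    then show thesis using that by blast
  qed
  have "u \<notin> ?E \<Longrightarrow> cf f u = 0 \<and> cf g u = 0 \<and> cf h u = 0" for u
    using h(1) by (auto simp: supported_on_def in_keys_iff)
  then have "min (cf f u) (cf g u) \<le> cf h u \<and> (cf f u \<noteq> cf g u \<longrightarrow> cf h u = min (cf f u) (cf g u))" for u
    using h(3) by (cases "u \<in> ?E") auto
  with h show ?case by blast
qed

section \<open>Weights, minima and covectors\<close>

definition val :: "('n::finite) laurent \<Rightarrow> (int ^ 'n \<Rightarrow> real) \<Rightarrow> int ^ 'n \<Rightarrow> trop" where
  "val f y u = cf f u * Fin (y u)"

lemma val_eq_zero [simp]: "val f y u = 0 \<longleftrightarrow> u \<notin> supp f"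
  by (simp add: val_def in_keys_iff)

lemma val_outside: "u \<notin> supp f \<Longrightarrow> val f y u = 0"
  by simp

lemma val_scale [simp]: "val (scale c f) y u = Fin c * val f y u"
  by (simp add: val_def mult.assoc)

text \<open>The weight \<open>y\<close> is an arbitrary real function of the exponent, since the
  covector that matroid theory provides is not linear; the weights \<open>lin w\<close> are those
  that come from points \<open>w\<close> of real space. Comparing with all exponents costs nothing,
  as terms off the support have value infinity.\<close>

definition attains_twice :: "('n::finite) laurent \<Rightarrow> (int ^ 'n \<Rightarrow> real) \<Rightarrow> bool" where
  "attains_twice f y \<longleftrightarrow> (\<exists>a b. a \<noteq> b \<and> a \<in> supp f \<and> b \<in> supp f \<and>
      val f y a = val f y b \<and> (\<forall>u. val f y a \<le> val f y u))"

lemma attains_twice_scale [simp]: "attains_twice (scale c f) y \<longleftrightarrow> attains_twice f y"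
  by (simp add: attains_twice_def)

lemma exists_min_val:
  assumes "finite S" "S \<noteq> {}"
  obtains a where "a \<in> S" "\<And>u. u \<in> S \<Longrightarrow> val f y a \<le> val f y u"
  using ex_min_if_finite[of "val f y ` S"] assms that by (auto simp: not_less)

lemma not_attains_twiceE:
  assumes "f \<noteq> 0" "\<not> attains_twice f y"
  obtains a where "a \<in> supp f" "\<And>u. u \<noteq> a \<Longrightarrow> val f y a < val f y u"
proof -
  obtain a where a: "a \<in> supp f" "\<And>u. u \<in> supp f \<Longrightarrow> val f y a \<le> val f y u"
    using exists_min_val[of "supp f" f y] assms(1) by (auto)
  have a': "val f y a \<le> val f y u" for u
    using a(2)[of u] by (cases "u \<in> supp f") (auto simp: val_outside)
  have "val f y a < val f y u" if "u \<noteq> a" for u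
  proof (rule ccontr)
    assume "\<not> ?thesis"
    then have "val f y a = val f y u" using a'[of u] by simp
    moreover then have "u \<in> supp f" using a(1) by (metis val_eq_zero)
    ultimately show False using assms(2) a(1) a' that unfolding attains_twice_def by metis
  qed
  with a that show thesis by blast
qed

text \<open>\<open>s\<close> is the least scalar for which \<open>scale s h\<close> lies above
  \<open>f\<close>, so the two touch at some \<open>t\<close>. Eliminating \<open>t\<close> between
  them gives a vector that lies above \<open>f\<close> and has smaller support.\<close>

lemma scale_tight:
  fixes f h :: "('n::finite) laurent"
  assumes "h \<noteq> 0" "supp h \<subseteq> supp f"
  obtains s t where "t \<in> supp h" "Fin s * cf h t = cf f t" "\<And>v. cf f v \<le> Fin s * cf h v"
proof -
  define r where "r g v = (THE c. cf g v = Fin c)" for g :: "'n laurent" and v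
  have r: "cf g v = Fin (r g v)" if "v \<in> supp g" for g v
    using that by (auto simp: in_keys_iff trop_neq_zero_iff r_def)
  have ne: "supp h \<noteq> {}" using assms by auto
  define s where "s = Max ((\<lambda>v. r f v - r h v) ` supp h)"
  have "s \<in> (\<lambda>v. r f v - r h v) ` supp h" unfolding s_def using ne by (intro Max_in) auto
  then obtain t where t: "t \<in> supp h" "s = r f t - r h t" by blast
  have le: "r f v - r h v \<le> s" if "v \<in> supp h" for v unfolding s_def using that by auto
  have "cf f v \<le> Fin s * cf h v" for v
  proof (cases "v \<in> supp h")
    case True
    then show ?thesis using r[OF True] r[of v f] le[OF True] assms(2) by auto
  next
    case False then show ?thesis by (simp add: in_keys_iff)
  qed
  moreover have "Fin s * cf h t = cf f t" using t r[OF t(1)] r[of t f] assms(2) by auto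
  ultimately show thesis using that t by blast
qed

text \<open>
  A vector \<open>f\<close> with the support of \<open>g S\<close> that exceeds \<open>g S\<close> everywhere off \<open>e\<close> lies below a vector of smaller support,
  so the vectors \<open>g S\<close>, one for each support, bound all the others.
\<close>

lemma normalized_bound:
  assumes V: "matroidal V" "finite E" "V \<subseteq> supported_on E" and nomon: "\<And>f. f \<in> V \<Longrightarrow> card (supp f) \<noteq> 1"
  obtains K where "\<And>f. f \<in> V \<Longrightarrow> cf f e = Fin 0 \<Longrightarrow> \<exists>v. v \<noteq> e \<and> cf f v \<le> Fin K"
proof -
  let ?N = "{f \<in> V. cf f e = Fin 0}"
  define g where "g S = (SOME f. f \<in> ?N \<and> supp f = S)" for S
  define r where "r S v = (case cf (g S) v of Fin c \<Rightarrow> c | Infty \<Rightarrow> 0)" for S v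
  define K where "K = Max ((\<lambda>(S,v). r S v) ` (Pow E \<times> E) \<union> {0})"
  have rK: "r S v \<le> K" if "S \<subseteq> E" "v \<in> E" for S v
    unfolding K_def using that \<open>finite E\<close> by (intro Max_ge) auto
  have "\<exists>v. v \<noteq> e \<and> cf f v \<le> Fin K" if "f \<in> ?N" for f
    using that
  proof (induction "card (supp f)" arbitrary: f rule: less_induct)
    case less
    let ?S = "supp f"
    have SE: "?S \<subseteq> E" using less.prems V by (auto simp: supported_on_def)
    have e: "e \<in> ?S" using less.prems by (auto simp: in_keys_iff)
    have "card ?S \<noteq> 1" using nomon less.prems by auto
    then have "?S \<noteq> {e}" by auto
    then obtain v0 where v0: "v0 \<in> ?S" "v0 \<noteq> e" using e by auto
    have gS: "g ?S \<in> ?N \<and> supp (g ?S) = ?S" unfolding g_def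
      by (rule someI) (use less.prems in auto)
    have grK: "cf (g ?S) v \<le> Fin K" if "v \<in> ?S" for v
    proof -
      have "cf (g ?S) v = Fin (r ?S v)" using gS that
        by (auto simp: r_def in_keys_iff zero_trop_def split: trop.splits)
      then show ?thesis using rK[OF SE] SE that by auto
    qed
    show ?case
    proof (cases "\<exists>v\<in>?S - {e}. cf f v \<le> cf (g ?S) v")
      case True
      then obtain v where "v \<in> ?S" "v \<noteq> e" "cf f v \<le> cf (g ?S) v" by blast
      then show ?thesis using grK[of v] order_trans by blast
    next
      case False
      then have lt: "cf (g ?S) v < cf f v" if "v \<in> ?S - {e}" for v using that by (meson not_le)
      \<comment> \<open>As \<open>g ?S\<close> is below \<open>f\<close> off \<open>e\<close>,
        eliminating \<open>e\<close> keeps all its other coefficients. The result is then raised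
        until it touches \<open>f\<close>, and the contact point is eliminated: \<open>k\<close>
        lies above \<open>f\<close>, still has the real coefficient 0 at \<open>e\<close>, and its
        bound is one for \<open>f\<close>.\<close>
      obtain h where h: "h \<in> V" "cf h e = 0" "\<And>u. cf f u \<noteq> cf (g ?S) u \<Longrightarrow> cf h u = min (cf f u) (cf (g ?S) u)"
         "supp h \<subseteq> ?S - {e}"
        by (rule matroidal_elim[OF V(1), of f "g ?S" e]) (use less.prems gS in auto)
      have hv0: "cf h v0 = cf (g ?S) v0" using h(3)[of v0] lt[of v0] v0 by auto
      have "h \<noteq> 0" using hv0 gS v0 by (auto simp: in_keys_iff)
      obtain s t where st: "t \<in> supp h" "Fin s * cf h t = cf f t" "\<And>v. cf f v \<le> Fin s * cf h v"
        by (rule scale_tight[of h f]) (use \<open>h \<noteq> 0\<close> h(4) in auto)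
      have "t \<in> supp f" using st(1) h(4) by auto
      obtain k where k: "k \<in> V" "\<And>u. min (cf f u) (Fin s * cf h u) \<le> cf k u"
        "\<And>u. cf f u \<noteq> Fin s * cf h u \<Longrightarrow> cf k u = min (cf f u) (Fin s * cf h u)"
        "supp k \<subseteq> (supp f \<union> supp h) - {t}"
        by (rule matroidal_elim[OF V(1), of f "scale s h" t])
          (use less.prems matroidal_scale[OF V(1) h(1)] st(2) \<open>t \<in> supp f\<close> in \<open>auto simp: in_keys_iff\<close>)
      have ke: "cf k e = Fin 0" using k(3)[of e] h(2) less.prems by auto
      have kf: "cf f u \<le> cf k u" for u using k(2)[of u] st(3)[of u] by auto
      have "supp k \<subset> supp f" using k(4) h(4) \<open>t \<in> supp f\<close> by auto
      then have "card (supp k) < card (supp f)" by (simp add: psubset_card_mono)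
      then show ?thesis using less.hyps[of k] k(1) ke kf by (metis (mono_tags) mem_Collect_eq order_trans)
    qed
  qed
  with that show thesis by blast
qed

text \<open>By induction the vectors avoiding \<open>e\<close> have a covector \<open>y\<close>, and
  only the weight of \<open>e\<close> is to be chosen. Normalise the coefficient at \<open>e\<close>
  to the real number 0 and let \<open>m\<close> be the minimum of the other terms. If the weight is
  \<open>m\<close>, there is a tie with \<open>e\<close>; if it is larger, two of the other terms
  must tie. The supremum of all such \<open>m\<close> works: below it, eliminating \<open>e\<close>
  against a vector with larger minimum keeps the value \<open>m\<close> and lands among the vectors
  avoiding \<open>e\<close>.\<close>

lemma exists_covector:
  assumes "finite E" "matroidal V" "V \<subseteq> supported_on E" "\<And>f. f \<in> V \<Longrightarrow> card (supp f) \<noteq> 1"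
  shows "\<exists>y. \<forall>f\<in>V - {0}. attains_twice f y"
  using assms
proof (induction E arbitrary: V rule: finite_induct)
  case empty
  then show ?case by (auto simp: supported_on_def)
next
  case (insert e E)
  let ?V' = "{f \<in> V. e \<notin> supp f}"
  have "?V' \<subseteq> supported_on E" using insert.prems(2) by (auto simp: supported_on_def)
  then obtain y where y: "\<forall>f\<in>?V' - {0}. attains_twice f y"
    using insert.IH[OF matroidal_deletion[OF insert.prems(1)], of e] insert.prems(3) by auto
  obtain K where K: "\<And>f. f \<in> V \<Longrightarrow> cf f e = Fin 0 \<Longrightarrow> \<exists>v. v \<noteq> e \<and> cf f v \<le> Fin K"
    using normalized_bound[OF insert.prems(1) _ insert.prems(2,3), of e] insert.hyps by auto
  define K' where "K' = K + Max (insert 0 (y ` E))"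
  define T where "T = {c::real. \<exists>f\<in>V. cf f e = Fin 0 \<and> (\<forall>v. v \<noteq> e \<longrightarrow> Fin c \<le> val f y v)}"
  have K': "c \<le> K'" if "c \<in> T" for c
  proof -
    from that obtain f where f: "f \<in> V" "cf f e = Fin 0" "\<And>v. v \<noteq> e \<Longrightarrow> Fin c \<le> val f y v"
      unfolding T_def by blast
    obtain v where v: "v \<noteq> e" "cf f v \<le> Fin K" using K[OF f(1,2)] by blast
    then obtain b where b: "cf f v = Fin b" "b \<le> K" by (cases "cf f v") auto
    then have "v \<in> supp f" by (auto simp: in_keys_iff)
    then have "v \<in> E" using insert.prems(2) f(1) v(1) by (auto simp: supported_on_def)
    then have "y v \<le> Max (insert 0 (y ` E))" using insert.hyps by auto
    then show ?thesis using f(3)[OF v(1)] b by (auto simp: val_def K'_def)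
  qed
  then have bdd: "bdd_above T" by (auto simp: bdd_above_def)
  define y' where "y' = y(e := Sup T)"
  have vy: "val f y' v = val f y v" if "v \<noteq> e" for f v using that by (simp add: val_def y'_def)
  have main: "attains_twice f y'" if f: "f \<in> V" "cf f e = Fin 0" for f
  proof -
    have e: "e \<in> supp f" using f by (auto simp: in_keys_iff)
    have "supp f - {e} \<noteq> {}" using insert.prems(3)[OF f(1)] e by (metis Diff_eq_empty_iff is_singletonI is_singleton_altdef subset_singletonD empty_iff)
    then obtain v0 where v0: "v0 \<in> supp f - {e}" "\<And>u. u \<in> supp f - {e} \<Longrightarrow> val f y v0 \<le> val f y u"
      using exists_min_val[of "supp f - {e}" f y] by auto
    obtain m where m: "val f y v0 = Fin m" using v0(1) by (metis Diff_iff val_eq_zero trop_neq_zero_iff)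
    have mle: "Fin m \<le> val f y u" if "u \<noteq> e" for u
      using v0(2)[of u] m that by (cases "u \<in> supp f") (auto simp: val_outside)
    have "m \<in> T" unfolding T_def using f mle by blast
    then have mS: "m \<le> Sup T" using bdd by (rule cSup_upper)
    have fe: "val f y' e = Fin (Sup T)" using f(2) by (simp add: val_def y'_def)
    show ?thesis
    proof (cases "m = Sup T")
      case True
      have "val f y' v0 \<le> val f y' u" for u
        using True fe m mle[of u] vy[of u f] vy[of v0 f] v0(1) by (cases "u = e") auto
      then show ?thesis unfolding attains_twice_def
        using True fe m v0(1) e vy[of v0 f] by (intro exI[of _ v0] exI[of _ e]) auto
    next
      case False
      then obtain c where c: "c \<in> T" "m < c" using mS \<open>m \<in> T\<close> less_cSupE[of m T] by (metis empty_iff le_less)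
      then obtain g where g: "g \<in> V" "cf g e = Fin 0" "\<And>v. v \<noteq> e \<Longrightarrow> Fin c \<le> val g y v"
        unfolding T_def by blast
      obtain h where h: "h \<in> V" "cf h e = 0" "\<And>u. min (cf f u) (cf g u) \<le> cf h u"
        "\<And>u. cf f u \<noteq> cf g u \<Longrightarrow> cf h u = min (cf f u) (cf g u)"
        by (rule matroidal_elim[OF insert.prems(1) f(1) g(1), of e]) (use f g in auto)
      have hge: "min (val f y u) (val g y u) \<le> val h y u" for u
        using h(3)[of u] by (auto simp: val_def min_def split: if_splits)
      have heq: "val f y u \<noteq> val g y u \<Longrightarrow> val h y u = min (val f y u) (val g y u)" for u
        using h(4)[of u] by (auto simp: val_def min_def)
      have mc: "Fin m < Fin c" using c by simp
      \<comment> \<open>A term of \<open>h\<close> of value \<open>m\<close> cannot come from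
        \<open>g\<close>, whose terms off \<open>e\<close> are all larger; so the double minimum of
        \<open>h\<close> is one of \<open>f\<close>.\<close>
      have hf: "val f y u = Fin m" if "val h y u = Fin m" "u \<noteq> e" for u
        using hge[of u] heq[of u] that mle[OF that(2)] g(3)[OF that(2)] mc
        by (cases "val f y u = val g y u") (auto simp: min_def split: if_splits)
      have hv0: "val h y v0 = Fin m" using heq[of v0] m less_le_trans[OF mc g(3)[of v0]] v0(1) by (auto simp: min_def)
      have hm: "Fin m \<le> val h y u" for u
      proof (cases "u = e")
        case True then show ?thesis using h(2) by (simp add: val_def)
      next
        case False
        then show ?thesis using order_trans[OF min.boundedI hge[of u]] mle[OF False] order_trans[OF less_imp_le[OF mc] g(3)[OF False]] by blast
      qed
      have "h \<in> ?V' - {0}" using h hv0 by (auto simp: in_keys_iff val_def)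
      then obtain a b where ab: "a \<noteq> b" "a \<in> supp h" "b \<in> supp h" "val h y a = val h y b" "\<And>u. val h y a \<le> val h y u"
        using y unfolding attains_twice_def by blast
      have "val h y a = Fin m" using ab(5)[of v0] hv0 hm[of a] by simp
      moreover have "a \<noteq> e" "b \<noteq> e" using ab(2,3) h(2) by (auto simp: in_keys_iff)
      ultimately have "val f y' a = Fin m" "val f y' b = Fin m" using hf ab(4) vy by auto
      moreover have "Fin m \<le> val f y' u" for u using mle[of u] fe mS vy[of u f] by (cases "u = e") auto
      ultimately show ?thesis unfolding attains_twice_def using ab(1) by (metis Fin_neq_zero(1) val_eq_zero)
    qed
  qed
  have "attains_twice f y'" if f: "f \<in> V - {0}" for f
  proof (cases "e \<in> supp f")
    case False
    have "val f y' u = val f y u" for u using False vy[of u f] by (cases "u = e") (auto simp: val_def in_keys_iff)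
    then have "attains_twice f y' = attains_twice f y" unfolding attains_twice_def by simp
    then show ?thesis using y f False by blast
  next
    case True
    then obtain c where "cf f e = Fin c" by (auto simp: in_keys_iff trop_neq_zero_iff)
    then have "attains_twice (scale (-c) f) y'" using main[of "scale (-c) f"] f matroidal_scale[OF insert.prems(1)] by auto
    then show ?thesis by simp
  qed
  then show ?case by blast
qed

section \<open>Leading terms\<close>

text \<open>Comparing equal values by an injective \<open>\<theta>\<close> makes the leading
  monomial unique for every weight, also for those with ties.\<close>

locale tiebreak =
  fixes \<theta> :: "int ^ 'n::finite \<Rightarrow> real"
  assumes inj_theta: "inj \<theta>"
begin

definition lt :: "trop \<times> (int ^ 'n) \<Rightarrow> trop \<times> (int ^ 'n) \<Rightarrow> bool" where
  "lt p q \<longleftrightarrow> fst p < fst q \<or> fst p = fst q \<and> \<theta> (snd p) < \<theta> (snd q)"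

lemma lt_trans: "lt p q \<Longrightarrow> lt q r \<Longrightarrow> lt p r"
  by (auto simp: lt_def)

lemma lt_irrefl [simp]: "\<not> lt p p"
  by (auto simp: lt_def)

lemma lt_linear: "lt p q \<or> p = q \<or> lt q p"
  using injD[OF inj_theta, of "snd p" "snd q"] unfolding lt_def prod_eq_iff
  by (meson linorder_neqE)

definition lval :: "'n laurent \<Rightarrow> (int ^ 'n \<Rightarrow> real) \<Rightarrow> int ^ 'n \<Rightarrow> trop \<times> (int ^ 'n)" where
  "lval f y u = (val f y u, u)"

lemma lval_eq_iff [simp]: "lval f y u = lval g y v \<longleftrightarrow> val f y u = val g y v \<and> u = v"
  by (auto simp: lval_def)

lemma lt_lval_same [simp]: "lt (lval f y u) (lval g y u) \<longleftrightarrow> cf f u < cf g u"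
  by (auto simp: lval_def lt_def val_def)

lemma lt_lval_scale [simp]: "lt (lval (scale c f) y u) (lval (scale c f) y v) \<longleftrightarrow> lt (lval f y u) (lval f y v)"
  by (auto simp: lval_def lt_def)

definition lead :: "(int ^ 'n \<Rightarrow> real) \<Rightarrow> 'n laurent \<Rightarrow> int ^ 'n \<Rightarrow> bool" where
  "lead y f a \<longleftrightarrow> a \<in> supp f \<and> (\<forall>u. u \<noteq> a \<longrightarrow> lt (lval f y a) (lval f y u))"

lemma leadI:
  assumes "a \<in> supp f" "\<And>u. u \<in> supp f \<Longrightarrow> u \<noteq> a \<Longrightarrow> lt (lval f y a) (lval f y u)"
  shows "lead y f a"
  unfolding lead_def
proof (intro conjI allI impI assms(1))
  fix u assume "u \<noteq> a"
  show "lt (lval f y a) (lval f y u)"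
  proof (cases "u \<in> supp f")
    case False
    have "val f y a < 0" using assms(1) by (simp flip: trop_neq_zero_iff_less)
    with False show ?thesis by (simp add: lt_def lval_def val_outside)
  qed (use assms \<open>u \<noteq> a\<close> in auto)
qed

lemma exists_lt_min:
  assumes "finite S" "S \<noteq> {}"
  obtains a where "a \<in> S" "\<And>u. u \<in> S \<Longrightarrow> u \<noteq> a \<Longrightarrow> lt (lval f y a) (lval f y u)"
proof -
  have "\<exists>a\<in>S. \<forall>u\<in>S. u \<noteq> a \<longrightarrow> lt (lval f y a) (lval f y u)"
    using assms
  proof (induction S rule: finite_ne_induct)
    case (insert x F)
    then obtain a where a: "a \<in> F" "\<And>u. u \<in> F \<Longrightarrow> u \<noteq> a \<Longrightarrow> lt (lval f y a) (lval f y u)" by blast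
    have "x \<noteq> a" using a insert by blast
    then consider "lt (lval f y a) (lval f y x)" | "lt (lval f y x) (lval f y a)"
      using lt_linear[of "lval f y a" "lval f y x"] by auto
    then show ?case
    proof cases
      case 1 then show ?thesis using a by blast
    next
      case 2 then show ?thesis using a(2) lt_trans by blast
    qed
  qed auto
  with that show thesis by blast
qed

lemma lead_exists:
  assumes "f \<noteq> 0" obtains a where "lead y f a"
proof -
  obtain a where "a \<in> supp f" "\<And>u. u \<in> supp f \<Longrightarrow> u \<noteq> a \<Longrightarrow> lt (lval f y a) (lval f y u)"
    using exists_lt_min[of "supp f" f y] assms by auto
  then show thesis using that leadI by blast
qed

lemma lead_scale [simp]: "lead y (scale c f) a \<longleftrightarrow> lead y f a"
  by (auto simp: lead_def)

lemma lead_keys: "lead y f a \<Longrightarrow> a \<in> supp f"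
  by (simp add: lead_def)

lemma lead_lt: "lead y f a \<Longrightarrow> u \<noteq> a \<Longrightarrow> lt (lval f y a) (lval f y u)"
  by (simp add: lead_def)

text \<open>At \<open>a\<close> the coefficient of \<open>f\<close> is strictly smaller and
  survives, while no term of \<open>h\<close> is below both of the terms it comes from.\<close>

lemma lead_of_elim:
  assumes "lead y f a" "\<And>u. min (cf f u) (cf g u) \<le> cf h u"
    "\<And>u. cf f u \<noteq> cf g u \<Longrightarrow> cf h u = min (cf f u) (cf g u)"
    and g: "\<And>u. lt (lval f y a) (lval g y u)"
  shows "lead y h a"
  unfolding lead_def
proof (intro conjI allI impI)
  have "cf f a < cf g a" using g[of a] by simp
  then have ha: "cf h a = cf f a" using assms(3)[of a] by auto
  then show "a \<in> supp h" using assms(1) by (auto simp: lead_def in_keys_iff)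
  fix u assume "u \<noteq> a"
  have "lt (lval f y a) (lval f y u)" using assms(1) \<open>u \<noteq> a\<close> by (simp add: lead_def)
  moreover have "min (val f y u) (val g y u) \<le> val h y u"
    using assms(2)[of u] by (auto simp: val_def min_def split: if_splits)
  moreover have "val h y a = val f y a" using ha by (simp add: val_def)
  ultimately show "lt (lval h y a) (lval h y u)"
    using g[of u] by (auto simp: lt_def lval_def min_def split: if_splits)
qed

text \<open>The complement of this set is a basis of the underlying matroid: no nonzero vector is
  supported on it, since its leading monomial is missing there, and \<open>spans\<close> supplies a
  fundamental vector for each leading monomial. Its size is thus the same for all weights, as proved
  in \<open>leads_basis\<close>.\<close>

definition leads :: "(int ^ 'n \<Rightarrow> real) \<Rightarrow> 'n laurent set \<Rightarrow> (int ^ 'n) set" where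
  "leads y V = {a. \<exists>f\<in>V. lead y f a}"

lemma leads_subset: "V \<subseteq> supported_on E \<Longrightarrow> leads y V \<subseteq> E"
  by (auto simp: leads_def lead_def supported_on_def)

definition spans :: "'n laurent set \<Rightarrow> (int ^ 'n) set \<Rightarrow> (int ^ 'n) set \<Rightarrow> bool" where
  "spans V B L \<longleftrightarrow> (\<forall>e\<in>L. \<exists>f\<in>V. e \<in> supp f \<and> supp f \<subseteq> insert e B)"

text \<open>Reducing \<open>f0\<close> by the fundamental vectors of the deletion gives
  \<open>c\<close>, which contains \<open>x\<close> and no old leading monomial, so its leading
  monomial \<open>l\<close> is new. There is no second new one: cancelling \<open>x\<close> between
  \<open>c\<close> and a vector led by another would leave a vector of the deletion led by one of
  the two.\<close>

lemma leads_insert_step: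
  assumes V: "matroidal V" "V \<subseteq> supported_on (insert x E)" and xE: "x \<notin> E" and f0: "f0 \<in> V" "x \<in> supp f0"
    and sp: "spans {f \<in> V. x \<notin> supp f} (E - leads y {f \<in> V. x \<notin> supp f}) (leads y {f \<in> V. x \<notin> supp f})"
  shows "\<exists>l. l \<notin> leads y {f \<in> V. x \<notin> supp f} \<and> leads y V = insert l (leads y {f \<in> V. x \<notin> supp f}) \<and>
      spans V (insert x E - leads y V) (leads y V)"
proof -
  define V' where "V' = {f \<in> V. x \<notin> supp f}"
  define L' where "L' = leads y V'"
  have V'V: "V' \<subseteq> V" by (auto simp: V'_def)
  have "V' \<subseteq> supported_on E" using V(2) by (auto simp: V'_def supported_on_def)
  then have L'E: "L' \<subseteq> E" unfolding L'_def by (rule leads_subset)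
  have sp': "\<exists>g\<in>V'. v \<in> supp g \<and> supp g \<subseteq> insert v (E - L')" if "v \<in> L'" for v
    using sp that unfolding spans_def V'_def L'_def by blast
  \<comment> \<open>Each elimination removes one monomial of \<open>L'\<close> and brings in none;
    \<open>x\<close> survives because \<open>g\<close> does not contain it.\<close>
  have "\<exists>c\<in>V. x \<in> supp c \<and> supp c \<subseteq> insert x (E - L')" if "f \<in> V" "x \<in> supp f" for f
    using that
  proof (induction "card (supp f \<inter> L')" arbitrary: f rule: less_induct)
    case less
    show ?case
    proof (cases "supp f \<inter> L' = {}")
      case True
      moreover have "supp f \<subseteq> insert x E" using V(2) less.prems by (auto simp: supported_on_def)
      ultimately show ?thesis using less.prems by blast
    next
      case False
      then obtain v where v: "v \<in> supp f" "v \<in> L'" by blast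
      obtain g where g: "g \<in> V'" "v \<in> supp g" "supp g \<subseteq> insert v (E - L')" using sp'[OF v(2)] by blast
      obtain s h where h: "h \<in> V" "cf f v = Fin s * cf g v"
        "\<And>u. cf f u \<noteq> Fin s * cf g u \<Longrightarrow> cf h u = min (cf f u) (Fin s * cf g u)"
        "supp h \<subseteq> (supp f \<union> supp g) - {v}"
        by (rule matroidal_elim_scaled[OF V(1) less.prems(1), of g v]) (use g v V'V in blast)+
      have "cf g x = 0" using g(1) by (auto simp: V'_def in_keys_iff)
      then have "x \<in> supp h" using h(3)[of x] less.prems(2) by (auto simp: in_keys_iff)
      moreover have "supp h \<inter> L' \<subset> supp f \<inter> L'" using h(4) g(3) v by blast
      then have "card (supp h \<inter> L') < card (supp f \<inter> L')" by (intro psubset_card_mono) auto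
      ultimately show ?thesis using less.hyps h(1) by blast
    qed
  qed
  then obtain c where c: "c \<in> V" "x \<in> supp c" "supp c \<subseteq> insert x (E - L')" using f0 by blast
  then have "c \<noteq> 0" by auto
  then obtain l where l: "lead y c l" by (rule lead_exists)
  have lc: "l \<in> supp c" using l by (rule lead_keys)
  then have lL': "l \<notin> L'" using c(3) xE L'E by auto
  have lL: "l \<in> leads y V" using l c(1) by (auto simp: leads_def)
  have "m \<in> insert l L'" if m: "m \<in> leads y V" for m
  proof (rule ccontr)
    assume nm: "m \<notin> insert l L'"
    obtain f where f: "f \<in> V" "lead y f m" using m by (auto simp: leads_def)
    have xf: "x \<in> supp f" using nm f by (auto simp: L'_def leads_def V'_def)
    obtain s h where h: "h \<in> V" "cf f x = Fin s * cf c x" "\<And>u. min (cf f u) (Fin s * cf c u) \<le> cf h u"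
      "\<And>u. cf f u \<noteq> Fin s * cf c u \<Longrightarrow> cf h u = min (cf f u) (Fin s * cf c u)"
      "supp h \<subseteq> (supp f \<union> supp c) - {x}"
      by (rule matroidal_elim_scaled[OF V(1) f(1) c(1) xf c(2)]) blast
    have hV': "h \<in> V'" using h(1,5) by (auto simp: V'_def)
    let ?c = "scale s c"
    have lc': "lead y ?c l" using l by simp
    \<comment> \<open>Whichever of the two leading terms comes first in the order also leads
      \<open>h\<close>.\<close>
    consider "lt (lval f y m) (lval ?c y l)" | "lt (lval ?c y l) (lval f y m)"
      using lt_linear[of "lval f y m" "lval ?c y l"] nm by auto
    then show False
    proof cases
      case 1
      have "lead y h m"
      proof (rule lead_of_elim[OF f(2), of ?c])
        show "lt (lval f y m) (lval ?c y u)" for u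
          using 1 lead_lt[OF lc', of u] lt_trans by (cases "u = l") blast+
      qed (use h in auto)
      then show False using hV' nm by (auto simp: L'_def leads_def)
    next
      case 2
      have "lead y h l"
      proof (rule lead_of_elim[OF lc', of f])
        show "lt (lval ?c y l) (lval f y u)" for u
          using 2 lead_lt[OF f(2), of u] lt_trans by (cases "u = m") blast+
        show "min (cf ?c u) (cf f u) \<le> cf h u" for u using h(3)[of u] by (simp add: min.commute)
        show "cf ?c u \<noteq> cf f u \<Longrightarrow> cf h u = min (cf ?c u) (cf f u)" for u using h(4)[of u] by (auto simp: min.commute)
      qed
      then show False using hV' lL' by (auto simp: L'_def leads_def)
    qed
  qed
  moreover have "L' \<subseteq> leads y V" using V'V by (auto simp: L'_def leads_def)
  ultimately have LV: "leads y V = insert l L'" using lL by blast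
  have "spans V (insert x E - leads y V) (leads y V)"
    unfolding spans_def
  proof
    fix e assume e: "e \<in> leads y V"
    show "\<exists>f\<in>V. e \<in> supp f \<and> supp f \<subseteq> insert e (insert x E - leads y V)"
    proof (cases "e = l")
      case True
      then show ?thesis using c lc LV xE L'E by (intro bexI[of _ c]) auto
    next
      case False
      then have eL': "e \<in> L'" using e LV by auto
      then obtain g where g: "g \<in> V'" "e \<in> supp g" "supp g \<subseteq> insert e (E - L')" using sp' by blast
      show ?thesis
      proof (cases "l \<in> supp g")
        case lg: False
        then show ?thesis using g LV V'V by (intro bexI[of _ g]) auto
      next
        case lg: True
        \<comment> \<open>\<open>l\<close> has become a leading monomial and must leave the
          fundamental vector of \<open>e\<close>; \<open>c\<close> removes it without touching
          \<open>e\<close>, because \<open>c\<close> avoids \<open>L'\<close>.\<close>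
        obtain s h where h: "h \<in> V" "\<And>u. cf g u \<noteq> Fin s * cf c u \<Longrightarrow> cf h u = min (cf g u) (Fin s * cf c u)"
          "supp h \<subseteq> (supp g \<union> supp c) - {l}"
          by (rule matroidal_elim_scaled[OF V(1) _ c(1) lg lc]) (use g(1) V'V in auto)
        have "e \<notin> supp c" using c(3) eL' xE L'E by auto
        then have "e \<in> supp h" using h(2)[of e] g(2) by (auto simp: in_keys_iff)
        moreover have "x \<notin> L'" using xE L'E by blast
        then have "supp h \<subseteq> insert e (insert x E - leads y V)" unfolding LV using h(3) g(3) c(3) by blast
        ultimately show ?thesis using h(1) by blast
      qed
    qed
  qed
  with LV lL' show ?thesis unfolding L'_def V'_def by blast
qed

text \<open>Whether \<open>x\<close> occurs in some vector does not depend on the weight, and if it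
  does, every weight gains exactly one leading monomial.\<close>

lemma leads_basis:
  assumes "finite E" "matroidal V" "V \<subseteq> supported_on E"
  shows "spans V (E - leads y V) (leads y V) \<and> card (leads y V) = card (leads y' V)"
  using assms
proof (induction E arbitrary: V y rule: finite_induct)
  case empty
  then have "leads y V = {}" for y using leads_subset by blast
  then show ?case by (auto simp: spans_def)
next
  case (insert x E)
  let ?V' = "{f \<in> V. x \<notin> supp f}"
  have V': "matroidal ?V'" "?V' \<subseteq> supported_on E"
    using matroidal_deletion[OF insert.prems(1)] insert.prems(2) by (auto simp: supported_on_def)
  note IH = insert.IH[OF V']
  show ?case
  proof (cases "\<exists>f\<in>V. x \<in> supp f")
    case False
    then have "?V' = V" by auto
    then have "spans V (E - leads y V) (leads y V) \<and> card (leads y V) = card (leads y' V)"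
      using IH[of y] by simp
    then show ?thesis unfolding spans_def by blast
  next
    case True
    then obtain f0 where f0: "f0 \<in> V" "x \<in> supp f0" by blast
    have *: "card (leads z V) = Suc (card (leads z ?V')) \<and> spans V (insert x E - leads z V) (leads z V)" for z
    proof -
      have "finite (leads z ?V')" using leads_subset[OF V'(2)] insert.hyps(1) finite_subset by blast
      then show ?thesis
        using leads_insert_step[OF insert.prems insert.hyps(2) f0, of z] IH[of z] by auto
    qed
    then show ?thesis using IH[of y] by simp
  qed
qed

end

section \<open>Finitely many polynomials\<close>

lemma convex_hull_finite_image:
  fixes p :: "'i \<Rightarrow> 'a::real_vector"
  assumes "finite T"
  shows "convex hull (p ` T) = {(\<Sum>t\<in>T. l t *\<^sub>R p t) | l. (\<forall>t\<in>T. 0 \<le> l t) \<and> sum l T = (1::real)}"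
    (is "_ = ?R")
proof
  show "convex hull (p ` T) \<subseteq> ?R"
  proof
    fix x assume "x \<in> convex hull (p ` T)"
    then obtain u where u: "\<forall>q\<in>p ` T. 0 \<le> u q" "sum u (p ` T) = 1" "(\<Sum>q\<in>p ` T. u q *\<^sub>R q) = x"
      using assms by (auto simp: convex_hull_finite)
    \<comment> \<open>One preimage is chosen for each point. Indexing the coefficients by
      \<open>T\<close> instead of by points matters in \<open>approximate_root\<close>, where a
      single entry of an index is changed.\<close>
    define U where "U = inv_into T p ` (p ` T)"
    have UT: "U \<subseteq> T" unfolding U_def by (auto intro: inv_into_into)
    have inj: "inj_on (inv_into T p) (p ` T)" by (rule inj_on_inv_into) simp
    define l where "l t = (if t \<in> U then u (p t) else 0)" for t
    have "sum l T = sum l U" using UT assms by (intro sum.mono_neutral_right) (auto simp: l_def)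
    also have "\<dots> = sum u (p ` T)" unfolding U_def sum.reindex[OF inj]
      by (intro sum.cong) (auto simp: l_def U_def f_inv_into_f)
    finally have 1: "sum l T = 1" using u by simp
    have "(\<Sum>t\<in>T. l t *\<^sub>R p t) = (\<Sum>t\<in>U. l t *\<^sub>R p t)" using UT assms
      by (intro sum.mono_neutral_right) (auto simp: l_def)
    also have "\<dots> = (\<Sum>q\<in>p ` T. u q *\<^sub>R q)" unfolding U_def sum.reindex[OF inj]
      by (intro sum.cong) (auto simp: l_def U_def f_inv_into_f)
    finally have "(\<Sum>t\<in>T. l t *\<^sub>R p t) = x" using u by simp
    moreover have "\<forall>t\<in>T. 0 \<le> l t" using u(1) by (auto simp: l_def)
    ultimately show "x \<in> ?R" using 1 by blast
  qed
  show "?R \<subseteq> convex hull (p ` T)"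
    using assms by (auto intro!: convex_sum intro: hull_inc)
qed

text \<open>In the cone \<open>?K\<close> the extra generator \<open>(0, 1)\<close> absorbs slack.
  If \<open>(0, -1)\<close> lies in the cone, its coefficients are the certificate
  \<open>\<mu>\<close>. Otherwise a hyperplane separates it from the closed cone; the last
  coordinate of the normal vector is positive, and dividing by it gives \<open>w\<close>.\<close>

lemma farkas:
  fixes c :: "'i \<Rightarrow> 'a::euclidean_space" and b :: "'i \<Rightarrow> real"
  assumes "finite T"
  shows "(\<exists>w. \<forall>t\<in>T. 0 \<le> c t \<bullet> w + b t) \<or>
    (\<exists>\<mu>. (\<forall>t\<in>T. 0 \<le> \<mu> t) \<and> (\<Sum>t\<in>T. \<mu> t *\<^sub>R c t) = 0 \<and> (\<Sum>t\<in>T. \<mu> t * b t) < 0)"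
proof -
  let ?p = "\<lambda>x. case x of None \<Rightarrow> (0, 1) | Some t \<Rightarrow> (c t, b t)"
  let ?T = "insert None (Some ` T)"
  let ?K = "convex_cone hull (?p ` ?T)"
  have fin: "finite ?T" using assms by simp
  have sumT: "(\<Sum>x\<in>?T. g x) = g None + (\<Sum>t\<in>T. g (Some t))" for g :: "'i option \<Rightarrow> 'b::comm_monoid_add"
    using assms by (subst sum.insert) (auto simp: sum.reindex)
  show ?thesis
  proof (cases "(0, -1) \<in> ?K")
    case True
    moreover have "convex_cone hull (?p ` ?T) = (\<Union>x \<in> convex hull (?p ` ?T). \<Union>c\<in>{0..}. {c *\<^sub>R x})"
      by (rule convex_cone_hull_convex_hull_nonempty) simp
    ultimately obtain x r where x: "x \<in> convex hull (?p ` ?T)" "0 \<le> r" "(0, -1) = r *\<^sub>R x" by auto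
    then obtain l where l: "\<forall>t\<in>?T. 0 \<le> l t" "x = (\<Sum>t\<in>?T. l t *\<^sub>R ?p t)"
      unfolding convex_hull_finite_image[OF fin] by blast
    have x2: "fst x = (\<Sum>t\<in>T. l (Some t) *\<^sub>R c t)" "snd x = l None + (\<Sum>t\<in>T. l (Some t) * b t)"
      unfolding l(2) sumT by (simp_all add: fst_sum snd_sum)
    have 1: "r *\<^sub>R fst x = 0" "r * snd x = -1" using x(3) by (simp_all add: prod_eq_iff)
    define \<mu> where "\<mu> t = r * l (Some t)" for t
    have "\<forall>t\<in>T. 0 \<le> \<mu> t" using l(1) x(2) by (auto simp: \<mu>_def)
    moreover have "(\<Sum>t\<in>T. \<mu> t *\<^sub>R c t) = 0" using 1(1)
      unfolding \<mu>_def x2 by (simp add: scaleR_sum_right)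
    moreover have "(\<Sum>t\<in>T. \<mu> t * b t) < 0"
    proof -
      have "r * l None + (\<Sum>t\<in>T. \<mu> t * b t) = -1" using 1(2) unfolding \<mu>_def x2
        by (simp add: sum_distrib_left algebra_simps)
      moreover have "0 \<le> r * l None" using l(1) x(2) by auto
      ultimately show ?thesis by linarith
    qed
    ultimately show ?thesis by blast
  next
    case False
    have cl: "closed ?K" using fin by (intro polyhedron_imp_closed polyhedron_convex_cone_hull) auto
    obtain a \<beta> where "a \<bullet> (0, -1) < \<beta> \<and> (\<forall>x\<in>?K. \<beta> < a \<bullet> x)"
      using separating_hyperplane_closed_point[OF convex_convex_cone_hull cl False] by blast
    then have a: "a \<bullet> (0, -1) < \<beta>" "\<And>x. x \<in> ?K \<Longrightarrow> \<beta> < a \<bullet> x" by blast+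
    have \<beta>: "\<beta> < 0" using a(2)[of 0] convex_cone_hull_contains_0 by auto
    \<comment> \<open>A functional bounded below on a cone is nonnegative on it: a rescaled point
      would otherwise take the excluded value \<open>\<beta>\<close>.\<close>
    have pos: "0 \<le> a \<bullet> x" if "x \<in> ?K" for x
    proof (rule ccontr)
      assume neg: "\<not> 0 \<le> a \<bullet> x"
      have "(\<beta> / (a \<bullet> x)) *\<^sub>R x \<in> ?K" using that neg \<beta>
        by (intro convex_cone_hull_mul) (auto simp: divide_nonpos_nonpos)
      from a(2)[OF this] neg show False by simp
    qed
    obtain w \<omega> where aw: "a = (w, \<omega>)" by (cases a)
    have "0 \<le> a \<bullet> ?p None" by (intro pos hull_inc) auto
    then have "0 \<le> \<omega>" by (simp add: aw)
    have "\<omega> > 0" 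
    proof (rule ccontr)
      assume "\<not> \<omega> > 0"
      then have "\<omega> = 0" using \<open>0 \<le> \<omega>\<close> by simp
      then show False using a(1) \<beta> by (simp add: aw)
    qed
    have "0 \<le> c t \<bullet> (w /\<^sub>R \<omega>) + b t" if "t \<in> T" for t
    proof -
      have "?p (Some t) \<in> ?p ` ?T" using that by blast
      then have "0 \<le> a \<bullet> ?p (Some t)" by (intro pos hull_inc)
      then have "0 \<le> w \<bullet> c t + \<omega> * b t" by (simp add: aw)
      then have "0 \<le> (w \<bullet> c t + \<omega> * b t) / \<omega>" using \<open>\<omega> > 0\<close> by simp
      then show ?thesis using \<open>\<omega> > 0\<close> by (simp add: field_simps inner_commute)
    qed
    then show ?thesis by blast
  qed
qed

section \<open>Lattice points, degrees and shifts\<close>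

lemma real_vec_simps [simp]:
  "real_vec (u + v) = real_vec u + real_vec v" "real_vec (u - v) = real_vec u - real_vec v"
  "real_vec 0 = 0" "real_vec (- u) = - real_vec u"
  by (auto simp: real_vec_def vec_eq_iff)

lemma real_vec_eq_iff [simp]: "real_vec u = real_vec v \<longleftrightarrow> u = v"
  by (auto simp: real_vec_def vec_eq_iff)

lemma real_vec_sum [simp]: "real_vec (\<Sum>i\<in>A. f i) = (\<Sum>i\<in>A. real_vec (f i))"
  by (induction A rule: infinite_finite_induct) auto

text \<open>The maximum norm plays the role of the degree of a Laurent monomial; it is subadditive
  by \<open>cube_add\<close>.\<close>

definition cube :: "nat \<Rightarrow> (int ^ 'n::finite) set" where
  "cube d = {u. \<forall>i. \<bar>u $ i\<bar> \<le> int d}"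

lemma finite_cube [simp]: "finite (cube d)"
proof -
  have "cube d \<subseteq> (\<lambda>f. \<chi> i. f i) ` (PiE UNIV (\<lambda>_. {- int d..int d}))"
  proof
    fix u assume "u \<in> cube d"
    then show "u \<in> (\<lambda>f. \<chi> i. f i) ` (PiE UNIV (\<lambda>_. {- int d..int d}))"
      by (intro image_eqI[of _ _ "\<lambda>i. u $ i"]) (auto simp: cube_def abs_le_iff minus_le_iff)
  qed
  then show ?thesis by (rule finite_subset) (intro finite_imageI finite_PiE, auto)
qed

lemma finite_subset_cube:
  assumes "finite S" obtains d where "S \<subseteq> cube d"
proof -
  define d where "d = nat (Max (insert 0 ((\<lambda>(u,i). \<bar>u $ i\<bar>) ` (S \<times> UNIV))))"
  have "\<bar>u $ i\<bar> \<le> Max (insert 0 ((\<lambda>(u,i). \<bar>u $ i\<bar>) ` (S \<times> UNIV)))" if "u \<in> S" for u i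
    using assms that by (intro Max_ge) auto
  then have "S \<subseteq> cube d" by (force simp: cube_def d_def)
  then show thesis by (rule that)
qed

lemma finite_bounded_lattice:
  assumes "bounded B" shows "finite {s. real_vec s \<in> B}"
proof -
  obtain K where K: "\<And>x. x \<in> B \<Longrightarrow> norm x \<le> K" using assms bounded_iff by blast
  have "{s. real_vec s \<in> B} \<subseteq> cube (nat \<lceil>K\<rceil>)"
  proof (unfold cube_def, intro subsetI CollectI allI)
    fix s :: "int ^ 'a" and i assume "s \<in> {s. real_vec s \<in> B}"
    then have "real_vec s \<in> B" by simp
    then have "\<bar>real_vec s $ i\<bar> \<le> K" using K component_le_norm_cart order_trans by blast
    then have "real_of_int \<bar>s $ i\<bar> \<le> K" by (simp add: real_vec_def)
    then show "\<bar>s $ i\<bar> \<le> int (nat \<lceil>K\<rceil>)" by linarith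
  qed
  then show ?thesis by (rule finite_subset) simp
qed

definition lin :: "real ^ 'n \<Rightarrow> int ^ 'n::finite \<Rightarrow> real" where
  "lin w u = real_vec u \<bullet> w"

lemma lin_simps [simp]: "lin w (u + v) = lin w u + lin w v" "lin w (u - v) = lin w u - lin w v" "lin w 0 = 0"
  by (simp_all add: lin_def inner_simps)

definition real_coeff :: "'n::finite laurent \<Rightarrow> int ^ 'n \<Rightarrow> real" where
  "real_coeff f u = (THE c. cf f u = Fin c)"

lemma lookup_real_coeff: "u \<in> supp f \<Longrightarrow> cf f u = Fin (real_coeff f u)"
  by (auto simp: in_keys_iff trop_neq_zero_iff real_coeff_def)

lemma val_real_coeff: "u \<in> supp f \<Longrightarrow> val f y u = Fin (real_coeff f u + y u)"
  by (simp add: val_def lookup_real_coeff)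

definition shift :: "int ^ 'n \<Rightarrow> 'n::finite laurent \<Rightarrow> 'n laurent" where
  "shift a f = Poly_Mapping.single a 1 * f"

lemma lookup_shift [simp]: "cf (shift a f) u = cf f (u - a)"
  by (simp add: shift_def)

lemma keys_shift: "supp (shift a f) = (\<lambda>u. a + u) ` supp f"
proof (intro set_eqI iffI)
  fix u assume "u \<in> supp (shift a f)"
  then show "u \<in> (\<lambda>u. a + u) ` supp f" by (intro image_eqI[of _ _ "u - a"]) (auto simp: in_keys_iff)
qed (auto simp: in_keys_iff)

text \<open>\<open>\<Lambda>\<close> is the full lattice for the torus and the lattice orthogonal to
  a cone for an orbit, so that no coordinates on the orbit need to be chosen. Monomials with
  exponents in \<open>\<Lambda>\<close> are units, hence \<open>no_monomial\<close> expresses that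
  the ideal is proper.\<close>

locale tropical_lattice_ideal =
  fixes \<Lambda> :: "(int ^ 'n::finite) set" and J :: "'n laurent set"
  assumes zero_lat: "0 \<in> \<Lambda>" and add_lat: "u \<in> \<Lambda> \<Longrightarrow> v \<in> \<Lambda> \<Longrightarrow> u + v \<in> \<Lambda>"
    and diff_lat: "u \<in> \<Lambda> \<Longrightarrow> v \<in> \<Lambda> \<Longrightarrow> u - v \<in> \<Lambda>"
    and supported: "J \<subseteq> supported_on \<Lambda>" and mat: "matroidal J"
    and shift_closed: "f \<in> J \<Longrightarrow> a \<in> \<Lambda> \<Longrightarrow> shift a f \<in> J"
    and no_monomial: "f \<in> J \<Longrightarrow> card (supp f) \<noteq> 1"
begin

lemma keys_lat: "f \<in> J \<Longrightarrow> u \<in> supp f \<Longrightarrow> u \<in> \<Lambda>"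
  using supported by (auto simp: supported_on_def)

lemma sum_lat: "(\<And>i. i \<in> A \<Longrightarrow> f i \<in> \<Lambda>) \<Longrightarrow> (\<Sum>i\<in>A. f i) \<in> \<Lambda>"
  by (induction A rule: infinite_finite_induct) (auto simp: zero_lat add_lat)

text \<open>
  The number \<open>\<Phi> s\<close> is the value at \<open>s\<close> of the lower convex hull of the tropical product of all the \<open>g j\<close>, where \<open>g (f, a)\<close> is
  \<open>f\<close> with its coefficient at \<open>a\<close> raised by \<open>\<epsilon>\<close>. At a minimum \<open>s\<close> of \<open>\<Phi> + y\<close> take a supporting hyperplane of \<open>\<Phi>\<close> with slope \<open>- w\<close>.
  If \<open>f\<close> attained its minimum at \<open>w\<close> only at \<open>a\<close>, with a gap larger than \<open>\<epsilon>\<close>, then so would \<open>g (f, a)\<close>,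
  and exchanging \<open>a\<close> for the other monomials of \<open>f\<close> shows that the shift of \<open>f\<close> by \<open>s - a\<close> attains its minimum at \<open>y\<close> only at \<open>s\<close>.
  The \<open>\<epsilon>\<close> makes this minimum strict.
\<close>

lemma approximate_root:
  assumes F: "finite F" "F \<subseteq> J - {0}" and eps: "0 < \<epsilon>"
  shows "\<exists>w. \<forall>f\<in>F. \<not> (\<exists>a\<in>supp f. \<forall>u\<in>supp f - {a}. real_coeff f a + lin w a + \<epsilon> < real_coeff f u + lin w u)"
proof -
  define Jx where "Jx = (SIGMA f:F. supp f)"
  have finJ: "finite Jx" using F by (auto simp: Jx_def)
  define g where "g j u = real_coeff (fst j) u + (if u = snd j then \<epsilon> else 0)" for j :: "'n laurent \<times> (int ^ 'n)" and u
  \<comment> \<open>\<open>t\<close> picks a term from every factor, so \<open>P t\<close> and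
    \<open>G t\<close> are the exponent and the coefficient of a term of the expanded product, and
    \<open>H\<close> is the convex hull of these lifted exponents.\<close>
  define T where "T = PiE Jx (\<lambda>j. supp (fst j))"
  have finT: "finite T" unfolding T_def by (intro finite_PiE finJ) auto
  have "T \<noteq> {}" unfolding T_def PiE_eq_empty_iff by (auto simp: Jx_def)
  define P where "P t = (\<Sum>j\<in>Jx. t j)" for t :: "'n laurent \<times> (int ^ 'n) \<Rightarrow> int ^ 'n"
  define G where "G t = (\<Sum>j\<in>Jx. g j (t j))" for t :: "'n laurent \<times> (int ^ 'n) \<Rightarrow> int ^ 'n"
  define p where "p t = (real_vec (P t), G t)" for t
  define H where "H = convex hull (p ` T)"
  have cH: "compact H" unfolding H_def using finT by (intro finite_imp_compact_convex_hull) auto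
  have p_upd: "p (t(j := u)) = p t + (real_vec (u - t j), g j u - g j (t j))" if "j \<in> Jx" for t j u
  proof -
    have "P (t(j := u)) = P t + (u - t j)"
      unfolding P_def using finJ that by (simp add: sum.remove[of Jx j])
    moreover have "G (t(j := u)) = G t + (g j u - g j (t j))"
      unfolding G_def using finJ that by (simp add: sum.remove[of Jx j])
    ultimately show ?thesis by (simp add: p_def)
  qed
  \<comment> \<open>All points of \<open>\<Lambda>\<close> in the Newton polytope are taken, not
    only the exponents \<open>P t\<close>: exchanging a monomial may lead from \<open>s\<close> to
    any of them.\<close>
  define S where "S = {s \<in> \<Lambda>. real_vec s \<in> fst ` H}"
  have finS: "finite S"
    using finite_bounded_lattice[OF bounded_fst[OF compact_imp_bounded[OF cH]]]
    by (rule rev_finite_subset) (auto simp: S_def)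
  have "S \<noteq> {}"
  proof -
    obtain t where t: "t \<in> T" using \<open>T \<noteq> {}\<close> by blast
    have "t j \<in> \<Lambda>" if "j \<in> Jx" for j
      using t F(2) that by (intro keys_lat[of "fst j"]) (auto simp: T_def Jx_def PiE_iff)
    then have "P t \<in> \<Lambda>" unfolding P_def by (rule sum_lat)
    moreover have "real_vec (P t) \<in> fst ` H" unfolding H_def using t
      by (intro image_eqI[of _ _ "p t"]) (auto simp: p_def intro: hull_inc)
    ultimately show ?thesis by (auto simp: S_def)
  qed
  have "\<exists>y. \<forall>f\<in>J \<inter> supported_on S - {0}. attains_twice f y"
    using finS matroidal_restrict[OF mat] by (intro exists_covector) (auto dest: no_monomial)
  then obtain y where y: "\<And>f. f \<in> J \<Longrightarrow> supp f \<subseteq> S \<Longrightarrow> f \<noteq> 0 \<Longrightarrow> attains_twice f y"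
    by (auto simp: supported_on_def)
  have "\<exists>r. (real_vec s, r) \<in> H \<and> (\<forall>r'. (real_vec s, r') \<in> H \<longrightarrow> r \<le> r')" if "s \<in> S" for s
  proof -
    have c: "compact (H \<inter> ({real_vec s} \<times> UNIV))"
      by (intro compact_Int_closed cH closed_Times) auto
    have ne: "H \<inter> ({real_vec s} \<times> UNIV) \<noteq> {}" using that by (force simp: S_def)
    obtain x where "x \<in> H \<inter> ({real_vec s} \<times> UNIV)" "\<forall>x'\<in>H \<inter> ({real_vec s} \<times> UNIV). snd x \<le> snd x'"
      using continuous_attains_inf[OF c ne, of snd] continuous_on_snd[OF continuous_on_id] by auto
    then show ?thesis by (intro exI[of _ "snd x"]) force
  qed
  then obtain \<Phi> where \<Phi>: "\<And>s. s \<in> S \<Longrightarrow> (real_vec s, \<Phi> s) \<in> H"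
    "\<And>s r'. s \<in> S \<Longrightarrow> (real_vec s, r') \<in> H \<Longrightarrow> \<Phi> s \<le> r'" by metis
  obtain s where s: "s \<in> S" "\<And>s'. s' \<in> S \<Longrightarrow> \<Phi> s + y s \<le> \<Phi> s' + y s'"
    using finite_has_minimal[of "(\<lambda>s. \<Phi> s + y s) ` S"] finS \<open>S \<noteq> {}\<close>
    by (auto simp: image_iff) (metis linorder_linear)
  have sH: "\<Phi> s + y s \<le> r' + y s'" if "(real_vec s', r') \<in> H" "s' \<in> \<Lambda>" for s' r'
  proof -
    have "s' \<in> S" using that by (force simp: S_def)
    then show ?thesis using s(2)[of s'] \<Phi>(2)[of s' r'] that by simp
  qed
  \<comment> \<open>A certificate, divided by its total weight \<open>m\<close>, would give a point
    of \<open>H\<close> strictly below \<open>(s, \<Phi> s)\<close>.\<close>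
  have no: "\<nexists>\<mu>. (\<forall>t\<in>T. 0 \<le> \<mu> t) \<and> (\<Sum>t\<in>T. \<mu> t *\<^sub>R (real_vec (P t) - real_vec s)) = 0 \<and> (\<Sum>t\<in>T. \<mu> t * (G t - \<Phi> s)) < 0"
  proof (rule notI, elim exE conjE)
    fix \<mu> assume mu: "\<forall>t\<in>T. 0 \<le> \<mu> t" "(\<Sum>t\<in>T. \<mu> t *\<^sub>R (real_vec (P t) - real_vec s)) = 0" "(\<Sum>t\<in>T. \<mu> t * (G t - \<Phi> s)) < 0"
    define m where "m = sum \<mu> T"
    have "m \<noteq> 0"
    proof
      assume "m = 0"
      then have "\<forall>t\<in>T. \<mu> t = 0" using mu(1) finT by (simp add: m_def sum_nonneg_eq_0_iff)
      then show False using mu(3) by simp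
    qed
    moreover have "m \<ge> 0" unfolding m_def using mu(1) by (simp add: sum_nonneg)
    ultimately have m: "m > 0" by simp
    have 1: "(\<Sum>t\<in>T. (\<mu> t / m) *\<^sub>R p t) \<in> H"
      unfolding H_def convex_hull_finite_image[OF finT] using mu(1) m
      by (intro CollectI exI[of _ "\<lambda>t. \<mu> t / m"]) (auto simp flip: sum_divide_distrib simp: m_def)
    have A: "(\<Sum>t\<in>T. \<mu> t *\<^sub>R real_vec (P t)) = m *\<^sub>R real_vec s"
      using mu(2) by (simp add: m_def scaleR_diff_right sum_subtractf scaleR_sum_left)
    have B: "(\<Sum>t\<in>T. \<mu> t * G t) < m * \<Phi> s"
      using mu(3) by (simp add: m_def right_diff_distrib sum_subtractf sum_distrib_right)
    obtain x r where xr: "(\<Sum>t\<in>T. (\<mu> t / m) *\<^sub>R p t) = (x, r)" by (rule prod.exhaust)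
    have "fst (\<Sum>t\<in>T. (\<mu> t / m) *\<^sub>R p t) = (1/m) *\<^sub>R (\<Sum>t\<in>T. \<mu> t *\<^sub>R real_vec (P t))"
      by (simp add: fst_sum p_def scaleR_sum_right)
    then have "fst (\<Sum>t\<in>T. (\<mu> t / m) *\<^sub>R p t) = real_vec s" using A m by simp
    moreover have "snd (\<Sum>t\<in>T. (\<mu> t / m) *\<^sub>R p t) = (\<Sum>t\<in>T. \<mu> t * G t) / m"
      by (simp add: snd_sum p_def sum_divide_distrib)
    then have "snd (\<Sum>t\<in>T. (\<mu> t / m) *\<^sub>R p t) < \<Phi> s"
      using B m by (simp only: pos_divide_less_eq mult.commute[of "\<Phi> s"])
    ultimately show False using \<Phi>(2)[OF s(1), of r] 1 by (simp add: xr)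
  qed
  obtain w where w: "\<And>t. t \<in> T \<Longrightarrow> 0 \<le> (real_vec (P t) - real_vec s) \<bullet> w + (G t - \<Phi> s)"
    by (rule disjE[OF farkas[OF finT, of "\<lambda>t. real_vec (P t) - real_vec s" "\<lambda>t. G t - \<Phi> s"]])
      (blast, erule notE[OF no])
  let ?h = "\<lambda>x. fst x \<bullet> w + snd x"
  have w': "?h (real_vec s, \<Phi> s) \<le> ?h (p t)" if "t \<in> T" for t
    using w[OF that] by (simp add: p_def inner_diff_left)
  obtain l where l: "\<forall>t\<in>T. 0 \<le> l t" "sum l T = 1" "(real_vec s, \<Phi> s) = (\<Sum>t\<in>T. l t *\<^sub>R p t)"
    using \<Phi>(1)[OF s(1)] unfolding H_def convex_hull_finite_image[OF finT] by blast
  \<comment> \<open>A convex combination of points on or above the supporting hyperplane lies on it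
    only if all points with nonzero weight do.\<close>
  have act: "?h (p t) = ?h (real_vec s, \<Phi> s)" if "t \<in> T" "l t \<noteq> 0" for t
  proof -
    have "(\<Sum>t\<in>T. l t * ?h (p t)) = ?h (\<Sum>t\<in>T. l t *\<^sub>R p t)"
      by (simp add: fst_sum snd_sum inner_sum_left sum.distrib algebra_simps)
    then have "(\<Sum>t\<in>T. l t * (?h (p t) - ?h (real_vec s, \<Phi> s))) = 0"
      using l(2,3) by (simp add: right_diff_distrib sum_subtractf flip: sum_distrib_right)
    then have "\<forall>t\<in>T. l t * (?h (p t) - ?h (real_vec s, \<Phi> s)) = 0"
      using l(1) w' finT by (subst (asm) sum_nonneg_eq_0_iff) auto
    then have "l t * (?h (p t) - ?h (real_vec s, \<Phi> s)) = 0" using that(1) by (rule bspec)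
    then show ?thesis using that(2) by simp
  qed
  have "\<not> (\<exists>a\<in>supp f. \<forall>u\<in>supp f - {a}. real_coeff f a + lin w a + \<epsilon> < real_coeff f u + lin w u)" if f: "f \<in> F" for f
  proof
    assume "\<exists>a\<in>supp f. \<forall>u\<in>supp f - {a}. real_coeff f a + lin w a + \<epsilon> < real_coeff f u + lin w u"
    then obtain a where a: "a \<in> supp f" "\<And>u. u \<in> supp f \<Longrightarrow> u \<noteq> a \<Longrightarrow> real_coeff f a + lin w a + \<epsilon> < real_coeff f u + lin w u" by blast
    define j where "j = (f, a)"
    have j: "j \<in> Jx" using f a by (simp add: Jx_def j_def)
    have upT: "t(j := u) \<in> T" if "t \<in> T" "u \<in> supp f" for t u
      using that j by (auto simp: T_def PiE_iff j_def extensional_def)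
    \<comment> \<open>Exchanging \<open>t j\<close> for \<open>a\<close> would lead below the
      supporting hyperplane: the gap exceeds \<open>\<epsilon>\<close>, so \<open>a\<close> is the
      cheaper choice even with its raised coefficient.\<close>
    have tj: "t j = a" if "t \<in> T" "l t \<noteq> 0" for t
    proof (rule ccontr)
      assume ne: "t j \<noteq> a"
      have tjf: "t j \<in> supp f" using that(1) j by (auto simp: T_def PiE_iff j_def)
      have "?h (p t) \<le> ?h (p (t(j := a)))" using w'[OF upT[OF that(1) a(1)]] act[OF that] by simp
      also have "\<dots> = ?h (p t) + (lin w a - lin w (t j)) + (real_coeff f a + \<epsilon> - real_coeff f (t j))"
        using ne unfolding p_upd[OF j] by (simp add: g_def j_def lin_def inner_simps)
      finally show False using a(2)[OF tjf ne] by simp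
    qed
    have pt: "(real_vec (s - a + u), \<Phi> s - g j a + g j u) \<in> H" if u: "u \<in> supp f" for u
    proof -
      have "(\<Sum>t\<in>T. l t *\<^sub>R p (t(j := u))) \<in> H"
        unfolding H_def using l finT u by (intro convex_sum) (auto intro!: hull_inc upT)
      also have "(\<Sum>t\<in>T. l t *\<^sub>R p (t(j := u))) = (\<Sum>t\<in>T. l t *\<^sub>R p t + l t *\<^sub>R (real_vec (u - a), g j u - g j a))"
      proof (rule sum.cong[OF refl])
        fix t assume "t \<in> T"
        then show "l t *\<^sub>R p (t(j := u)) = l t *\<^sub>R p t + l t *\<^sub>R (real_vec (u - a), g j u - g j a)"
          using tj[of t] by (cases "l t = 0") (auto simp: p_upd[OF j] scaleR_add_right)
      qed
      also have "\<dots> = (real_vec s, \<Phi> s) + (real_vec (u - a), g j u - g j a)"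
        unfolding sum.distrib l(3)[symmetric] scaleR_sum_left[symmetric] l(2) by simp
      also have "\<dots> = (real_vec (s - a + u), \<Phi> s - g j a + g j u)" by (simp add: algebra_simps)
      finally show ?thesis .
    qed
    have fJ: "f \<in> J" using F f by blast
    have sL: "s \<in> \<Lambda>" using s by (simp add: S_def)
    have lat: "s - a + u \<in> \<Lambda>" if "u \<in> supp f" for u
      using sL fJ a(1) that by (intro add_lat diff_lat) (auto intro: keys_lat)
    let ?k = "shift (s - a) f"
    have "?k \<in> J" using fJ sL keys_lat[OF fJ a(1)] by (intro shift_closed diff_lat)
    moreover have "supp ?k \<subseteq> S"
      using pt lat by (force simp: keys_shift S_def)
    moreover have "?k \<noteq> 0" using a(1) keys_shift[of "s - a" f] by auto
    ultimately have "attains_twice ?k y" using y by blast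
    then obtain b c where bc: "b \<noteq> c" "b \<in> supp ?k" "c \<in> supp ?k" "val ?k y b = val ?k y c" "\<And>u. val ?k y b \<le> val ?k y u"
      unfolding attains_twice_def by blast
    have lt: "val ?k y s < val ?k y u" if "u \<in> supp ?k" "u \<noteq> s" for u
    proof -
      obtain v where v: "v \<in> supp f" "u = s - a + v" using \<open>u \<in> supp ?k\<close> by (auto simp: keys_shift)
      have va: "v \<noteq> a" using v that by auto
      have "\<Phi> s + y s \<le> \<Phi> s - g j a + g j v + y u" using sH[OF pt[OF v(1)] lat[OF v(1)]] v(2) by simp
      then have "real_coeff f a + y s < real_coeff f v + y u" using eps va by (simp add: g_def j_def)
      then show ?thesis using v(2) lookup_real_coeff[OF v(1)] lookup_real_coeff[OF a(1)] by (simp add: val_def)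
    qed
    have "b = s" using lt[OF bc(2)] bc(5)[of s] by (meson not_le)
    moreover have "c = s" using lt[OF bc(3)] bc(4) bc(5)[of s] by (metis not_le)
    ultimately show False using bc(1) by simp
  qed
  then show ?thesis by blast
qed

end

context tropical_lattice_ideal
begin

text \<open>For each polynomial choose two monomials that are to tie for the minimum; there are
  finitely many choices, and each is a system of linear inequalities. If no system is solvable, the
  Farkas certificates yield an amount by which every \<open>w\<close> violates some inequality of
  each system. An approximate root with \<open>\<epsilon>\<close> at most this amount contradicts
  that, without any limit of approximate roots.\<close>

lemma finite_root:
  assumes F: "finite F" "F \<subseteq> J - {0}"
  shows "\<exists>w. \<forall>f\<in>F. attains_twice f (lin w)"
proof -
  define Pt where "Pt = PiE F (\<lambda>f. {(a, b). a \<in> supp f \<and> b \<in> supp f \<and> a \<noteq> b})"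
  have finPt: "finite Pt" unfolding Pt_def
  proof (intro finite_PiE F)
    fix f
    have "{(a, b). a \<in> supp f \<and> b \<in> supp f \<and> a \<noteq> b} \<subseteq> supp f \<times> supp f" by auto
    then show "finite {(a, b). a \<in> supp f \<and> b \<in> supp f \<and> a \<noteq> b}" by (rule finite_subset) auto
  qed
  \<comment> \<open>The index \<open>(f, u, v)\<close> stands for the inequality that the term
    \<open>v\<close>, one of the two chosen for \<open>f\<close>, is not above the term
    \<open>u\<close>; \<open>c\<close> and \<open>b\<close> are its linear and constant
    parts.\<close>
  define I where "I \<pi> = (SIGMA f:F. supp f \<times> {fst (\<pi> f), snd (\<pi> f)})" for \<pi> :: "'n laurent \<Rightarrow> (int ^ 'n) \<times> (int ^ 'n)"
  have finI: "finite (I \<pi>)" for \<pi> unfolding I_def using F by auto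
  define c where "c i = real_vec (fst (snd i)) - real_vec (snd (snd i))" for i :: "'n laurent \<times> (int ^ 'n) \<times> (int ^ 'n)"
  define b where "b i = real_coeff (fst i) (fst (snd i)) - real_coeff (fst i) (snd (snd i))" for i :: "'n laurent \<times> (int ^ 'n) \<times> (int ^ 'n)"
  have "\<exists>\<pi>\<in>Pt. \<exists>w. \<forall>i\<in>I \<pi>. 0 \<le> c i \<bullet> w + b i"
  proof (rule ccontr)
    assume none: "\<not> ?thesis"
    have "\<exists>e>0. \<forall>w. \<exists>i\<in>I \<pi>. c i \<bullet> w + b i < - e" if "\<pi> \<in> Pt" for \<pi>
    proof -
      have no: "\<nexists>w. \<forall>i\<in>I \<pi>. 0 \<le> c i \<bullet> w + b i" using none that by blast
      obtain \<mu> where mu: "\<forall>i\<in>I \<pi>. 0 \<le> \<mu> i" "(\<Sum>i\<in>I \<pi>. \<mu> i *\<^sub>R c i) = 0" "(\<Sum>i\<in>I \<pi>. \<mu> i * b i) < 0"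
        by (rule disjE[OF farkas[OF finI[of \<pi>], of c b]]) (erule notE[OF no], blast)
      define m where "m = sum \<mu> (I \<pi>)"
      \<comment> \<open>If every inequality held up to \<open>e\<close>, the sum weighted by
        \<open>\<mu>\<close> would be at least \<open>- e * m\<close>, but it equals
        \<open>- e * (m + 1)\<close>. The added 1 keeps the denominator positive and the comparison
        strict.\<close>
      define e where "e = - (\<Sum>i\<in>I \<pi>. \<mu> i * b i) / (m + 1)"
      have "m \<ge> 0" unfolding m_def using mu(1) by (simp add: sum_nonneg)
      have e: "e > 0" unfolding e_def using mu(3) \<open>m \<ge> 0\<close> by (intro divide_pos_pos) auto
      have "\<exists>i\<in>I \<pi>. c i \<bullet> w + b i < - e" for w
      proof (rule ccontr)
        assume "\<not> ?thesis"
        then have "\<mu> i * (- e) \<le> \<mu> i * (c i \<bullet> w + b i)" if "i \<in> I \<pi>" for i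
          using that mu(1) by (intro mult_left_mono) auto
        then have "(\<Sum>i\<in>I \<pi>. \<mu> i * (- e)) \<le> (\<Sum>i\<in>I \<pi>. \<mu> i * (c i \<bullet> w + b i))" by (rule sum_mono)
        also have "\<dots> = (\<Sum>i\<in>I \<pi>. \<mu> i *\<^sub>R c i) \<bullet> w + (\<Sum>i\<in>I \<pi>. \<mu> i * b i)"
          by (simp add: inner_sum_left sum.distrib algebra_simps)
        also have "\<dots> = - e * (m + 1)" using mu(2) \<open>m \<ge> 0\<close> by (simp add: e_def)
        finally have "- m * e \<le> - e * (m + 1)" by (simp add: m_def sum_distrib_right sum_negf)
        then show False using e by (simp add: algebra_simps)
      qed
      with e show ?thesis by blast
    qed
    then obtain e where e: "\<And>\<pi>. \<pi> \<in> Pt \<Longrightarrow> 0 < e \<pi>" "\<And>\<pi> w. \<pi> \<in> Pt \<Longrightarrow> \<exists>i\<in>I \<pi>. c i \<bullet> w + b i < - e \<pi>"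
      by metis
    define \<epsilon> where "\<epsilon> = Min (insert 1 (e ` Pt))"
    have eps: "0 < \<epsilon>" unfolding \<epsilon>_def using finPt e(1) by (subst Min_gr_iff) auto
    have epsle: "\<epsilon> \<le> e \<pi>" if "\<pi> \<in> Pt" for \<pi> unfolding \<epsilon>_def using finPt that by auto
    obtain w where w: "\<And>f. f \<in> F \<Longrightarrow> \<not> (\<exists>a\<in>supp f. \<forall>u\<in>supp f - {a}. real_coeff f a + lin w a + \<epsilon> < real_coeff f u + lin w u)"
      using approximate_root[OF F eps] by blast
    have "\<exists>a b. a \<in> supp f \<and> b \<in> supp f \<and> a \<noteq> b \<and> (\<forall>u\<in>supp f. real_coeff f a + lin w a \<le> real_coeff f u + lin w u)
        \<and> real_coeff f b + lin w b \<le> real_coeff f a + lin w a + \<epsilon>" if f: "f \<in> F" for f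
    proof -
      have "supp f \<noteq> {}" using f F by auto
      then obtain a where a: "a \<in> supp f" "\<And>u. u \<in> supp f \<Longrightarrow> val f (lin w) a \<le> val f (lin w) u"
        using exists_min_val[of "supp f" f "lin w"] by auto
      then obtain b where b: "b \<in> supp f - {a}" "\<not> (real_coeff f a + lin w a + \<epsilon> < real_coeff f b + lin w b)"
        using w[OF f] by blast
      have "real_coeff f a + lin w a \<le> real_coeff f u + lin w u" if "u \<in> supp f" for u
        using a(2)[OF that] val_real_coeff[OF a(1), of "lin w"] val_real_coeff[OF that, of "lin w"] by simp
      then show ?thesis using a b by (intro exI[of _ a] exI[of _ b]) auto
    qed
    then obtain A B where AB: "\<And>f. f \<in> F \<Longrightarrow> A f \<in> supp f \<and> B f \<in> supp f \<and> A f \<noteq> B f \<and>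
        (\<forall>u\<in>supp f. real_coeff f (A f) + lin w (A f) \<le> real_coeff f u + lin w u)
        \<and> real_coeff f (B f) + lin w (B f) \<le> real_coeff f (A f) + lin w (A f) + \<epsilon>" by metis
    define \<pi> where "\<pi> = restrict (\<lambda>f. (A f, B f)) F"
    have pi: "\<pi> \<in> Pt" using AB by (auto simp: Pt_def \<pi>_def)
    obtain i where i: "i \<in> I \<pi>" "c i \<bullet> w + b i < - e \<pi>" using e(2)[OF pi] by blast
    then obtain f u v where fuv: "i = (f, u, v)" "f \<in> F" "u \<in> supp f" "v = A f \<or> v = B f"
      unfolding I_def \<pi>_def by (auto split: if_splits)
    have "real_coeff f v + lin w v \<le> real_coeff f (A f) + lin w (A f) + \<epsilon>" using AB[OF fuv(2)] fuv(4) eps by auto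
    also have "real_coeff f (A f) + lin w (A f) \<le> real_coeff f u + lin w u" using AB[OF fuv(2)] fuv(3) by blast
    finally have "- \<epsilon> \<le> c i \<bullet> w + b i" by (simp add: fuv(1) c_def b_def lin_def inner_diff_left)
    then show False using i(2) epsle[OF pi] by simp
  qed
  then obtain \<pi> w where pi: "\<pi> \<in> Pt" and w: "\<And>i. i \<in> I \<pi> \<Longrightarrow> 0 \<le> c i \<bullet> w + b i" by blast
  have "attains_twice f (lin w)" if f: "f \<in> F" for f
  proof -
    obtain a a' where a: "\<pi> f = (a, a')" by (cases "\<pi> f")
    have aa: "a \<in> supp f" "a' \<in> supp f" "a \<noteq> a'" using pi f a by (auto simp: Pt_def PiE_iff)
    have le: "val f (lin w) v \<le> val f (lin w) u" if v: "v = a \<or> v = a'" for u v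
    proof (cases "u \<in> supp f")
      case False then show ?thesis by (simp add: val_outside)
    next
      case True
      have vf: "v \<in> supp f" using v aa by auto
      have "(f, u, v) \<in> I \<pi>" using f True v a by (auto simp: I_def)
      from w[OF this] show ?thesis
        using val_real_coeff[OF True, of "lin w"] val_real_coeff[OF vf, of "lin w"] by (simp add: c_def b_def lin_def inner_diff_left)
    qed
    show ?thesis unfolding attains_twice_def
      using aa le by (intro exI[of _ a] exI[of _ a']) (auto intro: order_antisym)
  qed
  then show ?thesis by blast
qed

text \<open>The elements of \<open>J\<close> supported on \<open>E\<close> are infinitely many, but one polynomial for each support suffices.\<close>

lemma finite_support_root:
  assumes E: "finite E"
  shows "\<exists>w. \<forall>f \<in> J \<inter> supported_on E - {0}. attains_twice f (lin w)"
proof -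
  let ?V = "J \<inter> supported_on E"
  have V: "matroidal ?V" by (rule matroidal_restrict[OF mat])
  define g where "g S = (SOME f. f \<in> ?V \<and> supp f = S)" for S
  have g: "g (supp f) \<in> ?V \<and> supp (g (supp f)) = supp f" if "f \<in> ?V" for f
    unfolding g_def by (rule someI) (use that in auto)
  define F where "F = (g ` supp ` ?V) - {0}"
  have "supp ` ?V \<subseteq> Pow E" by (auto simp: supported_on_def)
  then have "finite (supp ` ?V)" using E by (meson finite_Pow_iff finite_subset)
  then have "finite F" by (simp add: F_def)
  moreover have "F \<subseteq> J - {0}" using g by (auto simp: F_def)
  ultimately have "\<exists>w. \<forall>f\<in>F. attains_twice f (lin w)" by (rule finite_root)
  then obtain w where w: "\<And>f. f \<in> F \<Longrightarrow> attains_twice f (lin w)" by blast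
  let ?y = "lin w"
  have False if "f \<in> ?V" "a \<in> supp f" "\<And>u. u \<noteq> a \<Longrightarrow> val f ?y a < val f ?y u" for f a
    using that
  proof (induction "card (supp f)" arbitrary: f rule: less_induct)
    case less
    note f = less.prems
    let ?g = "g (supp f)"
    have g': "?g \<in> ?V" "supp ?g = supp f" using g[OF f(1)] by auto
    have "?g \<noteq> 0" using g'(2) f(2) by auto
    \<comment> \<open>If the raised \<open>?g\<close> touches \<open>f\<close> at \<open>a\<close>,
      it has its only minimum there, against the choice of \<open>w\<close>. Otherwise the contact
      point \<open>t\<close> is eliminated, and \<open>a\<close> remains the only minimum of a
      vector with smaller support.\<close>
    obtain s t where st: "t \<in> supp ?g" "Fin s * cf ?g t = cf f t" "\<And>v. cf f v \<le> Fin s * cf ?g v"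
      by (rule scale_tight[of ?g f]) (use \<open>?g \<noteq> 0\<close> g'(2) in auto)
    have ge: "val f ?y v \<le> val (scale s ?g) ?y v" for v
      using st(3)[of v] by (simp add: val_def)
    show False
    proof (cases "Fin s * cf ?g a = cf f a")
      case True
      then have a: "val (scale s ?g) ?y a = val f ?y a" by (simp add: val_def)
      have lt: "val (scale s ?g) ?y a < val (scale s ?g) ?y u" if "u \<noteq> a" for u
        using f(3)[OF that] ge[of u] a by simp
      have "?g \<in> F" using \<open>?g \<noteq> 0\<close> f(1) by (auto simp: F_def)
      then have "attains_twice (scale s ?g) ?y" using w by simp
      then show False using lt unfolding attains_twice_def by (metis not_le)
    next
      case False
      have tf: "t \<in> supp f" using st(1) g'(2) by simp
      obtain k where k: "k \<in> ?V" "\<And>u. min (cf f u) (Fin s * cf ?g u) \<le> cf k u"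
        "\<And>u. cf f u \<noteq> Fin s * cf ?g u \<Longrightarrow> cf k u = min (cf f u) (Fin s * cf ?g u)"
        "supp k \<subseteq> (supp f \<union> supp ?g) - {t}"
        by (rule matroidal_elim[OF V f(1) matroidal_scale[OF V g'(1)], of t s])
          (use st(2) tf in \<open>auto simp: in_keys_iff\<close>)
      have ka: "cf k a = cf f a" using k(3)[of a] False st(3)[of a] by (auto simp: min_def)
      have kf: "cf f u \<le> cf k u" for u using k(2)[of u] st(3)[of u] by auto
      have "supp k \<subset> supp f" using k(4) g'(2) tf by auto
      then have c: "card (supp k) < card (supp f)" by (simp add: psubset_card_mono)
      have "a \<in> supp k" using ka f(2) by (simp add: in_keys_iff)
      moreover have "val k ?y a < val k ?y u" if "u \<noteq> a" for u
      proof -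
        have "val k ?y a = val f ?y a" using ka by (simp add: val_def)
        also have "\<dots> < val f ?y u" by (rule f(3)[OF that])
        also have "\<dots> \<le> val k ?y u" using kf[of u] by (simp add: val_def)
        finally show ?thesis .
      qed
      ultimately show False using less.hyps[OF c k(1)] by blast
    qed
  qed
  then have "attains_twice f ?y" if "f \<in> ?V - {0}" for f
    using that by (metis Diff_iff insertI1 not_attains_twiceE)
  then show ?thesis by blast
qed

end

section \<open>Roots of tropical ideals\<close>

lemma incseq_subsequence:
  fixes s :: "nat \<Rightarrow> nat"
  obtains f :: "nat \<Rightarrow> nat" where "strict_mono f" "mono (\<lambda>n. s (f n))"
proof -
  obtain f where f: "strict_mono f" "monoseq (\<lambda>n. s (f n))" using seq_monosub[of s] by blast
  show thesis
  proof (cases "mono (\<lambda>n. s (f n))")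
    case True with f(1) show thesis by (rule that)
  next
    case False
    then have dec: "s (f n) \<le> s (f m)" if "m \<le> n" for m n
      using f(2) that by (auto simp: monoseq_def mono_def)
    \<comment> \<open>A nonincreasing sequence of natural numbers is constant from an index
      \<open>n0\<close> at which it takes its least value.\<close>
    define m where "m = (LEAST v. v \<in> range (\<lambda>n. s (f n)))"
    have "m \<in> range (\<lambda>n. s (f n))" unfolding m_def by (rule LeastI_ex) auto
    then obtain n0 where n0: "s (f n0) = m" by auto
    have "m \<le> s (f n)" for n unfolding m_def by (rule Least_le) auto
    then have "s (f (n + n0)) = m" for n using dec[of n0 "n + n0"] n0 by (simp add: order_antisym)
    moreover have "strict_mono (\<lambda>n. f (n + n0))" using f(1) by (auto simp: strict_mono_def)
    ultimately show thesis using that[of "\<lambda>n. f (n + n0)"] by (simp add: mono_def)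
  qed
qed

lemma dickson:
  fixes x :: "nat \<Rightarrow> 'i \<Rightarrow> nat"
  assumes "finite C"
  obtains i j where "i < j" "\<forall>c\<in>C. x i c \<le> x j c"
proof -
  have "\<exists>f. strict_mono (f :: nat \<Rightarrow> nat) \<and> (\<forall>c\<in>C. mono (\<lambda>n. x (f n) c))"
    using assms
  proof induction
    case empty
    then show ?case by (intro exI[of _ id]) (auto simp: strict_mono_def)
  next
    case (insert c C)
    obtain f :: "nat \<Rightarrow> nat" where f: "strict_mono f" "\<forall>c\<in>C. mono (\<lambda>n. x (f n) c)"
      using insert.IH by (elim exE conjE)
    obtain g :: "nat \<Rightarrow> nat" where g: "strict_mono g" "mono (\<lambda>n. x (f (g n)) c)"
      by (rule incseq_subsequence[of "\<lambda>n. x (f n) c"])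
    have "mono (\<lambda>n. x (f (g n)) b)" if "b \<in> C" for b
      using f(2)[rule_format, OF that] g(1) by (auto simp: mono_def strict_mono_less_eq)
    moreover have "strict_mono (\<lambda>n. f (g n))" using f(1) g(1) by (auto simp: strict_mono_def)
    ultimately show ?case using g(2) by (intro exI[of _ "\<lambda>n. f (g n)"]) auto
  qed
  then obtain f :: "nat \<Rightarrow> nat" where f: "strict_mono f" "\<forall>c\<in>C. mono (\<lambda>n. x (f n) c)" by (elim exE conjE)
  have "f 0 < f 1" using f(1) by (simp add: strict_mono_def)
  moreover have "\<forall>c\<in>C. x (f 0) c \<le> x (f 1) c" using f(2) by (auto simp: mono_def)
  ultimately show thesis using that by blast
qed

lemma cube_mono: "d \<le> e \<Longrightarrow> cube d \<subseteq> cube e"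
  unfolding cube_def by (auto intro: order_trans)

lemma cube_add: "u \<in> cube d \<Longrightarrow> v \<in> cube e \<Longrightarrow> u + v \<in> cube (d + e)"
  unfolding cube_def by (auto intro!: order_trans[OF abs_triangle_ineq] add_mono)

text \<open>A pair of an exponent \<open>u\<close> and a degree \<open>d\<close> is encoded by the
  natural numbers \<open>d + u $ i\<close> and \<open>d - u $ i\<close>. Then
  \<open>u - u0 \<in> cube (d - d0)\<close> becomes the componentwise order, to which Dickson's
  lemma applies.\<close>

lemma dickson_cubes:
  assumes up: "\<And>d. L d \<subseteq> (cube d :: (int ^ 'n::finite) set)"
  shows "\<exists>D. \<forall>d. \<forall>u\<in>L d. \<exists>d0\<le>D. d0 \<le> d \<and> (\<exists>u0\<in>L d0. u - u0 \<in> cube (d - d0))"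
proof (rule ccontr)
  assume none: "\<not> ?thesis"
  have "\<forall>D. \<exists>d u. u \<in> L d \<and> (\<forall>d0\<le>D. d0 \<le> d \<longrightarrow> (\<forall>u0\<in>L d0. u - u0 \<notin> cube (d - d0)))"
  proof
    fix D
    have "\<not> (\<forall>d. \<forall>u\<in>L d. \<exists>d0\<le>D. d0 \<le> d \<and> (\<exists>u0\<in>L d0. u - u0 \<in> cube (d - d0)))"
      using none by (rule contrapos_nn) (rule exI)
    then obtain d u where "u \<in> L d" "\<not> (\<exists>d0\<le>D. d0 \<le> d \<and> (\<exists>u0\<in>L d0. u - u0 \<in> cube (d - d0)))"
      unfolding not_all Ball_def by blast
    then show "\<exists>d u. u \<in> L d \<and> (\<forall>d0\<le>D. d0 \<le> d \<longrightarrow> (\<forall>u0\<in>L d0. u - u0 \<notin> cube (d - d0)))"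
      by (intro exI[of _ d] exI[of _ u]) auto
  qed
  from choice[OF this] obtain dd where "\<forall>D. \<exists>u. u \<in> L (dd D) \<and> (\<forall>d0\<le>D. d0 \<le> dd D \<longrightarrow> (\<forall>u0\<in>L d0. u - u0 \<notin> cube (dd D - d0)))"
    by (elim exE)
  from choice[OF this] obtain uu where "\<forall>D. uu D \<in> L (dd D) \<and> (\<forall>d0\<le>D. d0 \<le> dd D \<longrightarrow> (\<forall>u0\<in>L d0. uu D - u0 \<notin> cube (dd D - d0)))"
    by (elim exE)
  then have du: "\<And>D. uu D \<in> L (dd D)"
    "\<And>D d0 u0. d0 \<le> D \<Longrightarrow> d0 \<le> dd D \<Longrightarrow> u0 \<in> L d0 \<Longrightarrow> uu D - u0 \<notin> cube (dd D - d0)" by blast+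
  have "(0 :: int ^ 'n) \<in> cube 0" by (simp add: cube_def)
  \<comment> \<open>Otherwise the counterexample would be its own witness.\<close>
  have gt: "D < dd D" for D
  proof (rule ccontr)
    assume "\<not> D < dd D"
    then have "dd D \<le> D" by simp
    from du(2)[OF this order_refl du(1)] show False using \<open>(0 :: int ^ 'n) \<in> cube 0\<close> by simp
  qed
  \<comment> \<open>Iterating \<open>dd\<close> makes each counterexample admissible as
    \<open>u0\<close> for all later ones: \<open>dd (e i) \<le> e j\<close> whenever
    \<open>i < j\<close>.\<close>
  define e where "e = rec_nat 0 (\<lambda>_ k. dd k)"
  have e: "e (Suc k) = dd (e k)" for k by (simp add: e_def)
  have emono: "strict_mono e" unfolding strict_mono_Suc_iff e using gt by blast
  define x where "x k c = nat (case c of (i, True) \<Rightarrow> int (dd (e k)) + uu (e k) $ i | (i, False) \<Rightarrow> int (dd (e k)) - uu (e k) $ i)"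
    for k and c :: "'n \<times> bool"
  obtain i j where ij: "i < j" "\<forall>c\<in>UNIV. x i c \<le> x j c" using dickson[of UNIV x] by auto
  let ?di = "dd (e i)" let ?d = "dd (e j)" let ?ui = "uu (e i)" let ?u = "uu (e j)"
  have c: "\<bar>uu (e k) $ l\<bar> \<le> int (dd (e k))" for k l using up du(1)[of "e k"] by (auto simp: cube_def)
  have "e (Suc i) \<le> e j" using ij(1) emono by (simp add: strict_mono_less_eq Suc_leI)
  then have "?di \<le> e j" by (simp add: e)
  then have "?di \<le> ?d" by (rule order_trans[OF _ less_imp_le[OF gt]])
  have "\<bar>?u $ l - ?ui $ l\<bar> \<le> int (?d - ?di)" for l
  proof -
    have "x i (l, True) \<le> x j (l, True)" "x i (l, False) \<le> x j (l, False)" using ij(2) by auto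
    then show ?thesis using c[of i l] c[of j l] \<open>?di \<le> ?d\<close> by (simp add: x_def)
  qed
  then have "?u - ?ui \<in> cube (?d - ?di)" by (simp add: cube_def)
  then show False using du(2)[OF \<open>?di \<le> e j\<close> \<open>?di \<le> ?d\<close> du(1)] by blast
qed

text \<open>The functionals to be avoided lie on countably many hyperplanes, a null set. The
  tiebreak is to be linear so that shifting a polynomial shifts its leading monomial.\<close>

lemma exists_injective_functional: "\<exists>r. inj (lin r :: int ^ 'n::finite \<Rightarrow> real)"
proof -
  let ?N = "(\<lambda>u :: int ^ 'n. {x. real_vec u \<bullet> x = 0}) ` (UNIV - {0})"
  have "negligible (\<Union>?N)"
  proof (rule negligible_countable_Union)
    show "countable ?N" by (intro countable_image) (rule countable_subset[OF subset_UNIV], simp)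
    fix T assume "T \<in> ?N"
    then obtain u :: "int ^ 'n" where "u \<noteq> 0" "T = {x. real_vec u \<bullet> x = 0}" by auto
    then show "negligible T" using negligible_hyperplane[of "real_vec u" 0] real_vec_eq_iff[of u 0] by simp
  qed
  then have "\<Union>?N \<noteq> UNIV" using non_negligible_UNIV by metis
  then obtain r where r: "\<And>u :: int ^ 'n. u \<noteq> 0 \<Longrightarrow> real_vec u \<bullet> r \<noteq> 0" by auto
  have "inj (lin r :: int ^ 'n \<Rightarrow> real)"
  proof (rule injI)
    fix u v :: "int ^ 'n" assume "lin r u = lin r v"
    then have "real_vec (u - v) \<bullet> r = 0" by (simp add: lin_def inner_simps)
    then show "u = v" using r[of "u - v"] by auto
  qed
  then show ?thesis by blast
qed

context tropical_lattice_ideal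
begin

text \<open>
  The leading monomials up to each degree form, with the degree, an ideal of monomials, so by Dickson's
  lemma they are determined by their part of degree at most some \<open>D\<close>: a smaller set in one degree
  would violate the invariance of their number. If roots \<open>W k\<close> for degree \<open>k\<close> have, along an infinite set of
  indices, the same leading monomials and the same ties in the finitely many fundamental polynomials up to degree
  \<open>D\<close>, then moving away from \<open>W k0\<close> slightly beyond \<open>W k\<close> keeps the leading monomials, which is
  impossible if a fundamental polynomial has a tie at \<open>W k\<close> but not at \<open>W k0\<close>.
\<close>

theorem exists_root: "\<exists>w. \<forall>f\<in>J - {0}. attains_twice f (lin w)"
proof (rule ccontr)
  assume none: "\<not> ?thesis"
  obtain r :: "real ^ 'n" where r: "inj (lin r :: int ^ 'n \<Rightarrow> real)" using exists_injective_functional by blast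
  interpret tiebreak "lin r" by standard (rule r)
  define V where "V d = J \<inter> supported_on (cube d)" for d
  have mV: "matroidal (V d)" for d unfolding V_def by (rule matroidal_restrict[OF mat])
  have VE: "V d \<subseteq> supported_on (cube d)" for d by (auto simp: V_def)
  have Vmono: "V d \<subseteq> V e" if "d \<le> e" for d e using cube_mono[OF that] by (auto simp: V_def supported_on_def)
  have "\<forall>k. \<exists>w. \<forall>f\<in>V k - {0}. attains_twice f (lin w)" unfolding V_def using finite_support_root by simp
  then obtain W where W: "\<And>k f. f \<in> V k \<Longrightarrow> f \<noteq> 0 \<Longrightarrow> attains_twice f (lin (W k))" by (metis DiffI singletonD)
  define L where "L d w = leads (lin w) (V d)" for d w
  have Lc: "L d w \<subseteq> cube d" for d w unfolding L_def by (rule leads_subset[OF VE])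
  have finL: "finite (L d w)" for d w using Lc finite_cube by (rule finite_subset)
  have cardL: "card (L d w) = card (L d w')" for d w w'
    using leads_basis[OF finite_cube mV VE] unfolding L_def by blast
  have spL: "\<exists>f\<in>V d. u \<in> supp f \<and> supp f \<subseteq> insert u (cube d - L d w)" if "u \<in> L d w" for d u w
    using leads_basis[OF finite_cube mV VE, where y = "lin w"] that unfolding L_def spans_def by blast
  have Llat: "u \<in> \<Lambda>" if "u \<in> L d w" for u d w
    using that keys_lat by (auto simp: L_def leads_def V_def dest: lead_keys)
  have Lup: "u + a \<in> L (d + e) w" if u: "u \<in> L d w" and a: "a \<in> \<Lambda>" "a \<in> cube e" for u a d e w
  proof -
    obtain f where f: "f \<in> V d" "lead (lin w) f u" using u by (auto simp: L_def leads_def)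
    have "shift a f \<in> V (d + e)"
      using f(1) a shift_closed cube_add[of _ d a e] by (auto simp: V_def supported_on_def keys_shift add.commute)
    moreover have "lead (lin w) (shift a f) (u + a)"
      unfolding lead_def
    proof (intro conjI allI impI)
      show "u + a \<in> supp (shift a f)" using lead_keys[OF f(2)] by (simp add: keys_shift)
      fix v assume "v \<noteq> u + a"
      then have "v - a \<noteq> u" by auto
      from lead_lt[OF f(2) this] have "lt (lval f (lin w) u) (lval f (lin w) (v - a))" .
      moreover have "val (shift a f) (lin w) z = Fin (lin w a) * val f (lin w) (z - a)" for z
        by (cases "cf f (z - a)") (auto simp: val_def)
      ultimately show "lt (lval (shift a f) (lin w) (u + a)) (lval (shift a f) (lin w) v)"
        by (auto simp: lt_def lval_def)
    qed
    ultimately show ?thesis by (auto simp: L_def leads_def)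
  qed
  have pig: "\<exists>B\<subseteq>A. infinite B \<and> (\<forall>k\<in>B. \<forall>k'\<in>B. F k = F k')"
    if "infinite A" "finite X" "\<And>k. F k \<subseteq> X" for A :: "nat set" and F :: "nat \<Rightarrow> 'z set" and X
  proof -
    have "F ` A \<subseteq> Pow X" using that by auto
    then have "finite (F ` A)" using that(2) by (meson finite_Pow_iff finite_subset)
    from pigeonhole_infinite[OF that(1) this]
    obtain k0 where "k0 \<in> A" "infinite {k\<in>A. F k = F k0}" by blast
    then show ?thesis by (intro exI[of _ "{k\<in>A. F k = F k0}"]) auto
  qed
  let ?P = "\<lambda>d A. infinite A \<and> (\<forall>k\<in>A. \<forall>k'\<in>A. L d (W k) = L d (W k'))"
  \<comment> \<open>A diagonal choice: the index sets are nested and infinite, and on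
    \<open>S d\<close> the leading monomials in degree \<open>d\<close> do not vary. This replaces a
    limit of the \<open>W k\<close>.\<close>
  have "\<exists>S. \<forall>d. ?P d (S d) \<and> S (Suc d) \<subseteq> S d"
  proof (rule dependent_nat_choice)
    show "\<exists>A. ?P 0 A" using pig[of UNIV "cube 0" "\<lambda>k. L 0 (W k)"] Lc by auto
    show "\<exists>B. ?P (Suc d) B \<and> B \<subseteq> A" if "?P d A" for A d
      using pig[of A "cube (Suc d)" "\<lambda>k. L (Suc d) (W k)"] Lc that by auto
  qed
  then obtain S where S: "\<And>d. infinite (S d)" "\<And>d k k'. k \<in> S d \<Longrightarrow> k' \<in> S d \<Longrightarrow> L d (W k) = L d (W k')"
    "\<And>d. S (Suc d) \<subseteq> S d" by metis
  have Smono: "S e \<subseteq> S d" if "d \<le> e" for d e using lift_Suc_antimono_le[of S d e] S(3) that by blast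
  define Li where "Li d = L d (W (SOME k. k \<in> S d))" for d
  have Li: "L d (W k) = Li d" if "k \<in> S e" "d \<le> e" for d e k
  proof -
    have "(SOME k. k \<in> S d) \<in> S d" by (rule someI_ex) (use S(1)[of d] in \<open>auto simp: ex_in_conv\<close>)
    then show ?thesis unfolding Li_def using S(2) Smono[OF that(2)] that(1) by blast
  qed
  have "Li d \<subseteq> cube d" for d unfolding Li_def by (rule Lc)
  then obtain D where D: "\<And>d u. u \<in> Li d \<Longrightarrow> \<exists>d0\<le>D. d0 \<le> d \<and> (\<exists>u0\<in>Li d0. u - u0 \<in> cube (d - d0))"
    using dickson_cubes[of Li] by blast
  have Lieq: "L d w = Li d" if w: "\<And>d. d \<le> D \<Longrightarrow> Li d \<subseteq> L d w" for d w
  proof -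
    have "Li d \<subseteq> L d w"
    proof
      fix u assume u: "u \<in> Li d"
      then obtain d0 u0 where d0: "d0 \<le> D" "d0 \<le> d" "u0 \<in> Li d0" "u - u0 \<in> cube (d - d0)" using D by blast
      have "u - u0 \<in> \<Lambda>" using u d0(3) Llat unfolding Li_def by (blast intro: diff_lat)
      then have "u0 + (u - u0) \<in> L (d0 + (d - d0)) w" using Lup w d0 by blast
      then show "u \<in> L d w" using d0(2) by simp
    qed
    moreover have "card (L d w) = card (Li d)" unfolding Li_def by (rule cardL)
    ultimately show ?thesis using finL card_subset_eq by metis
  qed
  have LW: "L d (W k) = Li d" if "k \<in> S D" for d k using Li[OF that] by (intro Lieq) simp
  \<comment> \<open>The analogue of a reduced Groebner basis: \<open>u\<close> is the only monomial
    of \<open>h d u\<close> in \<open>Li d\<close>, so it leads \<open>h d u\<close> for every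
    weight whose leading sets are the \<open>Li d\<close>.\<close>
  define h where "h d u = (SOME f. f \<in> V d \<and> u \<in> supp f \<and> supp f \<subseteq> insert u (cube d - Li d))" for d u
  have h_all: "h d u \<in> V d \<and> u \<in> supp (h d u) \<and> supp (h d u) \<subseteq> insert u (cube d - Li d)" if "u \<in> Li d" for d u
  proof -
    have "\<exists>f. f \<in> V d \<and> u \<in> supp f \<and> supp f \<subseteq> insert u (cube d - Li d)"
      using spL that unfolding Li_def by blast
    then show ?thesis unfolding h_def by (rule someI_ex)
  qed
  have h: "\<And>d u. u \<in> Li d \<Longrightarrow> h d u \<in> V d" "\<And>d u. u \<in> Li d \<Longrightarrow> u \<in> supp (h d u)"
    "\<And>d u. u \<in> Li d \<Longrightarrow> supp (h d u) \<subseteq> insert u (cube d - Li d)"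
    using h_all by blast+
  have leadh: "lead (lin w) (h d u) u" if w: "\<And>d. L d w = Li d" and u: "u \<in> Li d" for w d u
  proof -
    have "h d u \<noteq> 0" using h(2)[OF u] by auto
    then obtain a where a: "lead (lin w) (h d u) a" by (rule lead_exists)
    then have "a \<in> Li d" using h(1)[OF u] w by (auto simp: L_def leads_def)
    then have "a = u" using lead_keys[OF a] h(3)[OF u] by auto
    then show ?thesis using a by simp
  qed
  define Q where "Q = (SIGMA d:{..D}. SIGMA u:Li d. supp (h d u))"
  have "finite (Li d)" for d unfolding Li_def by (rule finL)
  then have finQ: "finite Q" unfolding Q_def by (intro finite_SigmaI) auto
  \<comment> \<open>The height of term \<open>b\<close> of \<open>h d u\<close> above term
    \<open>u\<close>, an affine function of \<open>w\<close>; it cannot be negative where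
    \<open>u\<close> leads.\<close>
  define ell where "ell w d u b = real_coeff (h d u) b + lin w b - real_coeff (h d u) u - lin w u" for w d u b
  define ties where "ties k = {(d, u, b) \<in> Q. ell (W k) d u b = 0}" for k
  have "\<exists>B\<subseteq>S D. infinite B \<and> (\<forall>k\<in>B. \<forall>k'\<in>B. ties k = ties k')"
    by (rule pig[OF S(1) finQ]) (auto simp: ties_def)
  then obtain B where B: "B \<subseteq> S D" "infinite B" "\<And>k k'. k \<in> B \<Longrightarrow> k' \<in> B \<Longrightarrow> ties k = ties k'" by blast
  have ell: "val (h d u) (lin w) b = Fin (ell w d u b) * val (h d u) (lin w) u" if "u \<in> Li d" "b \<in> supp (h d u)" for w d u b
    using val_real_coeff[OF that(2), of "lin w"] val_real_coeff[OF h(2)[OF that(1)], of "lin w"] by (simp add: ell_def)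
  have valfin: "\<exists>c. val (h d u) (lin w) u = Fin c" if "u \<in> Li d" for w d u
    using val_real_coeff[OF h(2)[OF that]] by blast
  have "B \<noteq> {}" using B(2) by auto
  then obtain k0 where k0: "k0 \<in> B" by blast
  obtain f where f: "f \<in> J" "f \<noteq> 0" "\<not> attains_twice f (lin (W k0))" using none by blast
  obtain a where a: "a \<in> supp f" "\<And>u. u \<noteq> a \<Longrightarrow> val f (lin (W k0)) a < val f (lin (W k0)) u"
    by (rule not_attains_twiceE[OF f(2,3)]) blast
  obtain d where d: "supp f \<subseteq> cube d" by (rule finite_subset_cube[of "supp f"]) auto
  have fV: "f \<in> V d" using f d by (auto simp: V_def supported_on_def)
  have "lead (lin (W k0)) f a" unfolding lead_def lt_def lval_def using a by auto
  then have aLi: "a \<in> Li d" using LW[of k0 d] k0 B(1) fV by (auto simp: L_def leads_def)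
  \<comment> \<open>That \<open>f\<close> has its minimum at \<open>W k0\<close> only at
    \<open>a\<close> passes to \<open>h d a\<close>: a tie at \<open>b\<close> would survive the
    elimination of \<open>a\<close> between \<open>f\<close> and \<open>h d a\<close>, and the
    leading monomial of the result would have to occur in \<open>h d a\<close>, hence lie outside
    \<open>Li d\<close>.\<close>
  have strict0: "0 < ell (W k0) d a b" if b: "b \<in> supp (h d a)" "b \<noteq> a" for b
  proof (rule ccontr)
    assume neg: "\<not> ?thesis"
    let ?y = "lin (W k0)"
    have LWk0: "\<And>d. L d (W k0) = Li d" using LW k0 B(1) by blast
    have "lt (lval (h d a) ?y a) (lval (h d a) ?y b)" using lead_lt[OF leadh[OF LWk0 aLi] b(2)] .
    moreover obtain c0 where "val (h d a) ?y a = Fin c0" using valfin[OF aLi] by blast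
    ultimately have e0: "val (h d a) ?y b = val (h d a) ?y a"
      using ell[OF aLi b(1), of "W k0"] neg by (auto simp: lt_def lval_def)
    have haV: "h d a \<in> V d" "a \<in> supp (h d a)" using h aLi by auto
    obtain s g where g: "g \<in> V d" "cf f a = Fin s * cf (h d a) a" "\<And>u. min (cf f u) (Fin s * cf (h d a) u) \<le> cf g u"
      "\<And>u. cf f u \<noteq> Fin s * cf (h d a) u \<Longrightarrow> cf g u = min (cf f u) (Fin s * cf (h d a) u)"
      "supp g \<subseteq> (supp f \<union> supp (h d a)) - {a}"
      by (rule matroidal_elim_scaled[OF mV fV haV(1) a(1) haV(2)]) blast
    let ?k = "scale s (h d a)"
    have ka: "val ?k ?y a = val f ?y a" using g(2) by (simp add: val_def mult.assoc)
    have kb: "val ?k ?y b = val f ?y a" using e0 ka by simp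
    have gb: "val g ?y b = val f ?y a"
    proof -
      have "val ?k ?y b < val f ?y b" using kb a(2)[OF b(2)] by simp
      then have "cf ?k b < cf f b" by (simp add: val_def)
      then have "cf g b = cf ?k b" using g(4)[of b] by (auto simp: min_def)
      then show ?thesis using kb by (simp add: val_def)
    qed
    have "b \<in> supp g" using gb a(1) by (metis val_eq_zero)
    then have "g \<noteq> 0" by auto
    then obtain c where c: "lead ?y g c" by (rule lead_exists)
    have ca: "c \<noteq> a" using lead_keys[OF c] g(5) by auto
    have gc: "val g ?y c \<le> val f ?y a" using lead_lt[OF c, of b] gb by (cases "b = c") (auto simp: lt_def lval_def)
    have "val g ?y c < val f ?y c" using gc a(2)[OF ca] by simp
    then have "cf g c < cf f c" by (simp add: val_def)
    then have "cf ?k c \<noteq> 0" using g(3)[of c] by (auto simp: min_def split: if_splits)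
    then have "c \<in> supp (h d a)" by (auto simp: in_keys_iff)
    then have "c \<notin> Li d" using h(3)[OF aLi] ca by auto
    moreover have "c \<in> L d (W k0)" using c g(1) by (auto simp: L_def leads_def)
    ultimately show False using LWk0 by blast
  qed
  obtain k where k: "k \<in> B" "d \<le> k" using B(2) unfolding infinite_nat_iff_unbounded_le by blast
  have LWk: "\<And>d. L d (W k) = Li d" "\<And>d. L d (W k0) = Li d" using LW k k0 B(1) by blast+
  have ell_nonneg: "0 \<le> ell (W k') d u b" if "k' \<in> B" "u \<in> Li d" "b \<in> supp (h d u)" for k' d u b
  proof (cases "b = u")
    case True then show ?thesis by (simp add: ell_def)
  next
    case False
    have "\<And>d. L d (W k') = Li d" using LW that(1) B(1) by blast
    from lead_lt[OF leadh[OF this that(2)] False] ell[OF that(2,3), of "W k'"] valfin[OF that(2), of "W k'"]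
    show ?thesis by (auto simp: lt_def lval_def)
  qed
  \<comment> \<open>Since \<open>d \<le> k\<close>, the minimum of \<open>h d a\<close> is attained
    twice at \<open>W k\<close>, whereas at \<open>W k0\<close> the term \<open>a\<close> is
    strictly least.\<close>
  have "h d a \<in> V k" "h d a \<noteq> 0" using h(1,2)[OF aLi] Vmono[OF k(2)] by auto
  then have "attains_twice (h d a) (lin (W k))" using W by blast
  then obtain b1 b2 where b12: "b1 \<noteq> b2" "b1 \<in> supp (h d a)" "b2 \<in> supp (h d a)"
    "val (h d a) (lin (W k)) b1 = val (h d a) (lin (W k)) b2" "\<And>u. val (h d a) (lin (W k)) b1 \<le> val (h d a) (lin (W k)) u"
    unfolding attains_twice_def by blast
  obtain b where b: "b \<in> supp (h d a)" "b \<noteq> a" "val (h d a) (lin (W k)) b \<le> val (h d a) (lin (W k)) a"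
    using b12 by metis
  have bk: "ell (W k) d a b \<le> 0" using ell[OF aLi b(1), of "W k"] valfin[OF aLi, of "W k"] b(3) by auto
  \<comment> \<open>\<open>\<epsilon>\<close> is so small that every positive gap at
    \<open>W k\<close> stays positive at \<open>w\<close>. The added 1 keeps the denominator
    positive where the gap at \<open>W k0\<close> vanishes, and makes the resulting inequality
    strict.\<close>
  define Z where "Z = (\<lambda>(d,u,b). ell (W k) d u b / (1 + ell (W k0) d u b)) ` {(d,u,b) \<in> Q. ell (W k) d u b \<noteq> 0}"
  define \<epsilon> where "\<epsilon> = Min (insert 1 Z)"
  have QD: "u \<in> Li d \<and> b \<in> supp (h d u)" if "(d,u,b) \<in> Q" for d u b using that by (auto simp: Q_def)
  have finZ: "finite Z" unfolding Z_def by (intro finite_imageI finite_subset[OF _ finQ]) auto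
  have "z > 0" if z: "z \<in> Z" for z
  proof -
    obtain d u b where q: "(d,u,b) \<in> Q" "ell (W k) d u b \<noteq> 0" "z = ell (W k) d u b / (1 + ell (W k0) d u b)"
      using z unfolding Z_def by auto
    show ?thesis using q ell_nonneg[OF k(1), of u d b] ell_nonneg[OF k0, of u d b] QD[OF q(1)]
      by (auto intro!: divide_pos_pos)
  qed
  then have eps: "\<epsilon> > 0" unfolding \<epsilon>_def using finZ by (subst Min_gr_iff) auto
  have epsle: "\<epsilon> * (1 + ell (W k0) d u b) \<le> ell (W k) d u b" if q: "(d,u,b) \<in> Q" "ell (W k) d u b \<noteq> 0" for d u b
  proof -
    have "\<epsilon> \<le> ell (W k) d u b / (1 + ell (W k0) d u b)" unfolding \<epsilon>_def using finZ q
      by (intro Min_le) (auto simp: Z_def intro!: image_eqI[of _ _ "(d,u,b)"])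
    then show ?thesis using ell_nonneg[OF k0, of u d b] QD[OF q(1)] by (simp add: pos_le_divide_eq)
  qed
  define w where "w = W k + \<epsilon> *\<^sub>R (W k - W k0)"
  have ellw: "ell w d u b = (1 + \<epsilon>) * ell (W k) d u b - \<epsilon> * ell (W k0) d u b" for d u b
    by (simp add: ell_def w_def lin_def inner_simps algebra_simps)
  have "Li d' \<subseteq> L d' w" if d': "d' \<le> D" for d'
  proof
    fix u assume u: "u \<in> Li d'"
    have "lead (lin w) (h d' u) u"
    proof (rule leadI[OF h(2)[OF u]])
      fix c assume c: "c \<in> supp (h d' u)" "c \<noteq> u"
      have q: "(d', u, c) \<in> Q" using u c d' by (simp add: Q_def)
      obtain z where z: "val (h d' u) (lin w) u = Fin z" using valfin[OF u] by blast
      show "lt (lval (h d' u) (lin w) u) (lval (h d' u) (lin w) c)"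
      proof (cases "ell (W k) d' u c = 0")
        case True
        then have "(d', u, c) \<in> ties k" using q by (simp add: ties_def)
        \<comment> \<open>A gap that vanishes at both roots vanishes along the line through them, so
          at \<open>w\<close> the tiebreak decides as it does at \<open>W k\<close>.\<close>
        then have "(d', u, c) \<in> ties k0" using B(3) k k0 by blast
        then have "ell (W k0) d' u c = 0" by (simp add: ties_def)
        then have "ell w d' u c = 0" using True by (simp add: ellw)
        moreover have "lt (lval (h d' u) (lin (W k)) u) (lval (h d' u) (lin (W k)) c)"
          using lead_lt[OF leadh[OF LWk(1) u] c(2)] .
        ultimately show ?thesis
          using True ell[OF u c(1), of w] ell[OF u c(1), of "W k"] z valfin[OF u, of "W k"] by (auto simp: lt_def lval_def)
      next
        case False
        have "0 \<le> ell (W k) d' u c" using ell_nonneg[OF k(1) u c(1)] .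
        then have "\<epsilon> * ell (W k) d' u c \<ge> 0" using eps by simp
        then have "0 < ell w d' u c" using epsle[OF q False] eps by (simp add: ellw algebra_simps)
        then show ?thesis using ell[OF u c(1), of w] z by (auto simp: lt_def lval_def)
      qed
    qed
    then show "u \<in> L d' w" using h(1)[OF u] by (auto simp: L_def leads_def)
  qed
  \<comment> \<open>The leading sets are kept in all degrees, including \<open>d\<close>, which may
    exceed \<open>D\<close>; yet at \<open>w\<close> the term \<open>b\<close> of
    \<open>h d a\<close> lies strictly below the term \<open>a\<close>.\<close>
  then have "\<And>d. L d w = Li d" by (rule Lieq)
  from lead_lt[OF leadh[OF this aLi] b(2)] ell[OF aLi b(1), of w] valfin[OF aLi, of w]
  have "0 \<le> ell w d a b" by (auto simp: lt_def lval_def)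
  moreover have "ell w d a b < 0"
  proof -
    have "(1 + \<epsilon>) * ell (W k) d a b \<le> 0" using bk eps by (simp add: mult_nonneg_nonpos)
    moreover have "\<epsilon> * ell (W k0) d a b > 0" using strict0[OF b(1,2)] eps by simp
    ultimately show ?thesis by (simp add: ellw)
  qed
  ultimately show False by simp
qed

end

section \<open>Varieties and the weak Nullstellensatz\<close>

lemma sum_trop_eq_min:
  fixes g :: "'a \<Rightarrow> trop"
  assumes "finite S" "a \<in> S" "\<And>u. u \<in> S \<Longrightarrow> g a \<le> g u"
  shows "sum g S = g a"
proof (rule order_antisym)
  have le: "sum g S \<le> g u" if "finite S" "u \<in> S" for S u
    using that
  proof (induction S rule: finite_induct)
    case (insert x F)
    then show ?case by (auto simp: plus_trop_def min_le_iff_disj)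
  qed simp
  show "sum g S \<le> g a" using le assms by blast
  have "c \<le> sum g S" if "finite S" "\<And>u. u \<in> S \<Longrightarrow> c \<le> g u" for S c
    using that by (induction S rule: finite_induct) (auto simp: plus_trop_def)
  then show "g a \<le> sum g S" using assms by blast
qed

lemma attains_twice_imp_min_achieved_twice:
  assumes "attains_twice f (lin w)" shows "min_achieved_twice f w"
proof -
  have tv: "term_value f w u = val f (lin w) u" for u by (simp add: term_value_def val_def lin_def)
  obtain a b where ab: "a \<noteq> b" "a \<in> supp f" "b \<in> supp f" "val f (lin w) a = val f (lin w) b"
    "\<And>u. val f (lin w) a \<le> val f (lin w) u" using assms unfolding attains_twice_def by blast
  have ev: "trop_eval f w = val f (lin w) a" unfolding trop_eval_def tv using ab by (intro sum_trop_eq_min) auto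
  have "{a, b} \<subseteq> {u \<in> supp f. term_value f w u = trop_eval f w}" using ab by (auto simp: tv ev)
  then have "card {a, b} \<le> card {u \<in> supp f. term_value f w u = trop_eval f w}" by (intro card_mono) auto
  then show ?thesis unfolding min_achieved_twice_def using ab(1) by simp
qed

lemma one_laurent: "(1 :: 'n::finite laurent) = Poly_Mapping.single 0 1"
  by simp

lemma keys_one_laurent [simp]: "supp (1 :: 'n::finite laurent) = {0}"
  unfolding one_laurent by (subst keys_single) simp

lemma lookup_one_laurent: "cf (1 :: 'n::finite laurent) u = (if u = 0 then 1 else 0)"
  by (simp add: lookup_one when_def)

lemma not_min_achieved_twice_one: "\<not> min_achieved_twice (1 :: ('n::finite) laurent) w"
proof -
  have "card {u \<in> supp (1 :: 'n laurent). term_value 1 w u = trop_eval 1 w} \<le> card {0 :: int ^ 'n}"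
    by (intro card_mono) auto
  then show ?thesis by (simp add: min_achieved_twice_def)
qed

lemma singleton_keys_single:
  assumes "supp f = {u}" obtains c where "f = Poly_Mapping.single u (Fin c)"
proof -
  obtain c where "cf f u = Fin c" using assms by (metis in_keys_iff insertI1 trop_neq_zero_iff)
  then have "f = Poly_Mapping.single u (Fin c)" using assms
    by (intro poly_mapping_eqI) (auto simp: lookup_single when_def in_keys_iff)
  then show thesis by (rule that)
qed

lemma ideal_mult: "semiring_ideal A J \<Longrightarrow> r \<in> A \<Longrightarrow> f \<in> J \<Longrightarrow> r * f \<in> J"
  and ideal_add: "semiring_ideal A J \<Longrightarrow> f \<in> J \<Longrightarrow> g \<in> J \<Longrightarrow> f + g \<in> J"
  and ideal_subset: "semiring_ideal A J \<Longrightarrow> J \<subseteq> A"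
  by (auto simp: semiring_ideal_def)

lemma single_supported [simp]: "a \<in> A \<Longrightarrow> Poly_Mapping.single a c \<in> supported_on A"
  by (auto simp: supported_on_def)

lemma ideal_shift: "semiring_ideal (supported_on A) J \<Longrightarrow> f \<in> J \<Longrightarrow> a \<in> A \<Longrightarrow> shift a f \<in> J"
  unfolding shift_def by (intro ideal_mult) auto

lemma monomial_imp_one:
  assumes J: "semiring_ideal (supported_on A) J" and "Poly_Mapping.single u (Fin c) \<in> J" "- u \<in> A"
  shows "1 \<in> J"
proof -
  have "Poly_Mapping.single (- u) (Fin (- c)) * Poly_Mapping.single u (Fin c) \<in> J"
    using assms by (intro ideal_mult[OF J]) auto
  also have "Poly_Mapping.single (- u) (Fin (- c)) * Poly_Mapping.single u (Fin c) = 1"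
    by (simp add: mult_single one_laurent one_trop_def)
  finally show ?thesis .
qed

text \<open>Every monomial with exponent in the group \<open>\<Lambda>\<close> is invertible, so an
  ideal without \<open>1\<close> contains no monomial and \<open>exists_root\<close>
  applies.\<close>

lemma tropical_ideal_has_root:
  fixes J :: "('n::finite) laurent set"
  assumes L: "0 \<in> \<Lambda>" "\<And>u v. u \<in> \<Lambda> \<Longrightarrow> v \<in> \<Lambda> \<Longrightarrow> u - v \<in> \<Lambda>"
    and J: "tropical_ideal \<Lambda> J" and "1 \<notin> J"
  shows "\<exists>w. \<forall>f\<in>J - {0}. attains_twice f (lin w)"
proof -
  have SI: "semiring_ideal (supported_on \<Lambda>) J" using J by (simp add: tropical_ideal_def)
  have neg: "- u \<in> \<Lambda>" if "u \<in> \<Lambda>" for u using L(2)[OF L(1) that] by simp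
  interpret tropical_lattice_ideal \<Lambda> J
  proof
    show "u + v \<in> \<Lambda>" if "u \<in> \<Lambda>" "v \<in> \<Lambda>" for u v using L(2)[OF that(1) neg[OF that(2)]] by simp
    show "J \<subseteq> supported_on \<Lambda>" using SI by (rule ideal_subset)
    show "matroidal J" using J L(1) by (rule tropical_ideal_matroidal)
    show "shift a f \<in> J" if "f \<in> J" "a \<in> \<Lambda>" for f a using SI that by (rule ideal_shift)
    show "card (supp f) \<noteq> 1" if "f \<in> J" for f
    proof
      assume "card (supp f) = 1"
      then obtain u where u: "supp f = {u}" by (auto simp: card_1_singleton_iff)
      then obtain c where c: "f = Poly_Mapping.single u (Fin c)" by (rule singleton_keys_single)
      have "u \<in> \<Lambda>" using u \<open>J \<subseteq> supported_on \<Lambda>\<close> that by (auto simp: supported_on_def)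
      have "Poly_Mapping.single u (Fin c) \<in> J" by (fold c) (rule that)
      then have "1 \<in> J" by (rule monomial_imp_one[OF SI _ neg[OF \<open>u \<in> \<Lambda>\<close>]])
      then show False using \<open>1 \<notin> J\<close> by simp
    qed
  qed (use L in auto)
  show ?thesis by (rule exists_root)
qed

lemma hull_ideal_mult:
  assumes "r \<in> A" "f \<in> X" shows "r * f \<in> semiring_ideal A hull X"
  unfolding hull_def using assms by (auto intro: ideal_mult)

lemma unit_ideal_iff:
  assumes "semiring_ideal UNIV J" shows "J = semiring_ideal UNIV hull {1} \<longleftrightarrow> 1 \<in> J"
proof
  assume J: "J = semiring_ideal UNIV hull {1}"
  show "1 \<in> J" by (subst J) (rule hull_inc, simp)
next
  assume "1 \<in> J"
  then have "f \<in> J" for f using ideal_mult[OF assms, of f 1] by simp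
  moreover have "f \<in> semiring_ideal UNIV hull {1}" for f using hull_ideal_mult[of f UNIV 1 "{1}"] by simp
  ultimately show "J = semiring_ideal UNIV hull {1}" by auto
qed

lemma torus_nullstellensatz:
  fixes I :: "('n::finite) laurent set"
  assumes I: "tropical_ideal UNIV I"
  shows "torus_variety I = {} \<longleftrightarrow> I = semiring_ideal UNIV hull {1}"
proof -
  have SI: "semiring_ideal UNIV I"
    using I by (simp add: tropical_ideal_def supported_on_def)
  have "torus_variety I = {} \<longleftrightarrow> 1 \<in> I"
  proof
    assume e: "torus_variety I = {}"
    show "1 \<in> I"
    proof (rule ccontr)
      assume "1 \<notin> I"
      then obtain w where "\<forall>f\<in>I - {0}. attains_twice f (lin w)" using tropical_ideal_has_root[OF _ _ I] by auto
      then have "w \<in> torus_variety I" by (auto simp: torus_variety_def intro: attains_twice_imp_min_achieved_twice)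
      then show False using e by simp
    qed
  next
    assume "1 \<in> I"
    then show "torus_variety I = {}"
      using not_min_achieved_twice_one by (auto simp: torus_variety_def intro!: bexI[of _ 1])
  qed
  then show ?thesis using unit_ideal_iff[OF SI] by simp
qed

text \<open>
  From an element \<open>1 + (terms of positive level)\<close> one reaches \<open>1\<close>: eliminating the lowest nonconstant terms
  against multiples of the same element pushes the level up, until all the nonconstant monomials belong to \<open>J\<close>.
\<close>

lemma one_from_positive_level:
  fixes J :: "('n::finite) laurent set" and lv :: "int ^ 'n \<Rightarrow> int"
  assumes J: "tropical_ideal A J" "0 \<in> A"
    and ladd: "\<And>u v. lv (u + v) = lv u + lv v"
    and g0: "g0 \<in> J" "0 \<in> supp g0" "\<And>u. u \<in> supp g0 \<Longrightarrow> u \<noteq> 0 \<Longrightarrow> 0 < lv u"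
    and large: "\<And>v. v \<in> A \<Longrightarrow> N \<le> lv v \<Longrightarrow> Poly_Mapping.single v 1 \<in> J"
  shows "1 \<in> J"
proof -
  have SI: "semiring_ideal (supported_on A) J" using J by (simp add: tropical_ideal_def)
  have mat: "matroidal J" using J by (rule tropical_ideal_matroidal)
  have keysA: "u \<in> A" if "f \<in> J" "u \<in> supp f" for f u
    using that ideal_subset[OF SI] by (auto simp: supported_on_def)
  have l0: "lv 0 = 0" using ladd[of 0 0] by simp
  let ?G = "\<lambda>l g. g \<in> J \<and> 0 \<in> supp g \<and> (\<forall>u\<in>supp g - {0}. l \<le> lv u)"
  have step: "\<exists>g. ?G (l + 1) g" if g: "?G l g" and l: "1 \<le> l" for l g
  proof -
    have "\<exists>g. ?G (l + 1) g" if "?G l h" for h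
      using that
    proof (induction "card {u \<in> supp h - {0}. lv u = l}" arbitrary: h rule: less_induct)
      case less
      show ?case
      proof (cases "{u \<in> supp h - {0}. lv u = l} = {}")
        case True
        have "l + 1 \<le> lv u" if "u \<in> supp h - {0}" for u
        proof -
          have "l \<le> lv u" "lv u \<noteq> l" using less.prems True that by blast+
          then show ?thesis by simp
        qed
        then have "?G (l + 1) h" using less.prems by blast
        then show ?thesis by blast
      next
        case False
        then obtain v where v: "v \<in> supp h" "v \<noteq> 0" "lv v = l" by blast
        \<comment> \<open>Apart from \<open>v\<close>, this multiple of \<open>g\<close> has only
          terms of level at least \<open>l + l\<close>, which exceeds \<open>l\<close>. So
          eliminating \<open>v\<close> brings in no term of level \<open>l\<close> and leaves the
          constant term alone.\<close>
        let ?s = "shift v g"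
        have vA: "v \<in> A" using keysA less.prems v by blast
        have sJ: "?s \<in> J" using g ideal_shift[OF SI _ vA] by blast
        have vs: "v \<in> supp ?s" using g by (auto simp: keys_shift)
        have hJ: "h \<in> J" using less.prems by blast
        have lev: "l + 1 \<le> lv u" if u: "u \<in> supp ?s" "u \<noteq> v" for u
        proof -
          obtain z where z: "z \<in> supp g" "u = v + z" using u(1) by (auto simp: keys_shift)
          then have "z \<noteq> 0" using u(2) by auto
          then have "l \<le> lv z" using z g by blast
          then show ?thesis using z l v(3) by (simp add: ladd)
        qed
        have "0 \<notin> supp ?s" using lev[of 0] v(2) l l0 by auto
        obtain c k where k: "k \<in> J"
          "\<And>u. cf h u \<noteq> Fin c * cf ?s u \<Longrightarrow> cf k u = min (cf h u) (Fin c * cf ?s u)"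
          "supp k \<subseteq> (supp h \<union> supp ?s) - {v}"
          by (rule matroidal_elim_scaled[OF mat hJ sJ v(1) vs]) blast
        have "0 \<in> supp k"
          using k(2)[of 0] \<open>0 \<notin> supp ?s\<close> less.prems by (auto simp: in_keys_iff)
        moreover have "l \<le> lv u" if "u \<in> supp k - {0}" for u
        proof (cases "u \<in> supp h")
          case True then show ?thesis using less.prems that by blast
        next
          case False
          then have "u \<in> supp ?s" "u \<noteq> v" using that k(3) by auto
          then show ?thesis using lev by force
        qed
        moreover have "{u \<in> supp k - {0}. lv u = l} \<subset> {u \<in> supp h - {0}. lv u = l}"
        proof
          show "{u \<in> supp k - {0}. lv u = l} \<subseteq> {u \<in> supp h - {0}. lv u = l}"
          proof
            fix u assume "u \<in> {u \<in> supp k - {0}. lv u = l}"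
            then have u: "u \<in> supp k" "u \<noteq> 0" "lv u = l" by auto
            have "u \<notin> supp ?s" using lev[of u] u k(3) by auto
            then show "u \<in> {u \<in> supp h - {0}. lv u = l}" using u k(3) by auto
          qed
          show "{u \<in> supp k - {0}. lv u = l} \<noteq> {u \<in> supp h - {0}. lv u = l}" using v k(3) by blast
        qed
        then have "card {u \<in> supp k - {0}. lv u = l} < card {u \<in> supp h - {0}. lv u = l}"
          by (intro psubset_card_mono) auto
        ultimately show ?thesis using less.hyps k(1) by blast
      qed
    qed
    with g show ?thesis by blast
  qed
  have "\<exists>g. ?G (int n + 1) g" for n
  proof (induction n)
    case 0
    have "int 0 + 1 \<le> lv u" if "u \<in> supp g0 - {0}" for u using g0(3)[of u] that by simp
    then have "?G (int 0 + 1) g0" using g0(1,2) by blast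
    then show ?case by blast
  next
    case (Suc n)
    then obtain g where "?G (int n + 1) g" by blast
    from step[OF this] show ?case by (simp add: algebra_simps)
  qed
  then obtain g where g: "?G (int (nat N) + 1) g" by blast
  have "\<exists>g\<in>J. supp g = {0}" if "h \<in> J" "0 \<in> supp h" "\<And>u. u \<in> supp h \<Longrightarrow> u \<noteq> 0 \<Longrightarrow> Poly_Mapping.single u 1 \<in> J" for h
    using that
  proof (induction "card (supp h)" arbitrary: h rule: less_induct)
    case less
    show ?case
    proof (cases "supp h = {0}")
      case True then show ?thesis using less.prems by blast
    next
      case False
      then obtain v where v: "v \<in> supp h" "v \<noteq> 0" using less.prems by blast
      let ?s = "Poly_Mapping.single v (1::trop)"
      have sJ: "?s \<in> J" using less.prems v by blast
      have sk: "supp ?s = {v}" by (subst keys_single) simp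
      obtain c k where k: "k \<in> J"
        "\<And>u. cf h u \<noteq> Fin c * cf ?s u \<Longrightarrow> cf k u = min (cf h u) (Fin c * cf ?s u)"
        "supp k \<subseteq> (supp h \<union> supp ?s) - {v}"
        by (rule matroidal_elim_scaled[OF mat less.prems(1) sJ v(1)]) (use sk in blast)+
      have "cf ?s 0 = 0" using v by (simp add: lookup_single)
      then have "0 \<in> supp k" using k(2)[of 0] less.prems(2) by (auto simp: in_keys_iff)
      moreover have sub: "supp k \<subset> supp h" using k(3) sk v by auto
      then have "card (supp k) < card (supp h)" by (intro psubset_card_mono) auto
      moreover have "\<And>u. u \<in> supp k \<Longrightarrow> u \<noteq> 0 \<Longrightarrow> Poly_Mapping.single u 1 \<in> J"
        using sub less.prems(3) by blast
      ultimately show ?thesis using less.hyps k(1) by blast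
    qed
  qed
  moreover have "Poly_Mapping.single u 1 \<in> J" if u: "u \<in> supp g" "u \<noteq> 0" for u
  proof (rule large)
    show "u \<in> A" using keysA g u by blast
    have "int (nat N) + 1 \<le> lv u" using g u by blast
    then show "N \<le> lv u" by linarith
  qed
  ultimately obtain f where f: "f \<in> J" "supp f = {0}" using g by blast
  obtain c where "f = Poly_Mapping.single 0 (Fin c)" using f(2) by (rule singleton_keys_single)
  then show ?thesis using monomial_imp_one[OF SI, of 0 c] f(1) J(2) by simp
qed

section \<open>Simplicial fans\<close>

lemma ray_eq:
  assumes "fan \<Sigma>" "\<rho> \<in> rays \<Sigma>" "x \<in> \<rho>" "x \<noteq> 0"
  shows "\<rho> = {t *\<^sub>R x | t. 0 \<le> t}"
proof -
  have \<rho>: "rational_cone \<rho>" "strongly_convex \<rho>" "dim \<rho> = 1"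
    using assms(1,2) by (auto simp: fan_def rays_def)
  have cone: "convex_cone \<rho>" using \<rho>(1) unfolding rational_cone_def by (auto simp: convex_cone_convex_cone_hull)
  have sc: "t *\<^sub>R y \<in> \<rho>" if "0 \<le> t" "y \<in> \<rho>" for t y
    using cone that by (simp add: convex_cone_def conic_def)
  have "span {x} = span \<rho>"
  proof (rule dim_eq_span)
    show "{x} \<subseteq> \<rho>" using assms by simp
    show "dim \<rho> \<le> dim {x}" using \<rho>(3) assms(4) dim_eq_card_independent[of "{x}"] by simp
  qed
  then have sp: "\<rho> \<subseteq> span {x}" using span_superset by blast
  show ?thesis
  proof
    show "{t *\<^sub>R x | t. 0 \<le> t} \<subseteq> \<rho>" using sc assms(3) by auto
    show "\<rho> \<subseteq> {t *\<^sub>R x | t. 0 \<le> t}"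
    proof
      fix y assume y: "y \<in> \<rho>"
      then obtain t where t: "y = t *\<^sub>R x" using sp by (auto simp: span_singleton)
      have "0 \<le> t"
      proof (rule ccontr)
        assume "\<not> 0 \<le> t"
        then have "(1 / - t) *\<^sub>R y \<in> \<rho>" using sc[of "1 / - t" y] y by simp
        then have "- x \<in> \<rho>" using t \<open>\<not> 0 \<le> t\<close> by simp
        then have "x \<in> \<rho> \<inter> uminus ` \<rho>" using assms(3) by (auto simp: image_iff intro: bexI[of _ "- x"])
        then show False using \<rho>(2) assms(4) by (auto simp: strongly_convex_def)
      qed
      then show "y \<in> {t *\<^sub>R x | t. 0 \<le> t}" using t by blast
    qed
  qed
qed

lemma dual_basis:
  fixes B :: "(real ^ 'n) set"
  assumes "independent B" "b \<in> B"
  obtains a where "a \<bullet> b = 1" "\<And>c. c \<in> B \<Longrightarrow> c \<noteq> b \<Longrightarrow> a \<bullet> c = 0"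
proof -
  obtain g :: "real ^ 'n \<Rightarrow> real" where g: "linear g" "\<forall>x\<in>B. g x = (if x = b then 1 else 0)"
    using linear_independent_extend[OF assms(1), of "\<lambda>x. if x = b then 1 else 0"] by blast
  have ga: "adjoint g 1 \<bullet> x = g x" for x
    using adjoint_works[OF g(1), of x 1] by (simp add: inner_commute)
  show thesis by (rule that[of "adjoint g 1"]) (use g assms in \<open>auto simp: ga\<close>)
qed

text \<open>The generators \<open>B\<close> are arbitrary real vectors, whereas the indices come
  from rays of the fan. They correspond up to positive multiples: a generator spans a face of the
  cone, which is then a ray of the fan, and a ray of the fan inside the cone is a face of it, hence
  spanned by one generator. The face on which the coordinate of that generator vanishes loses
  exactly one index.\<close>

lemma simplicial_cone_facets:
  assumes fan: "fan \<Sigma>" and \<sigma>: "\<sigma> \<in> \<Sigma>" "simplicial_cone \<sigma>" and Q: "cox_matrix \<Sigma> R Q"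
  shows "\<sigma> \<subseteq> span ((\<lambda>i. real_vec (Q $ i)) ` cone_indices R Q \<sigma>)"
    and "\<And>i. i \<in> cone_indices R Q \<sigma> \<Longrightarrow> \<exists>\<tau>\<in>\<Sigma>. cone_indices R Q \<tau> = cone_indices R Q \<sigma> - {i}"
proof -
  let ?q = "\<lambda>i. real_vec (Q $ i)"
  let ?C = "cone_indices R Q \<sigma>"
  obtain B where B: "independent B" "\<sigma> = convex_cone hull B" using \<sigma>(2) by (auto simp: simplicial_cone_def)
  have finB: "finite B" using B(1) by (rule finiteI_independent)
  obtain \<rho> where \<rho>: "bij_betw \<rho> R (rays \<Sigma>)" "\<And>i. i \<in> R \<Longrightarrow> first_lattice_point (\<rho> i) (Q $ i)"
    using Q by (auto simp: cox_matrix_def)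
  have qray: "\<rho> i \<in> rays \<Sigma>" "?q i \<in> \<rho> i" "?q i \<noteq> 0" if "i \<in> R" for i
    using that \<rho> real_vec_eq_iff[of "Q $ i" 0] by (auto simp: first_lattice_point_def bij_betw_def)
  have \<rho>eq: "\<rho> i = {t *\<^sub>R ?q i | t. 0 \<le> t}" if "i \<in> R" for i
    using ray_eq[OF fan qray(1)[OF that] qray(2)[OF that] qray(3)[OF that]] .
  have CR: "i \<in> R" "?q i \<in> \<sigma>" if "i \<in> ?C" for i using that by (auto simp: cone_indices_def)
  have "\<forall>b\<in>B. \<exists>a. a \<bullet> b = 1 \<and> (\<forall>c\<in>B. c \<noteq> b \<longrightarrow> a \<bullet> c = 0)"
    using dual_basis[OF B(1)] by metis
  then obtain a where a: "\<And>b. b \<in> B \<Longrightarrow> a b \<bullet> b = 1" "\<And>b c. b \<in> B \<Longrightarrow> c \<in> B \<Longrightarrow> c \<noteq> b \<Longrightarrow> a b \<bullet> c = 0"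
    by metis
  have cone: "convex_cone \<sigma>" unfolding B by (rule convex_cone_convex_cone_hull)
  have zero\<sigma>: "0 \<in> \<sigma>" using cone by (rule convex_cone_contains_0)
  have scl: "t *\<^sub>R x \<in> \<sigma>" if "0 \<le> t" "x \<in> \<sigma>" for t x using cone that by (simp add: convex_cone_def conic_def)
  have add: "x + y \<in> \<sigma>" if "x \<in> \<sigma>" "y \<in> \<sigma>" for x y using cone that by (rule convex_cone_add)
  have B\<sigma>: "b \<in> \<sigma>" if "b \<in> B" for b unfolding B using that by (rule hull_inc)
  have nonneg: "0 \<le> a b \<bullet> x" if "b \<in> B" "x \<in> \<sigma>" for b x
  proof -
    have "convex_cone {x. 0 \<le> a b \<bullet> x}"
      unfolding convex_cone_def conic_def using convex_halfspace_ge[of 0 "a b"] by (auto intro!: exI[of _ 0])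
    moreover have "B \<subseteq> {x. 0 \<le> a b \<bullet> x}"
    proof
      fix c assume "c \<in> B"
      then show "c \<in> {x. 0 \<le> a b \<bullet> x}" using a(1)[OF that(1)] a(2)[OF that(1), of c] by (cases "c = b") auto
    qed
    ultimately have "convex_cone hull B \<subseteq> {x. 0 \<le> a b \<bullet> x}" by (intro hull_minimal)
    then show ?thesis using that(2) B(2) by blast
  qed
  have "convex_cone (span B)" unfolding convex_cone_def conic_def
    by (auto simp: span_scale intro!: subspace_imp_convex exI[of _ 0] span_zero)
  then have "\<sigma> \<subseteq> span B" unfolding B by (intro hull_minimal span_superset)
  have expand: "x = (\<Sum>b\<in>B. (a b \<bullet> x) *\<^sub>R b)" if "x \<in> \<sigma>" for x
  proof -
    have "x = (\<Sum>b\<in>B. (a b \<bullet> x) *\<^sub>R b)" if "x \<in> span B" for x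
      using that
    proof (induction rule: span_induct_alt)
      case base then show ?case by simp
    next
      case (step c x y)
      have "(\<Sum>b\<in>B. (a b \<bullet> x) *\<^sub>R b) = (\<Sum>b\<in>B. if b = x then b else 0)"
        using a step(1) by (intro sum.cong) auto
      also have "\<dots> = x" using finB step(1) by simp
      finally have "(\<Sum>b\<in>B. (a b \<bullet> (c *\<^sub>R x + y)) *\<^sub>R b) = c *\<^sub>R x + (\<Sum>b\<in>B. (a b \<bullet> y) *\<^sub>R b)"
        by (simp add: inner_add_right scaleR_add_left sum.distrib flip: scaleR_scaleR scaleR_sum_right)
      then show ?case using step(2) by simp
    qed
    then show ?thesis using that \<open>\<sigma> \<subseteq> span B\<close> by blast
  qed
  have face\<Sigma>: "\<tau> \<in> \<Sigma>" if "\<tau> face_of \<sigma>" "\<tau> \<noteq> {}" for \<tau>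
    using fan \<sigma>(1) that unfolding fan_def by blast
  have conv: "convex \<sigma>" using cone by (simp add: convex_cone_def)
  have face: "\<sigma> \<inter> {x. c \<bullet> x = 0} \<in> \<Sigma>" if "\<And>x. x \<in> \<sigma> \<Longrightarrow> 0 \<le> c \<bullet> x" for c
  proof (rule face\<Sigma>)
    show "\<sigma> \<inter> {x. c \<bullet> x = 0} face_of \<sigma>" using conv that by (intro face_of_Int_supporting_hyperplane_ge)
    show "\<sigma> \<inter> {x. c \<bullet> x = 0} \<noteq> {}" using zero\<sigma> by auto
  qed
  have gen: "\<exists>i\<in>?C. \<exists>t>0. ?q i = t *\<^sub>R b" if b: "b \<in> B" for b
  proof -
    \<comment> \<open>The sum of the other dual vectors is nonnegative on the cone and cuts out the
      ray through \<open>b\<close>.\<close>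
    define c where "c = (\<Sum>b'\<in>B - {b}. a b')"
    have c: "c \<bullet> x = (\<Sum>b'\<in>B - {b}. a b' \<bullet> x)" for x by (simp add: c_def inner_sum_left)
    let ?\<rho> = "\<sigma> \<inter> {x. c \<bullet> x = 0}"
    have \<rho>\<Sigma>: "?\<rho> \<in> \<Sigma>" by (rule face) (auto simp: c intro!: sum_nonneg nonneg)
    have b\<rho>: "b \<in> ?\<rho>" using B\<sigma>[OF b] a(2)[OF _ b] by (auto simp: c intro!: sum.neutral)
    have sub: "x = (a b \<bullet> x) *\<^sub>R b" if x: "x \<in> ?\<rho>" for x
    proof -
      have "\<forall>b'\<in>B - {b}. a b' \<bullet> x = 0"
        using x nonneg finB c[of x] by (subst sum_nonneg_eq_0_iff[symmetric]) auto
      then have "(\<Sum>b\<in>B. (a b \<bullet> x) *\<^sub>R b) = (a b \<bullet> x) *\<^sub>R b"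
        using finB b by (subst sum.remove[of B b]) auto
      then show ?thesis using expand[of x] x by simp
    qed
    have b0: "b \<noteq> 0" using a(1)[OF b] by auto
    have "dim ?\<rho> = dim {b}"
    proof (rule span_eq_dim, rule span_subspace)
      show "?\<rho> \<subseteq> span {b}" using sub by (metis span_base span_scale singletonI subsetI)
      show "span {b} \<subseteq> span ?\<rho>" using b\<rho> by (intro span_mono) auto
    qed (rule subspace_span)
    also have "\<dots> = 1" using b0 dim_eq_card_independent[of "{b}"] by simp
    finally have "?\<rho> \<in> rays \<Sigma>" using \<rho>\<Sigma> by (simp add: rays_def)
    then have "?\<rho> \<in> \<rho> ` R" using \<rho>(1) by (simp add: bij_betw_def)
    then obtain i where i: "i \<in> R" "\<rho> i = ?\<rho>" by auto
    have qi: "?q i \<in> ?\<rho>" using qray(2)[OF i(1)] i(2) by simp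
    have "?q i = (a b \<bullet> ?q i) *\<^sub>R b" using qi by (rule sub)
    moreover have "a b \<bullet> ?q i \<noteq> 0"
    proof
      assume "a b \<bullet> ?q i = 0"
      then have "?q i = 0" using \<open>?q i = (a b \<bullet> ?q i) *\<^sub>R b\<close> by simp
      then show False using qray(3)[OF i(1)] by simp
    qed
    moreover have "0 \<le> a b \<bullet> ?q i" using qi by (intro nonneg b) auto
    moreover have "i \<in> ?C" using i(1) qi by (auto simp: cone_indices_def)
    ultimately show ?thesis by (intro bexI[of _ i] exI[of _ "a b \<bullet> ?q i"]) auto
  qed
  have "B \<subseteq> span (?q ` ?C)"
  proof
    fix b assume "b \<in> B"
    then obtain i t where it: "i \<in> ?C" "t > 0" "?q i = t *\<^sub>R b" using gen by blast
    then have "b = (1 / t) *\<^sub>R ?q i" by simp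
    then show "b \<in> span (?q ` ?C)" using it(1) by (metis imageI span_base span_scale)
  qed
  then have "span B \<subseteq> span (?q ` ?C)" by (intro span_minimal subspace_span)
  then show "\<sigma> \<subseteq> span (?q ` ?C)" using \<open>\<sigma> \<subseteq> span B\<close> by blast
  have mult: "\<exists>b\<in>B. \<exists>t>0. ?q i = t *\<^sub>R b" if i: "i \<in> ?C" for i
  proof -
    have iR: "i \<in> R" "?q i \<in> \<sigma>" using CR[OF i] by auto
    have F: "(\<rho> i \<inter> \<sigma>) face_of \<sigma>" using fan \<sigma>(1) qray(1)[OF iR(1)] by (auto simp: fan_def rays_def)
    have "\<exists>b\<in>B. a b \<bullet> ?q i \<noteq> 0"
    proof (rule ccontr)
      assume "\<not> ?thesis"
      then have "?q i = 0" using expand[OF iR(2)] by simp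
      then show False using qray(3)[OF iR(1)] by simp
    qed
    then obtain b where b: "b \<in> B" "a b \<bullet> ?q i \<noteq> 0" by blast
    then have pos: "0 < a b \<bullet> ?q i" using nonneg[OF b(1) iR(2)] by simp
    \<comment> \<open>With two nonzero coordinates, the lattice point would be the midpoint of a
      multiple \<open>?x\<close> of \<open>b\<close> and of the remainder \<open>?y\<close>. As the
      ray is a face, it would contain \<open>?x\<close>, whose coordinate at \<open>b'\<close> is
      0.\<close>
    have "a b' \<bullet> ?q i = 0" if b': "b' \<in> B" "b' \<noteq> b" for b'
    proof (rule ccontr)
      assume ne: "a b' \<bullet> ?q i \<noteq> 0"
      let ?x = "(2 * (a b \<bullet> ?q i)) *\<^sub>R b"
      let ?y = "2 *\<^sub>R (\<Sum>c\<in>B - {b}. (a c \<bullet> ?q i) *\<^sub>R c)"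
      have "(\<Sum>c\<in>A. (a c \<bullet> ?q i) *\<^sub>R c) \<in> \<sigma>" if "A \<subseteq> B" for A
        using finite_subset[OF that finB] that
        by (induction A rule: finite_induct) (auto intro!: zero\<sigma> add scl nonneg iR intro: B\<sigma>)
      then have y\<sigma>: "?y \<in> \<sigma>" by (intro scl) auto
      have x\<sigma>: "?x \<in> \<sigma>" using pos B\<sigma>[OF b(1)] by (intro scl) auto
      have mid: "?q i = (1/2) *\<^sub>R ?x + (1/2) *\<^sub>R ?y"
        using expand[OF iR(2)] finB b(1) by (subst (asm) sum.remove[of B b]) auto
      have ab'x: "a b' \<bullet> ?x = 0" using a(2)[OF b'(1) b(1)] b'(2) by auto
      have "a b' \<bullet> ?y = 2 * (a b' \<bullet> ?q i)"
        using ab'x by (subst mid) (simp only: inner_add_right inner_scaleR_right, simp)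
      then have "a b' \<bullet> ?x \<noteq> a b' \<bullet> ?y" unfolding ab'x using ne by simp
      then have "?x \<noteq> ?y" by metis
      then have "?q i \<in> open_segment ?x ?y" unfolding in_segment
        using mid by (intro conjI exI[of _ "1/2"]) (auto simp: field_simps)
      moreover have "?q i \<in> \<rho> i \<inter> \<sigma>" using iR qray(2)[OF iR(1)] by blast
      ultimately have "?x \<in> \<rho> i" using F x\<sigma> y\<sigma> unfolding face_of_def by blast
      then obtain t where t: "?x = t *\<^sub>R ?q i" using \<rho>eq[OF iR(1)] by auto
      have "0 = t * (a b' \<bullet> ?q i)" using ab'x unfolding t by simp
      then have "t = 0" using ne by simp
      then have "?x = 0" using t by simp
      then have "b = 0" using pos by simp
      then show False using a(1)[OF b(1)] by simp
    qed
    then have "(\<Sum>c\<in>B. (a c \<bullet> ?q i) *\<^sub>R c) = (a b \<bullet> ?q i) *\<^sub>R b"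
      using finB b(1) by (subst sum.remove[of B b]) auto
    then have "?q i = (a b \<bullet> ?q i) *\<^sub>R b" using expand[OF iR(2)] by simp
    then show ?thesis using b(1) pos by blast
  qed
  show "\<exists>\<tau>\<in>\<Sigma>. cone_indices R Q \<tau> = ?C - {i}" if i: "i \<in> ?C" for i
  proof -
    obtain b t where b: "b \<in> B" "t > 0" "?q i = t *\<^sub>R b" using mult[OF i] by blast
    let ?\<tau> = "\<sigma> \<inter> {x. a b \<bullet> x = 0}"
    have "a b \<bullet> ?q j = 0 \<longleftrightarrow> j \<noteq> i" if j: "j \<in> ?C" for j
    proof
      assume "a b \<bullet> ?q j = 0" then show "j \<noteq> i" using b a(1)[OF b(1)] by auto
    next
      assume "j \<noteq> i"
      obtain b' t' where b': "b' \<in> B" "t' > 0" "?q j = t' *\<^sub>R b'" using mult[OF j] by blast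
      show "a b \<bullet> ?q j = 0"
      proof (cases "b' = b")
        case False then show ?thesis using a(2)[OF b(1) b'(1)] b'(3) by simp
      next
        case True
        \<comment> \<open>Two rays on the same generator coincide, and the indexing of the rays is
          injective.\<close>
        then have "?q j = (t' / t) *\<^sub>R ?q i" using b b' by simp
        moreover have "0 \<le> t' / t" using b b' by simp
        ultimately have "?q j \<in> \<rho> i" using \<rho>eq CR(1)[OF i] by blast
        from ray_eq[OF fan qray(1)[OF CR(1)[OF i]] this qray(3)[OF CR(1)[OF j]]]
        have "\<rho> i = \<rho> j" using \<rho>eq[OF CR(1)[OF j]] by simp
        then have "i = j" using \<rho>(1) CR(1) i j by (auto simp: bij_betw_def inj_on_def)
        then show ?thesis using \<open>j \<noteq> i\<close> by simp
      qed
    qed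
    then have "cone_indices R Q ?\<tau> = ?C - {i}" by (auto simp: cone_indices_def)
    moreover have "?\<tau> \<in> \<Sigma>" by (rule face) (rule nonneg[OF b(1)])
    ultimately show ?thesis by blast
  qed
qed

lemma real_vec_matrix_mult: "real_of_int ((Q *v u) $ i) = real_vec (Q $ i) \<bullet> real_vec u"
  by (simp add: matrix_vector_mult_def inner_vec_def real_vec_def)

text \<open>\<open>u\<close> is orthogonal to every row, hence to both of its components in the
  splitting of the lattice, hence to itself. So a monomial \<open>x^(Q u)\<close> determines
  \<open>u\<close>.\<close>

lemma cox_matrix_inj:
  fixes Q :: "int ^ 'n ^ 'm::finite"
  assumes fan: "fan \<Sigma>" and Q: "cox_matrix \<Sigma> R Q" and u: "Q *v u = 0"
  shows "u = 0"
proof -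
  have Qu: "real_vec (Q $ i) \<bullet> real_vec u = 0" for i
    using u by (simp flip: real_vec_matrix_mult)
  obtain \<rho> where \<rho>: "bij_betw \<rho> R (rays \<Sigma>)" "\<And>i. i \<in> R \<Longrightarrow> first_lattice_point (\<rho> i) (Q $ i)"
    using Q by (auto simp: cox_matrix_def)
  obtain N where N: "lattice_direct_sum {v. real_vec v \<in> span (\<Union>(rays \<Sigma>))} N" "lattice_basis (- R) (\<lambda>i. Q $ i) N"
    using Q by (auto simp: cox_matrix_def)
  obtain p where p: "real_vec (fst p) \<in> span (\<Union>(rays \<Sigma>))" "snd p \<in> N" "u = fst p + snd p"
    using N(1) unfolding lattice_direct_sum_def by (metis mem_Collect_eq)
  have "\<Union>(rays \<Sigma>) \<subseteq> {x. x \<bullet> real_vec u = 0}"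
  proof
    fix x assume "x \<in> \<Union>(rays \<Sigma>)"
    then obtain i where i: "i \<in> R" "x \<in> \<rho> i" using \<rho>(1) by (auto simp: bij_betw_def)
    have "\<rho> i \<in> rays \<Sigma>" using i \<rho>(1) by (auto simp: bij_betw_def)
    moreover have "real_vec (Q $ i) \<in> \<rho> i" "real_vec (Q $ i) \<noteq> 0"
      using \<rho>(2)[OF i(1)] real_vec_eq_iff[of "Q $ i" 0] by (auto simp: first_lattice_point_def)
    ultimately have "\<rho> i = {t *\<^sub>R real_vec (Q $ i) | t. 0 \<le> t}" by (rule ray_eq[OF fan])
    then show "x \<in> {x. x \<bullet> real_vec u = 0}" using i(2) Qu by auto
  qed
  moreover have "subspace {x. x \<bullet> real_vec u = 0}"
    by (simp add: subspace_def inner_add_left)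
  ultimately have "span (\<Union>(rays \<Sigma>)) \<subseteq> {x. x \<bullet> real_vec u = 0}" by (rule span_minimal)
  then have 1: "real_vec (fst p) \<bullet> real_vec u = 0" using p(1) by blast
  obtain c where "snd p = (\<Sum>i\<in>-R. c i *s Q $ i)" using N(2) p(2) unfolding lattice_basis_def by metis
  moreover have "real_vec (c *s v) = real_of_int c *\<^sub>R real_vec v" for c :: int and v :: "int ^ 'n"
    by (simp add: vec_eq_iff real_vec_def)
  ultimately have 2: "real_vec (snd p) \<bullet> real_vec u = 0" by (simp add: inner_sum_left Qu)
  have "real_vec u \<bullet> real_vec u = 0"
    using 1 2 p(3) by (metis add.right_neutral inner_add_left real_vec_simps(1))
  then show ?thesis using real_vec_eq_iff[of u 0] by simp
qed

section \<open>The Cox semiring\<close>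

lemma prod_var: "finite A \<Longrightarrow> (\<Prod>i\<in>A. var i) = Poly_Mapping.single (\<chi> j. if j \<in> A then 1 else 0) (1::trop)"
proof (induction A rule: finite_induct)
  case empty
  have "(\<chi> j. 0) = (0 :: int ^ 'a)" by (simp add: vec_eq_iff)
  then show ?case by simp
next
  case (insert i A)
  have "axis i 1 + (\<chi> j. if j \<in> A then 1 else 0) = (\<chi> j. if j \<in> insert i A then 1 else (0::int))"
    using insert.hyps by (auto simp: vec_eq_iff axis_def)
  then show ?case using insert by (simp add: var_def mult_single)
qed

lemma xhat_power:
  "xhat R Q \<sigma> ^ k = Poly_Mapping.single (\<chi> j. if j \<in> cone_indices R Q \<sigma> then 0 else int k) 1"
proof (induction k)
  case 0
  have "(\<chi> j. if j \<in> cone_indices R Q \<sigma> then 0 else int 0) = 0" by (simp add: vec_eq_iff)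
  then show ?case by simp
next
  case (Suc k)
  have "(\<chi> j. if j \<in> - cone_indices R Q \<sigma> then 1 else 0) + (\<chi> j. if j \<in> cone_indices R Q \<sigma> then 0 else int k)
      = (\<chi> j. if j \<in> cone_indices R Q \<sigma> then 0 else int (Suc k))" by (auto simp: vec_eq_iff)
  then show ?case using Suc by (simp add: xhat_def prod_var mult_single)
qed

lemma single_in_cox: "(\<And>i. 0 \<le> a $ i) \<Longrightarrow> Poly_Mapping.single a c \<in> cox"
  by (simp add: cox_def)

lemma xhat_power_in_cox: "xhat R Q \<sigma> ^ k \<in> cox"
  unfolding xhat_power by (rule single_in_cox) simp

lemma cox_mult: "f \<in> cox \<Longrightarrow> g \<in> cox \<Longrightarrow> f * g \<in> cox"
  unfolding cox_def supported_on_def using keys_mult[of f g] by fastforce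

lemma cox_add: "f \<in> cox \<Longrightarrow> g \<in> cox \<Longrightarrow> f + g \<in> cox"
  unfolding cox_def supported_on_def using Poly_Mapping.keys_add[of f g] by fastforce

lemma zero_in_cox: "0 \<in> cox"
  by (simp add: cox_def supported_on_def)

lemma ideal_zero: "semiring_ideal cox I \<Longrightarrow> 0 \<in> I"
proof -
  assume I: "semiring_ideal cox I"
  then obtain f where "f \<in> I" by (auto simp: semiring_ideal_def)
  then show "0 \<in> I" using ideal_mult[OF I zero_in_cox] by fastforce
qed

lemma single_in_localization:
  assumes "\<And>j. j \<in> cone_indices R Q \<sigma> \<Longrightarrow> 0 \<le> a $ j"
  shows "Poly_Mapping.single a 1 \<in> cox_localization R Q \<sigma>"
proof -
  obtain d where "{a} \<subseteq> cube d" by (rule finite_subset_cube[of "{a}"]) auto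
  then have d: "\<bar>a $ j\<bar> \<le> int d" for j by (auto simp: cube_def)
  have "0 \<le> (if j \<in> cone_indices R Q \<sigma> then 0 else int d) + a $ j" for j
    using assms[of j] d[of j] by auto
  then have "xhat R Q \<sigma> ^ d * Poly_Mapping.single a 1 \<in> cox"
    unfolding xhat_power mult_single by (intro single_in_cox) simp
  then show ?thesis by (auto simp: cox_localization_def)
qed

lemma degree_class_matrix: "degree_class Q (Q *v u) = degree_class Q 0"
proof (intro set_eqI iffI)
  fix x assume "x \<in> degree_class Q (Q *v u)"
  then obtain v where "x = Q *v u + Q *v v" unfolding degree_class_def by blast
  then have "x = 0 + Q *v (u + v)" by (simp add: matrix_vector_right_distrib)
  then show "x \<in> degree_class Q 0" unfolding degree_class_def by blast
next
  fix x assume "x \<in> degree_class Q 0"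
  then obtain v where "x = 0 + Q *v v" unfolding degree_class_def by blast
  then have "x = Q *v u + Q *v (v - u)" by (simp flip: matrix_vector_right_distrib)
  then show "x \<in> degree_class Q (Q *v u)" unfolding degree_class_def by blast
qed

text \<open>The variables outside the cone are units in the localization, so the exponents at its
  rays alone decide whether \<open>x^(Q v)\<close> is a multiple of the given power.\<close>

lemma monomial_in_chart_ideal:
  assumes inj: "\<And>u. Q *v u = 0 \<Longrightarrow> u = 0" and X: "xhat R Q \<tau> ^ k \<in> I"
    and v: "\<And>j. j \<in> cone_indices R Q \<sigma> \<Longrightarrow> (if j \<in> cone_indices R Q \<tau> then 0 else int k) \<le> (Q *v v) $ j"
  shows "Poly_Mapping.single v 1 \<in> chart_ideal R Q I \<sigma>"
proof -
  let ?e = "\<chi> j. if j \<in> cone_indices R Q \<tau> then 0 else int k"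
  let ?f = "Poly_Mapping.single (Q *v v) (1::trop)"
  have "Poly_Mapping.single (Q *v v - ?e) 1 * xhat R Q \<tau> ^ k \<in> semiring_ideal (cox_localization R Q \<sigma>) hull I"
    using v by (intro hull_ideal_mult X single_in_localization) auto
  also have "Poly_Mapping.single (Q *v v - ?e) 1 * xhat R Q \<tau> ^ k = ?f"
    unfolding xhat_power mult_single by simp
  finally have f: "?f \<in> semiring_ideal (cox_localization R Q \<sigma>) hull I" .
  have "Q *v v = Q *v u \<longleftrightarrow> v = u" for u
    using inj[of "v - u"] by (auto simp: matrix_vector_mult_diff_distrib)
  then have "cf (Poly_Mapping.single v 1) u = cf ?f (Q *v u)" for u
    by (simp add: lookup_single when_def)
  moreover have "\<forall>a\<in>supp ?f. degree_class Q a = degree_class Q 0"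
    by (auto simp: degree_class_matrix)
  ultimately show ?thesis unfolding chart_ideal_def degree_zero_part_def using f by blast
qed

lemma one_in_chart_ideal:
  assumes inj: "\<And>u. Q *v u = 0 \<Longrightarrow> u = 0" and "xhat R Q \<sigma> ^ k \<in> I"
  shows "1 \<in> chart_ideal R Q I \<sigma>"
proof -
  have "Poly_Mapping.single 0 1 \<in> chart_ideal R Q I \<sigma>"
    by (rule monomial_in_chart_ideal[where \<tau> = \<sigma>, OF inj assms(2)]) auto
  then show ?thesis by simp
qed

text \<open>Denominators can be cleared: the elements that some power of
  \<open>xhat R Q \<sigma>\<close> carries into \<open>I\<close> form an ideal of the localization
  containing \<open>I\<close>, and hence the ideal it generates. An element of degree zero is
  determined by its coefficients at the exponents \<open>Q *v u\<close>, so \<open>1\<close> comes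
  only from \<open>1\<close>.\<close>

lemma one_in_chart_ideal_imp:
  assumes I: "semiring_ideal cox I" and one: "1 \<in> chart_ideal R Q I \<sigma>"
  shows "\<exists>k. xhat R Q \<sigma> ^ k \<in> I"
proof -
  let ?x = "xhat R Q \<sigma>" and ?A = "cox_localization R Q \<sigma>"
  obtain f where f: "f \<in> semiring_ideal ?A hull I" "\<And>a. a \<in> supp f \<Longrightarrow> degree_class Q a = degree_class Q 0"
    "\<And>u. cf 1 u = cf f (Q *v u)" using one unfolding chart_ideal_def degree_zero_part_def by blast
  have "f = 1"
  proof (rule poly_mapping_eqI)
    fix a
    have f0: "cf f 0 = 1" using f(3)[of 0] by (simp add: lookup_one_laurent)
    show "cf f a = cf 1 a"
    proof (cases "a = 0 \<or> a \<notin> supp f")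
      case True then show ?thesis using f0 by (auto simp: lookup_one_laurent in_keys_iff)
    next
      case False
      have "a = a + Q *v 0" by simp
      then have "a \<in> degree_class Q a" unfolding degree_class_def by blast
      then have "a \<in> degree_class Q 0" using f(2) False by blast
      then obtain u where u: "a = Q *v u" unfolding degree_class_def by auto
      then have "u \<noteq> 0" using False by auto
      then have "cf f a = 0" using f(3)[of u] u by (simp add: lookup_one_laurent)
      then show ?thesis using False by (simp add: in_keys_iff)
    qed
  qed
  let ?T = "{f \<in> ?A. \<exists>k. ?x ^ k * f \<in> I}"
  have "semiring_ideal ?A ?T"
    unfolding semiring_ideal_def
  proof (intro conjI ballI)
    have "0 \<in> ?A" by (auto simp: cox_localization_def zero_in_cox)
    then show "?T \<noteq> {}" using ideal_zero[OF I] by (auto intro!: exI[of _ 0])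
    show "?T \<subseteq> ?A" by blast
  next
    fix f g assume "f \<in> ?T" "g \<in> ?T"
    then obtain k l k' l' where kl: "?x ^ k * f \<in> I" "?x ^ l * g \<in> I" "?x ^ k' * f \<in> cox" "?x ^ l' * g \<in> cox"
      unfolding cox_localization_def by blast
    have "?x ^ l * (?x ^ k * f) \<in> I" "?x ^ k * (?x ^ l * g) \<in> I"
      by (rule ideal_mult[OF I xhat_power_in_cox kl(1)], rule ideal_mult[OF I xhat_power_in_cox kl(2)])
    then have "?x ^ l * (?x ^ k * f) + ?x ^ k * (?x ^ l * g) \<in> I" by (rule ideal_add[OF I])
    also have "?x ^ l * (?x ^ k * f) + ?x ^ k * (?x ^ l * g) = ?x ^ (k + l) * (f + g)"
      by (simp add: power_add algebra_simps)
    finally have 1: "?x ^ (k + l) * (f + g) \<in> I" .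
    have "?x ^ l' * (?x ^ k' * f) + ?x ^ k' * (?x ^ l' * g) \<in> cox"
      by (rule cox_add[OF cox_mult[OF xhat_power_in_cox kl(3)] cox_mult[OF xhat_power_in_cox kl(4)]])
    also have "?x ^ l' * (?x ^ k' * f) + ?x ^ k' * (?x ^ l' * g) = ?x ^ (k' + l') * (f + g)"
      by (simp add: power_add algebra_simps)
    finally show "f + g \<in> ?T" using 1 unfolding cox_localization_def by blast
  next
    fix r f assume r: "r \<in> ?A" and f: "f \<in> ?T"
    then obtain k l k' where kl: "?x ^ k * f \<in> I" "?x ^ l * r \<in> cox" "?x ^ k' * f \<in> cox"
      unfolding cox_localization_def by blast
    have "(?x ^ l * r) * (?x ^ k * f) \<in> I" by (rule ideal_mult[OF I kl(2,1)])
    moreover have "(?x ^ l * r) * (?x ^ k' * f) \<in> cox" by (rule cox_mult[OF kl(2,3)])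
    moreover have "(?x ^ l * r) * (?x ^ k * f) = ?x ^ (l + k) * (r * f)" for k
      by (simp add: power_add algebra_simps)
    ultimately have "?x ^ (l + k) * (r * f) \<in> I" "?x ^ (l + k') * (r * f) \<in> cox" by simp_all
    then show "r * f \<in> ?T" unfolding cox_localization_def by blast
  qed
  moreover have "I \<subseteq> ?T"
  proof
    fix f assume f: "f \<in> I"
    then have "?x ^ 0 * f \<in> cox" "?x ^ 0 * f \<in> I" using ideal_subset[OF I] by auto
    then show "f \<in> ?T" unfolding cox_localization_def by blast
  qed
  ultimately have "semiring_ideal ?A hull I \<subseteq> ?T" by (rule hull_minimal[rotated])
  then have "1 \<in> ?T" using f(1) unfolding \<open>f = 1\<close> by (rule subsetD)
  then show ?thesis by simp
qed

section \<open>Ideals and varieties of the orbits\<close>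

lemma exists_restriction: "\<exists>h. \<forall>u. cf h u = (if P u then 0 else cf g u)"
proof -
  have "{u. (if P u then 0 else cf g u) \<noteq> 0} \<subseteq> supp g" by (auto simp: in_keys_iff split: if_splits)
  then have "finite {u. (if P u then 0 else cf g u) \<noteq> 0}" by (rule finite_subset) simp
  then show ?thesis
    by (intro exI[of _ "Poly_Mapping.Abs_poly_mapping (\<lambda>u. if P u then 0 else cf g u)"])
      (simp add: Poly_Mapping.Abs_poly_mapping_inverse)
qed

lemma lookup_mult_laurent:
  fixes r h :: "('n::finite) laurent"
  shows "cf (r * h) u = (\<Sum>l\<in>supp r. cf r l * cf h (u - l))"
proof -
  have "(\<Sum>l\<in>supp r. Poly_Mapping.single l (cf r l)) = r"
    by (rule poly_mapping_eqI) (auto simp: lookup_sum lookup_single when_def in_keys_iff)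
  then have "cf (r * h) u = cf ((\<Sum>l\<in>supp r. Poly_Mapping.single l (cf r l)) * h) u" by simp
  also have "\<dots> = (\<Sum>l\<in>supp r. cf r l * cf h (u - l))"
    by (simp add: sum_distrib_right lookup_sum)
  finally show ?thesis .
qed

definition perp_monomials :: "(real ^ 'n) set \<Rightarrow> (int ^ 'n) set" where
  "perp_monomials \<sigma> = {u. \<forall>w\<in>\<sigma>. real_vec u \<bullet> w = 0}"

text \<open>Elimination is done on lifts in the chart ideal and the result truncated; the monomial
  to be cancelled is one that truncation keeps. Multiplying by a monomial orthogonal to the cone
  does not change which terms are dropped. By \<open>sp\<close>, the remaining exponents are
  orthogonal to the whole cone.\<close>

lemma orbit_ideal_tropical:
  fixes Q :: "int ^ 'n::finite ^ 'm::finite"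
  assumes J: "tropical_ideal (dual_monomials \<sigma>) (chart_ideal R Q I \<sigma>)"
    and sp: "\<sigma> \<subseteq> span ((\<lambda>i. real_vec (Q $ i)) ` cone_indices R Q \<sigma>)"
  shows "tropical_ideal (perp_monomials \<sigma>) (orbit_ideal R Q I \<sigma>)"
proof -
  let ?J = "chart_ideal R Q I \<sigma>" and ?C = "cone_indices R Q \<sigma>" and ?L = "perp_monomials \<sigma>" and ?O = "orbit_ideal R Q I \<sigma>"
  define P where "P u \<longleftrightarrow> (\<exists>i\<in>?C. 0 < (Q *v u) $ i)" for u
  have O: "h \<in> ?O \<longleftrightarrow> (\<exists>g\<in>?J. \<forall>u. cf h u = (if P u then 0 else cf g u))" for h
    by (simp add: orbit_ideal_def P_def)
  have C\<sigma>: "real_vec (Q $ i) \<in> \<sigma>" if "i \<in> ?C" for i using that by (simp add: cone_indices_def)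
  have L0: "(Q *v u) $ i = 0" if "u \<in> ?L" "i \<in> ?C" for u i
  proof -
    have "real_of_int ((Q *v u) $ i) = 0"
      using that(1) C\<sigma>[OF that(2)] by (simp add: real_vec_matrix_mult perp_monomials_def inner_commute[of "real_vec (Q $ i)"])
    then show ?thesis by simp
  qed
  have perp: "u \<in> ?L" if u: "u \<in> dual_monomials \<sigma>" "\<not> P u" for u
  proof -
    have "real_vec (Q $ i) \<bullet> real_vec u = 0" if i: "i \<in> ?C" for i
    proof -
      have "0 \<le> real_vec u \<bullet> real_vec (Q $ i)" using u(1) C\<sigma>[OF i] by (simp add: dual_monomials_def)
      moreover have "real_of_int ((Q *v u) $ i) \<le> 0" using u(2) i by (force simp: P_def)
      ultimately show ?thesis by (simp add: real_vec_matrix_mult inner_commute)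
    qed
    moreover have "subspace {x. x \<bullet> real_vec u = 0}" by (simp add: subspace_def inner_add_left)
    ultimately have "span ((\<lambda>i. real_vec (Q $ i)) ` ?C) \<subseteq> {x. x \<bullet> real_vec u = 0}"
      by (intro span_minimal) auto
    then show ?thesis using sp by (auto simp: perp_monomials_def inner_commute)
  qed
  have Ld: "?L \<subseteq> dual_monomials \<sigma>" by (auto simp: perp_monomials_def dual_monomials_def)
  have SI: "semiring_ideal (supported_on (dual_monomials \<sigma>)) ?J" using J by (simp add: tropical_ideal_def)
  have mat: "matroidal ?J" using J by (rule tropical_ideal_matroidal) (simp add: dual_monomials_def)
  have keysJ: "u \<in> dual_monomials \<sigma>" if "g \<in> ?J" "u \<in> supp g" for g u
    using that ideal_subset[OF SI] by (auto simp: supported_on_def)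
  have Osupp: "?O \<subseteq> supported_on ?L"
  proof
    fix h assume "h \<in> ?O"
    then obtain g where g: "g \<in> ?J" "\<And>u. cf h u = (if P u then 0 else cf g u)" unfolding O by blast
    have "u \<in> ?L" if "u \<in> supp h" for u
      using that g(2)[of u] keysJ[OF g(1), of u] perp[of u] by (auto simp: in_keys_iff split: if_splits)
    then show "h \<in> supported_on ?L" by (auto simp: supported_on_def)
  qed
  have "semiring_ideal (supported_on ?L) ?O"
    unfolding semiring_ideal_def
  proof (intro conjI ballI Osupp)
    obtain g where "g \<in> ?J" using SI by (auto simp: semiring_ideal_def)
    moreover obtain h where "\<forall>u. cf h u = (if P u then 0 else cf g u)" using exists_restriction by blast
    ultimately have "h \<in> ?O" unfolding O by blast
    then show "?O \<noteq> {}" by blast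
  next
    fix f h assume "f \<in> ?O" "h \<in> ?O"
    then obtain f' h' where fh: "f' \<in> ?J" "h' \<in> ?J" "\<And>u. cf f u = (if P u then 0 else cf f' u)"
      "\<And>u. cf h u = (if P u then 0 else cf h' u)" unfolding O by blast
    have "f' + h' \<in> ?J" using fh by (intro ideal_add[OF SI])
    moreover have "cf (f + h) u = (if P u then 0 else cf (f' + h') u)" for u
      by (simp add: lookup_add fh)
    ultimately show "f + h \<in> ?O" unfolding O by blast
  next
    fix r h assume r: "r \<in> supported_on ?L" and "h \<in> ?O"
    then obtain g where g: "g \<in> ?J" "\<And>u. cf h u = (if P u then 0 else cf g u)" unfolding O by blast
    have "r \<in> supported_on (dual_monomials \<sigma>)" using r Ld by (auto simp: supported_on_def)
    then have "r * g \<in> ?J" using g(1) by (rule ideal_mult[OF SI])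
    moreover have "cf (r * h) u = (if P u then 0 else cf (r * g) u)" for u
    proof -
      have Pl: "P (u - l) = P u" if "l \<in> supp r" for l
      proof -
        have "l \<in> ?L" using r that by (auto simp: supported_on_def)
        then show ?thesis using L0[of l] by (auto simp: P_def matrix_vector_mult_diff_distrib)
      qed
      show ?thesis
      proof (cases "P u")
        case True
        then show ?thesis unfolding lookup_mult_laurent by (simp add: g(2) Pl)
      next
        case False
        then show ?thesis unfolding lookup_mult_laurent by (simp add: g(2) Pl)
      qed
    qed
    ultimately show "r * h \<in> ?O" unfolding O by blast
  qed
  moreover have "\<exists>h \<in> ?O \<inter> supported_on E. cf h e = 0 \<and> (\<forall>u\<in>E. min (cf f u) (cf g u) \<le> cf h u \<and>
            (cf f u \<noteq> cf g u \<longrightarrow> cf h u = min (cf f u) (cf g u)))"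
    if f: "f \<in> ?O \<inter> supported_on E" and g: "g \<in> ?O \<inter> supported_on E" and e: "cf f e = cf g e \<and> cf f e \<noteq> 0" for E f g e
  proof -
    obtain f' where f': "f' \<in> ?J" "\<And>u. cf f u = (if P u then 0 else cf f' u)" using f unfolding O Int_iff by blast
    obtain g' where g': "g' \<in> ?J" "\<And>u. cf g u = (if P u then 0 else cf g' u)" using g unfolding O Int_iff by blast
    have "\<not> P e" using e f'(2)[of e] by auto
    then have e': "cf f' e = cf g' e" "cf f' e \<noteq> 0" using e f'(2)[of e] g'(2)[of e] by auto
    obtain k where k: "k \<in> ?J" "cf k e = 0" "\<And>u. min (cf f' u) (cf g' u) \<le> cf k u"
      "\<And>u. cf f' u \<noteq> cf g' u \<Longrightarrow> cf k u = min (cf f' u) (cf g' u)"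
      by (rule matroidal_elim[OF mat f'(1) g'(1) e']) blast
    obtain h where h: "\<And>u. cf h u = (if P u then 0 else cf k u)" using exists_restriction by metis
    have hO: "h \<in> ?O" unfolding O using k(1) h by blast
    have *: "min (cf f u) (cf g u) \<le> cf h u \<and> (cf f u \<noteq> cf g u \<longrightarrow> cf h u = min (cf f u) (cf g u))" for u
      using k(3,4)[of u] unfolding h f'(2) g'(2) by auto
    have "u \<in> E" if "u \<in> supp h" for u
    proof (rule ccontr)
      assume "u \<notin> E"
      then have "cf f u = 0" "cf g u = 0" using f g by (auto simp: supported_on_def in_keys_iff)
      then have "cf h u = 0" using *[of u] by simp
      then show False using that by (simp add: in_keys_iff)
    qed
    then have "h \<in> supported_on E" by (auto simp: supported_on_def)
    moreover have "cf h e = 0" using h[of e] k(2) by simp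
    ultimately show ?thesis using hO * by blast
  qed
  ultimately show ?thesis unfolding tropical_ideal_def by blast
qed

lemma orbit_variety_empty_imp:
  fixes Q :: "int ^ 'n::finite ^ 'm::finite"
  assumes J: "tropical_ideal (dual_monomials \<sigma>) (chart_ideal R Q I \<sigma>)"
    and sp: "\<sigma> \<subseteq> span ((\<lambda>i. real_vec (Q $ i)) ` cone_indices R Q \<sigma>)"
    and empty: "orbit_variety R Q I \<sigma> = {}"
  shows "1 \<in> orbit_ideal R Q I \<sigma>"
proof (rule ccontr)
  assume no: "1 \<notin> orbit_ideal R Q I \<sigma>"
  note trop = orbit_ideal_tropical[OF J sp]
  have "\<exists>w. \<forall>f\<in>orbit_ideal R Q I \<sigma> - {0}. attains_twice f (lin w)"
    by (rule tropical_ideal_has_root[OF _ _ trop no]) (auto simp: perp_monomials_def inner_diff_left)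
  then obtain w where w: "\<And>f. f \<in> orbit_ideal R Q I \<sigma> \<Longrightarrow> f \<noteq> 0 \<Longrightarrow> attains_twice f (lin w)" by blast
  let ?W = "{(v, w). v - w \<in> span \<sigma>} `` {w}"
  have "min_achieved_twice f w'" if f: "f \<in> orbit_ideal R Q I \<sigma>" "f \<noteq> 0" and w': "w' \<in> ?W" for f w'
  proof (rule attains_twice_imp_min_achieved_twice)
    have "w - w' \<in> span \<sigma>" using w' by simp
    have "lin w u = lin w' u" if "u \<in> supp f" for u
    proof -
      have "u \<in> perp_monomials \<sigma>" using f(1) that trop
        by (auto simp: tropical_ideal_def semiring_ideal_def supported_on_def)
      then have "\<sigma> \<subseteq> {x. real_vec u \<bullet> x = 0}" by (auto simp: perp_monomials_def)
      moreover have "subspace {x. real_vec u \<bullet> x = 0}" by (simp add: subspace_def inner_add_right)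
      ultimately have "span \<sigma> \<subseteq> {x. real_vec u \<bullet> x = 0}" by (rule span_minimal)
      then have "real_vec u \<bullet> (w - w') = 0" using \<open>w - w' \<in> span \<sigma>\<close> by blast
      then show ?thesis by (simp add: lin_def inner_diff_right)
    qed
    then have "val f (lin w') u = val f (lin w) u" for u
      by (cases "u \<in> supp f") (auto simp: val_def in_keys_iff)
    then show "attains_twice f (lin w')" using w[OF f] unfolding attains_twice_def by simp
  qed
  moreover have "?W \<in> orbit \<sigma>" unfolding orbit_def by (rule quotientI) simp
  ultimately have "?W \<in> orbit_variety R Q I \<sigma>" unfolding orbit_variety_def by blast
  then show False using empty by simp
qed

text \<open>Truncation leaves \<open>1\<close> unchanged, and \<open>1\<close> has no root. Points
  of an orbit are nonempty cosets, so the condition on their representatives is not vacuous.\<close>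

lemma one_in_chart_ideal_imp_empty:
  assumes "1 \<in> chart_ideal R Q I \<sigma>"
  shows "orbit_variety R Q I \<sigma> = {}"
proof -
  have "cf 1 u = (if \<exists>i\<in>cone_indices R Q \<sigma>. 0 < (Q *v u) $ i then 0 else cf 1 u)" for u
    by (auto simp: lookup_one_laurent)
  then have "1 \<in> orbit_ideal R Q I \<sigma>" unfolding orbit_ideal_def using assms by blast
  moreover have "W \<noteq> {}" if W: "W \<in> orbit \<sigma>" for W
  proof -
    obtain w where "W = {(v, w). v - w \<in> span \<sigma>} `` {w}" using W unfolding orbit_def by (rule quotientE)
    then have "w \<in> W" by (simp add: span_zero)
    then show ?thesis by blast
  qed
  ultimately show ?thesis using not_min_achieved_twice_one unfolding orbit_variety_def by fastforce
qed

lemma one_in_chart_ideal_step: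
  fixes Q :: "int ^ 'n::finite ^ 'm::finite"
  assumes J: "tropical_ideal (dual_monomials \<sigma>) (chart_ideal R Q I \<sigma>)"
    and inj: "\<And>u. Q *v u = 0 \<Longrightarrow> u = 0"
    and one: "1 \<in> orbit_ideal R Q I \<sigma>"
    and facets: "\<And>i. i \<in> cone_indices R Q \<sigma> \<Longrightarrow>
      \<exists>\<tau> k. cone_indices R Q \<tau> = cone_indices R Q \<sigma> - {i} \<and> xhat R Q \<tau> ^ k \<in> I"
  shows "1 \<in> chart_ideal R Q I \<sigma>"
proof -
  let ?C = "cone_indices R Q \<sigma>"
  obtain \<tau> k where \<tau>: "\<And>i. i \<in> ?C \<Longrightarrow> cone_indices R Q (\<tau> i) = ?C - {i}" "\<And>i. i \<in> ?C \<Longrightarrow> xhat R Q (\<tau> i) ^ k i \<in> I"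
    using facets by metis
  have dual: "0 \<le> (Q *v u) $ i" if "u \<in> dual_monomials \<sigma>" "i \<in> ?C" for u i
  proof -
    have "0 \<le> real_vec u \<bullet> real_vec (Q $ i)" using that by (auto simp: dual_monomials_def cone_indices_def)
    then have "0 \<le> real_of_int ((Q *v u) $ i)" by (simp add: real_vec_matrix_mult inner_commute)
    then show ?thesis by simp
  qed
  obtain g where g: "g \<in> chart_ideal R Q I \<sigma>" "\<And>u. cf 1 u = (if \<exists>i\<in>?C. 0 < (Q *v u) $ i then 0 else cf g u)"
    using one unfolding orbit_ideal_def by blast
  \<comment> \<open>The total order of vanishing along the rays of the cone; on the chart every
    summand is nonnegative.\<close>
  define lv where "lv u = (\<Sum>i\<in>?C. (Q *v u) $ i)" for u
  show ?thesis
  \<comment> \<open>A monomial whose level exceeds the sum of the \<open>k i\<close> vanishes to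
    order at least \<open>k i\<close> along some ray \<open>i\<close>, hence is a multiple of the
    known power for the facet opposite to \<open>i\<close>. For a cone without rays the added 1
    leaves no such monomial.\<close>
  proof (rule one_from_positive_level[OF J, of lv g "(\<Sum>i\<in>?C. int (k i)) + 1"])
    show "0 \<in> dual_monomials \<sigma>" by (simp add: dual_monomials_def)
    show "lv (u + v) = lv u + lv v" for u v by (simp add: lv_def matrix_vector_right_distrib sum.distrib)
    show "g \<in> chart_ideal R Q I \<sigma>" by (rule g(1))
    show "0 \<in> supp g" using g(2)[of 0] by (auto simp: lookup_one_laurent in_keys_iff)
    show "0 < lv u" if u: "u \<in> supp g" "u \<noteq> 0" for u
    proof -
      have "\<exists>i\<in>?C. 0 < (Q *v u) $ i"
        using g(2)[of u] u by (auto simp: lookup_one_laurent in_keys_iff split: if_splits)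
      then obtain i where i: "i \<in> ?C" "0 < (Q *v u) $ i" by blast
      have "u \<in> dual_monomials \<sigma>" using J g(1) u(1)
        by (auto simp: tropical_ideal_def semiring_ideal_def supported_on_def)
      then show ?thesis unfolding lv_def using i dual by (intro sum_pos2[of _ i]) auto
    qed
    show "Poly_Mapping.single v 1 \<in> chart_ideal R Q I \<sigma>"
      if v: "v \<in> dual_monomials \<sigma>" "(\<Sum>i\<in>?C. int (k i)) + 1 \<le> lv v" for v
    proof -
      have "\<exists>i\<in>?C. int (k i) \<le> (Q *v v) $ i"
      proof (rule ccontr)
        assume "\<not> ?thesis"
        then have "lv v \<le> (\<Sum>i\<in>?C. int (k i))" unfolding lv_def by (intro sum_mono) force
        then show False using v(2) by simp
      qed
      then obtain i where i: "i \<in> ?C" "int (k i) \<le> (Q *v v) $ i" by blast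
      show ?thesis
        by (rule monomial_in_chart_ideal[OF inj \<tau>(2)[OF i(1)]]) (use \<tau>(1)[OF i(1)] i(2) dual[OF v(1)] in auto)
    qed
  qed
qed

section \<open>Powers of the irrelevant ideal and the toric Nullstellensatz\<close>

lemma irrelevant_power_subset:
  fixes \<Sigma> :: "(real ^ 'n::finite) set set" and Q :: "int ^ 'n ^ 'm::finite"
  assumes I: "semiring_ideal cox I" and fin: "finite \<Sigma>" and pw: "\<And>\<sigma>. \<sigma> \<in> \<Sigma> \<Longrightarrow> \<exists>k. xhat R Q \<sigma> ^ k \<in> I"
  shows "\<exists>d>0. ideal_power cox (irrelevant_ideal \<Sigma> R Q) d \<subseteq> I"
proof -
  obtain k where k: "\<And>\<sigma>. \<sigma> \<in> \<Sigma> \<Longrightarrow> xhat R Q \<sigma> ^ k \<sigma> \<in> I" using pw by metis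
  \<comment> \<open>Among this many generators, some \<open>xhat R Q \<sigma>\<close> occurs at
    least \<open>k \<sigma>\<close> times; the added 1 also makes \<open>d\<close> positive.\<close>
  define d where "d = (\<Sum>\<sigma>\<in>\<Sigma>. k \<sigma>) + 1"
  let ?B = "irrelevant_ideal \<Sigma> R Q"
  have cox_ideal: "semiring_ideal cox cox"
    unfolding semiring_ideal_def using zero_in_cox by (auto intro: cox_add cox_mult)
  have xc: "xhat R Q \<sigma> \<in> cox" for \<sigma> using xhat_power_in_cox[of R Q \<sigma> 1] by simp
  have Bcox: "?B \<subseteq> cox" unfolding irrelevant_ideal_def
    by (rule hull_minimal) (use cox_ideal xc in auto)
  let ?p = "\<lambda>c. \<Prod>\<sigma>\<in>\<Sigma>. xhat R Q \<sigma> ^ c \<sigma>"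
  have pcox: "?p c \<in> cox" for c
  proof -
    have "(\<Prod>\<sigma>\<in>A. xhat R Q \<sigma> ^ c \<sigma>) \<in> cox" if "finite A" for A
      using that
    proof (induction A rule: finite_induct)
      case empty
      show ?case using xhat_power_in_cox[of R Q _ 0] by simp
    next
      case (insert x A)
      then show ?case by (simp add: cox_mult xhat_power_in_cox)
    qed
    then show ?thesis using fin by blast
  qed
  \<comment> \<open>General elements of the irrelevant ideal are traded for generators one factor at
    a time, with \<open>c\<close> counting the generators collected.\<close>
  have main: "?p c * (\<Prod>j<n. b j) \<in> I" if "\<And>j. j < n \<Longrightarrow> b j \<in> ?B" "d \<le> sum c \<Sigma> + n" for c n b
    using that
  proof (induction n arbitrary: c)
    case 0
    have "\<exists>\<sigma>\<in>\<Sigma>. k \<sigma> \<le> c \<sigma>"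
    proof (rule ccontr)
      assume "\<not> ?thesis"
      then have "sum c \<Sigma> \<le> sum k \<Sigma>" by (intro sum_mono) force
      then show False using 0 by (simp add: d_def)
    qed
    then obtain \<sigma> where \<sigma>: "\<sigma> \<in> \<Sigma>" "k \<sigma> \<le> c \<sigma>" by blast
    let ?c = "c(\<sigma> := c \<sigma> - k \<sigma>)"
    have "?p c = ?p ?c * xhat R Q \<sigma> ^ k \<sigma>"
    proof -
      have "xhat R Q \<sigma> ^ c \<sigma> = xhat R Q \<sigma> ^ (c \<sigma> - k \<sigma>) * xhat R Q \<sigma> ^ k \<sigma>"
        using \<sigma>(2) by (simp flip: power_add)
      then show ?thesis using fin \<sigma>(1) by (simp add: prod.remove[of \<Sigma> \<sigma>] mult_ac)
    qed
    moreover have "?p ?c * xhat R Q \<sigma> ^ k \<sigma> \<in> I" using pcox k[OF \<sigma>(1)] by (rule ideal_mult[OF I])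
    ultimately show ?case by simp
  next
    case (Suc n)
    let ?X = "\<Prod>j<n. b j"
    \<comment> \<open>The elements allowed in place of \<open>b n\<close> form an ideal, so it
      suffices to try the generators.\<close>
    let ?T = "{q \<in> cox. ?p c * q * ?X \<in> I}"
    have "semiring_ideal cox ?T"
      unfolding semiring_ideal_def
    proof (intro conjI ballI)
      show "?T \<noteq> {}" using zero_in_cox ideal_zero[OF I] by (auto intro!: exI[of _ 0])
      show "?T \<subseteq> cox" by blast
    next
      fix f g :: "'m laurent" assume fg: "f \<in> ?T" "g \<in> ?T"
      then have "?p c * f * ?X + ?p c * g * ?X \<in> I" by (intro ideal_add[OF I]) auto
      then show "f + g \<in> ?T" using fg by (auto simp: algebra_simps intro: cox_add)
    next
      fix r f :: "'m laurent" assume rf: "r \<in> cox" "f \<in> ?T"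
      then have "?p c * f * ?X \<in> I" by blast
      with rf(1) have "r * (?p c * f * ?X) \<in> I" by (rule ideal_mult[OF I])
      then show "r * f \<in> ?T" using rf by (auto simp: algebra_simps intro: cox_mult)
    qed
    moreover have "xhat R Q ` \<Sigma> \<subseteq> ?T"
    proof
      fix x assume "x \<in> xhat R Q ` \<Sigma>"
      then obtain \<sigma> where \<sigma>: "\<sigma> \<in> \<Sigma>" "x = xhat R Q \<sigma>" by blast
      let ?c = "c(\<sigma> := Suc (c \<sigma>))"
      have "sum ?c \<Sigma> = Suc (sum c \<Sigma>)" using fin \<sigma>(1) by (simp add: sum.remove[of \<Sigma> \<sigma>])
      then have "?p ?c * ?X \<in> I" using Suc.prems by (intro Suc.IH) auto
      moreover have "?p ?c = ?p c * x" using fin \<sigma> by (simp add: prod.remove[of \<Sigma> \<sigma>] algebra_simps)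
      ultimately show "x \<in> ?T" using \<sigma>(2) xc by simp
    qed
    ultimately have "?B \<subseteq> ?T" unfolding irrelevant_ideal_def by (rule hull_minimal[rotated])
    then have "b n \<in> ?T" using Suc.prems(1)[of n] by blast
    then show ?case by (simp add: algebra_simps)
  qed
  have "{(\<Prod>j<d. b j) | b. \<forall>j<d. b j \<in> ?B} \<subseteq> I"
    using main[of d _ "\<lambda>_. 0"] by auto
  then have "ideal_power cox ?B d \<subseteq> I" unfolding ideal_power_def using I by (intro hull_minimal)
  moreover have "d > 0" by (simp add: d_def)
  ultimately show ?thesis by blast
qed

lemma toric_nullstellensatz:
  fixes \<Sigma> :: "(real ^ 'n::finite) set set" and Q :: "int ^ 'n ^ 'm::finite"
  assumes \<Sigma>: "simplicial_fan \<Sigma>" and Q: "cox_matrix \<Sigma> R Q" and I: "locally_tropical \<Sigma> R Q I"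
  shows "toric_variety_of \<Sigma> R Q I = {} \<longleftrightarrow> (\<exists>d>0. ideal_power cox (irrelevant_ideal \<Sigma> R Q) d \<subseteq> I)"
proof -
  have fan: "fan \<Sigma>" and simp\<sigma>: "\<And>\<sigma>. \<sigma> \<in> \<Sigma> \<Longrightarrow> simplicial_cone \<sigma>" using \<Sigma> by (auto simp: simplicial_fan_def)
  have SI: "semiring_ideal cox I" and J: "\<And>\<sigma>. \<sigma> \<in> \<Sigma> \<Longrightarrow> tropical_ideal (dual_monomials \<sigma>) (chart_ideal R Q I \<sigma>)"
    using I by (auto simp: locally_tropical_def homogeneous_ideal_def)
  have inj: "\<And>u. Q *v u = 0 \<Longrightarrow> u = 0" using fan Q by (rule cox_matrix_inj)
  have empty_iff: "toric_variety_of \<Sigma> R Q I = {} \<longleftrightarrow> (\<forall>\<sigma>\<in>\<Sigma>. orbit_variety R Q I \<sigma> = {})"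
    by (auto simp: toric_variety_of_def)
  show ?thesis
  proof
    assume "toric_variety_of \<Sigma> R Q I = {}"
    then have e: "orbit_variety R Q I \<sigma> = {}" if "\<sigma> \<in> \<Sigma>" for \<sigma> using that empty_iff by blast
    have "\<exists>k. xhat R Q \<sigma> ^ k \<in> I" if "\<sigma> \<in> \<Sigma>" for \<sigma>
      using that
    \<comment> \<open>Each facet has one index fewer; for a cone without rays there are no facets to
      treat.\<close>
    proof (induction "card (cone_indices R Q \<sigma>)" arbitrary: \<sigma> rule: less_induct)
      case less
      note cone = simplicial_cone_facets[OF fan less.prems simp\<sigma>[OF less.prems] Q]
      have "\<exists>\<tau> k. cone_indices R Q \<tau> = cone_indices R Q \<sigma> - {i} \<and> xhat R Q \<tau> ^ k \<in> I"
        if i: "i \<in> cone_indices R Q \<sigma>" for i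
      proof -
        obtain \<tau> where \<tau>: "\<tau> \<in> \<Sigma>" "cone_indices R Q \<tau> = cone_indices R Q \<sigma> - {i}" using cone(2)[OF i] by blast
        have "card (cone_indices R Q \<tau>) < card (cone_indices R Q \<sigma>)"
          unfolding \<tau>(2) using i by (intro psubset_card_mono) auto
        then show ?thesis using less.hyps \<tau> by blast
      qed
      then have "1 \<in> chart_ideal R Q I \<sigma>"
        using orbit_variety_empty_imp[OF J[OF less.prems] cone(1) e[OF less.prems]]
        by (intro one_in_chart_ideal_step[OF J[OF less.prems] inj]) auto
      then show ?case by (rule one_in_chart_ideal_imp[OF SI])
    qed
    then show "\<exists>d>0. ideal_power cox (irrelevant_ideal \<Sigma> R Q) d \<subseteq> I"
      using fan by (intro irrelevant_power_subset SI) (auto simp: fan_def)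
  next
    assume "\<exists>d>0. ideal_power cox (irrelevant_ideal \<Sigma> R Q) d \<subseteq> I"
    then obtain d where d: "ideal_power cox (irrelevant_ideal \<Sigma> R Q) d \<subseteq> I" by blast
    have "orbit_variety R Q I \<sigma> = {}" if "\<sigma> \<in> \<Sigma>" for \<sigma>
    proof -
      \<comment> \<open>A power of a single generator suffices, since
        \<open>xhat R Q \<sigma>\<close> is a unit on its own chart.\<close>
      have "xhat R Q \<sigma> \<in> irrelevant_ideal \<Sigma> R Q" unfolding irrelevant_ideal_def using that by (intro hull_inc) auto
      then have "(\<Prod>k<d. xhat R Q \<sigma>) \<in> ideal_power cox (irrelevant_ideal \<Sigma> R Q) d"
        unfolding ideal_power_def by (intro hull_inc CollectI exI[of _ "\<lambda>_. xhat R Q \<sigma>"]) auto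
      then have "xhat R Q \<sigma> ^ d \<in> I" using d by auto
      with inj have "1 \<in> chart_ideal R Q I \<sigma>" by (rule one_in_chart_ideal)
      then show ?thesis by (rule one_in_chart_ideal_imp_empty)
    qed
    then show "toric_variety_of \<Sigma> R Q I = {}" using empty_iff by blast
  qed
qed

theorem theorem5p16:
  shows "(\<forall>I :: ('n :: finite) laurent set. tropical_ideal UNIV I \<longrightarrow>
            (torus_variety I = {} \<longleftrightarrow> I = semiring_ideal UNIV hull {1})) \<and>
         (\<forall>(\<Sigma> :: (real ^ 'n) set set) (R :: ('m :: finite) set) (Q :: int ^ 'n ^ 'm)
            (I :: 'm laurent set).
            simplicial_fan \<Sigma> \<and> cox_matrix \<Sigma> R Q \<and> locally_tropical \<Sigma> R Q I \<longrightarrow>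
            (toric_variety_of \<Sigma> R Q I = {} \<longleftrightarrow>
              (\<exists>d > 0. ideal_power cox (irrelevant_ideal \<Sigma> R Q) d \<subseteq> I)))"
proof (intro conjI allI impI)
  show "torus_variety I = {} \<longleftrightarrow> I = semiring_ideal UNIV hull {1}" if "tropical_ideal UNIV I" for I :: "'n laurent set"
    using that by (rule torus_nullstellensatz)
  show "toric_variety_of \<Sigma> R Q I = {} \<longleftrightarrow> (\<exists>d>0. ideal_power cox (irrelevant_ideal \<Sigma> R Q) d \<subseteq> I)"
    if "simplicial_fan \<Sigma> \<and> cox_matrix \<Sigma> R Q \<and> locally_tropical \<Sigma> R Q I"
    for \<Sigma> :: "(real ^ 'n) set set" and R :: "'m set" and Q :: "int ^ 'n ^ 'm" and I :: "'m laurent set"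
    using that by (intro toric_nullstellensatz) auto
qed

end
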